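(* Let $f\in S$ be a nonzero, non-unit bihomogeneous element of degree $(a,b)$ and let $R=S/fS$ be the hypersurface ring. Then $R$ has maximal depth with respect to $Q$ if and only if one of the following conditions holds (where $h_1,h_2,h_3$ denote bihomogeneous elements of $S$): (a) $f=h_1h_2h_3$ where $\deg h_1=(\alpha_1,0)$ with $\alpha_1>0$, $\deg h_2=(\alpha_2,\beta_1)$ with $\alpha_2,\beta_1>0$, $\deg h_3=(0,\beta_2)$ with $\beta_2>0$, and $\alpha_1+\alpha_2=a$, $\beta_1+\beta_2=b$; (b) $f=h_2h_3$ where $\deg h_2=(\alpha_2,\beta_1)$ with $a=\alpha_2>0$ and $\beta_1>0$, $\deg h_3=(0,\beta_2)$ with $\beta_2>0$, and $\beta_1+\beta_2=b$; (c) $f=h_1h_3$ where $\deg h_1=(a,0)$ with $a\ge 0$ and $\deg h_3=(0,b)$ with $b\ge 0$.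
   Context: $K$ is a field and $S=K[x_1,\dots,x_m,y_1,\dots,y_n]$ is the standard bigraded polynomial ring: $\deg x_i=(1,0)$, $\deg y_j=(0,1)$. Set $Q=(y_1,\dots,y_n)$. For a nonzero finitely generated bigraded $S$-module $N$, $\operatorname{cd}(Q,N)$ is the largest integer $i$ with $H^i_Q(N)\neq 0$, $\operatorname{grade}(Q,N)$ is the length of a maximal $N$-regular sequence in $Q$ (equivalently the smallest $i$ with $H^i_Q(N)\ne0$), and $\operatorname{mgrade}(Q,N)=\min\{\operatorname{cd}(Q,S/\mathfrak p):\mathfrak p\in\operatorname{Ass}(N)\}$. $N$ has maximal depth with respect to $Q$ if $\operatorname{grade}(Q,N)=\operatorname{mgrade}(Q,N)$. The ring $R$ is regarded as an $S$-module. *)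

theory Defs
  imports "HOL-Library.Poly_Mapping" "HOL-Library.Extended_Nat" "HOL-Algebra.QuotRing" "HOL-Algebra.Module"
begin

section \<open>Modules over a commutative ring\<close>

text \<open>A module in HOL-Algebra is a record that also carries the fields \<open>mult\<close> and \<open>one\<close>.
  They play no role for a module, and are left unspecified in the modules constructed below
  (except for quotient rings, where they are the ring operations).\<close>

definition nonzero_module :: "('a, 'b) module \<Rightarrow> bool"
  where "nonzero_module M \<longleftrightarrow> carrier M \<noteq> {\<zero>\<^bsub>M\<^esub>}"

text \<open>The quotient ring \<open>R/I\<close> of the library, as an \<open>R\<close>-module via \<open>R \<rightarrow> R/I\<close>.\<close>

definition quot_ring_module :: "'a ring \<Rightarrow> 'a set \<Rightarrow> ('a, 'a set) module"
  where "quot_ring_module R I =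
    \<lparr>carrier = carrier (R Quot I), mult = (\<otimes>\<^bsub>R Quot I\<^esub>), one = \<one>\<^bsub>R Quot I\<^esub>,
     zero = \<zero>\<^bsub>R Quot I\<^esub>, add = (\<oplus>\<^bsub>R Quot I\<^esub>),
     smult = (\<lambda>r A. (I +>\<^bsub>R\<^esub> r) \<otimes>\<^bsub>R Quot I\<^esub> A)\<rparr>"

text \<open>The quotient \<open>M/U\<close> of a module by a submodule, given as a set \<open>U\<close> of elements. The union
  in the scalar multiplication is over the representatives of a coset, all of which yield the
  same coset.\<close>

definition quot_module :: "('a, 'b) module \<Rightarrow> 'b set \<Rightarrow> ('a, 'b set) module"
  where "quot_module M U =
    \<lparr>carrier = a_rcosets\<^bsub>M\<^esub> U, mult = undefined, one = undefined,
     zero = U, add = (<+>\<^bsub>M\<^esub>),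
     smult = (\<lambda>r A. \<Union>x\<in>A. U +>\<^bsub>M\<^esub> (r \<odot>\<^bsub>M\<^esub> x))\<rparr>"

text \<open>The submodule \<open>(x\<^sub>1, \<dots>, x\<^sub>k)M\<close>.\<close>

definition list_submodule :: "'a list \<Rightarrow> ('a, 'b) module \<Rightarrow> 'b set"
  where "list_submodule xs M =
    {(\<Oplus>\<^bsub>M\<^esub>j\<in>{..<length xs}. (xs ! j) \<odot>\<^bsub>M\<^esub> v j) | v. v \<in> {..<length xs} \<rightarrow> carrier M}"

definition nonzerodivisor_on :: "'a \<Rightarrow> ('a, 'b) module \<Rightarrow> bool"
  where "nonzerodivisor_on x M \<longleftrightarrow>
    (\<forall>v\<in>carrier M. x \<odot>\<^bsub>M\<^esub> v = \<zero>\<^bsub>M\<^esub> \<longrightarrow> v = \<zero>\<^bsub>M\<^esub>)"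

definition regular_sequence :: "'a ring \<Rightarrow> ('a, 'b) module \<Rightarrow> 'a list \<Rightarrow> bool"
  where "regular_sequence R M xs \<longleftrightarrow>
    set xs \<subseteq> carrier R \<and>
    (\<forall>i<length xs. nonzerodivisor_on (xs ! i) (quot_module M (list_submodule (take i xs) M))) \<and>
    nonzero_module (quot_module M (list_submodule xs M))"

text \<open>The length of a maximal \<open>M\<close>-regular sequence in the ideal \<open>Q\<close>. Over a Noetherian ring, for
  \<open>M\<close> finitely generated with \<open>QM \<noteq> M\<close>, all maximal ones have the same length, which is then
  the supremum of all lengths.\<close>

definition grade :: "'a ring \<Rightarrow> 'a set \<Rightarrow> ('a, 'b) module \<Rightarrow> enat"
  where "grade R Q M = (SUP xs\<in>{xs. set xs \<subseteq> Q \<and> regular_sequence R M xs}. enat (length xs))"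

definition annihilator :: "'a ring \<Rightarrow> ('a, 'b) module \<Rightarrow> 'b \<Rightarrow> 'a set"
  where "annihilator R M v = {r \<in> carrier R. r \<odot>\<^bsub>M\<^esub> v = \<zero>\<^bsub>M\<^esub>}"

definition associated_primes :: "'a ring \<Rightarrow> ('a, 'b) module \<Rightarrow> 'a set set"
  where "associated_primes R M = {P. primeideal P R \<and> (\<exists>v\<in>carrier M. P = annihilator R M v)}"

section \<open>Localization\<close>

text \<open>The fraction \<open>v/w\<close> in \<open>W\<^sup>-\<^sup>1M\<close>, as the equivalence class of the pair \<open>(v, w)\<close>.\<close>

definition frac_class :: "'a ring \<Rightarrow> 'a set \<Rightarrow> ('a, 'b) module \<Rightarrow> 'b \<Rightarrow> 'a \<Rightarrow> ('b \<times> 'a) set"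
  where "frac_class R W M v w =
    {(v', w'). v' \<in> carrier M \<and> w' \<in> W \<and>
      (\<exists>u\<in>W. (u \<otimes>\<^bsub>R\<^esub> w') \<odot>\<^bsub>M\<^esub> v = (u \<otimes>\<^bsub>R\<^esub> w) \<odot>\<^bsub>M\<^esub> v')}"

text \<open>As for quotients, each union is over all representatives of the given fractions, and all
  its members coincide.\<close>

definition localization :: "'a ring \<Rightarrow> 'a set \<Rightarrow> ('a, 'b) module \<Rightarrow> ('a, ('b \<times> 'a) set) module"
  where "localization R W M =
    \<lparr>carrier = {frac_class R W M v w | v w. v \<in> carrier M \<and> w \<in> W},
     mult = undefined, one = undefined,
     zero = frac_class R W M \<zero>\<^bsub>M\<^esub> \<one>\<^bsub>R\<^esub>,
     add = (\<lambda>A B. \<Union>(v, w)\<in>A. \<Union>(v', w')\<in>B.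
       frac_class R W M (w' \<odot>\<^bsub>M\<^esub> v \<oplus>\<^bsub>M\<^esub> w \<odot>\<^bsub>M\<^esub> v') (w \<otimes>\<^bsub>R\<^esub> w')),
     smult = (\<lambda>r A. \<Union>(v, w)\<in>A. frac_class R W M (r \<odot>\<^bsub>M\<^esub> v) w)\<rparr>"

text \<open>The canonical map \<open>W\<^sub>0\<^sup>-\<^sup>1M \<rightarrow> W\<^sup>-\<^sup>1M\<close>, \<open>v/w \<mapsto> v/w\<close>, for \<open>W\<^sub>0 \<subseteq> W\<close>.\<close>

definition localization_map ::
    "'a ring \<Rightarrow> 'a set \<Rightarrow> ('a, 'b) module \<Rightarrow> ('b \<times> 'a) set \<Rightarrow> ('b \<times> 'a) set"
  where "localization_map R W M A = (\<Union>(v, w)\<in>A. frac_class R W M v w)"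

section \<open>Local cohomology\<close>

text \<open>The local cohomology of \<open>M\<close> with respect to the ideal generated by \<open>ys = [y\<^sub>0, \<dots>, y\<^sub>n\<^sub>-\<^sub>1]\<close>
  is the cohomology of the (extended) Cech complex
  \<open>0 \<rightarrow> M \<rightarrow> \<Oplus>\<^sub>i M\<^bsub>y\<^sub>i\<^esub> \<rightarrow> \<Oplus>\<^bsub>i<j\<^esub> M\<^bsub>y\<^sub>i y\<^sub>j\<^esub> \<rightarrow> \<dots> \<rightarrow> M\<^bsub>y\<^sub>0 \<dots> y\<^sub>n\<^sub>-\<^sub>1\<^esub> \<rightarrow> 0\<close>.
  For an index set \<open>I\<close>, the localization of \<open>M\<close> at the product of the \<open>y\<^sub>i\<close> with \<open>i \<in> I\<close> is taken
  at the multiplicative set of all monomials in these \<open>y\<^sub>i\<close>.\<close>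

definition cech_denominators :: "'a ring \<Rightarrow> 'a list \<Rightarrow> nat set \<Rightarrow> 'a set"
  where "cech_denominators R ys I = {(\<Otimes>\<^bsub>R\<^esub>i\<in>I. (ys ! i) [^]\<^bsub>R\<^esub> (e i :: nat)) | e. True}"

definition cech_local ::
    "'a ring \<Rightarrow> 'a list \<Rightarrow> ('a, 'b) module \<Rightarrow> nat set \<Rightarrow> ('a, ('b \<times> 'a) set) module"
  where "cech_local R ys M I = localization R (cech_denominators R ys I) M"

definition cech_indices :: "'a list \<Rightarrow> nat \<Rightarrow> nat set set"
  where "cech_indices ys i = {I. I \<subseteq> {..<length ys} \<and> card I = i}"

definition cech_module ::
    "'a ring \<Rightarrow> 'a list \<Rightarrow> ('a, 'b) module \<Rightarrow> nat \<Rightarrow> ('a, nat set \<Rightarrow> ('b \<times> 'a) set) module"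
  where "cech_module R ys M i =
    \<lparr>carrier = (\<Pi>\<^sub>E I\<in>cech_indices ys i. carrier (cech_local R ys M I)),
     mult = undefined, one = undefined,
     zero = (\<lambda>I\<in>cech_indices ys i. \<zero>\<^bsub>cech_local R ys M I\<^esub>),
     add = (\<lambda>c d. \<lambda>I\<in>cech_indices ys i. c I \<oplus>\<^bsub>cech_local R ys M I\<^esub> d I),
     smult = (\<lambda>r c. \<lambda>I\<in>cech_indices ys i. r \<odot>\<^bsub>cech_local R ys M I\<^esub> c I)\<rparr>"

definition cech_diff ::
    "'a ring \<Rightarrow> 'a list \<Rightarrow> ('a, 'b) module \<Rightarrow> nat \<Rightarrow>
     (nat set \<Rightarrow> ('b \<times> 'a) set) \<Rightarrow> (nat set \<Rightarrow> ('b \<times> 'a) set)"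
  where "cech_diff R ys M i c =
    (\<lambda>J\<in>cech_indices ys (Suc i).
      \<Oplus>\<^bsub>cech_local R ys M J\<^esub>j\<in>J.
        [((- 1 :: int) ^ card {k \<in> J. k < j})] \<cdot>\<^bsub>cech_local R ys M J\<^esub>
          localization_map R (cech_denominators R ys J) M (c (J - {j})))"

definition cech_cocycles ::
    "'a ring \<Rightarrow> 'a list \<Rightarrow> ('a, 'b) module \<Rightarrow> nat \<Rightarrow> (nat set \<Rightarrow> ('b \<times> 'a) set) set"
  where "cech_cocycles R ys M i =
    {c \<in> carrier (cech_module R ys M i). cech_diff R ys M i c = \<zero>\<^bsub>cech_module R ys M (Suc i)\<^esub>}"

fun cech_coboundaries ::
    "'a ring \<Rightarrow> 'a list \<Rightarrow> ('a, 'b) module \<Rightarrow> nat \<Rightarrow> (nat set \<Rightarrow> ('b \<times> 'a) set) set"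
  where
    "cech_coboundaries R ys M 0 = {\<zero>\<^bsub>cech_module R ys M 0\<^esub>}"
  | "cech_coboundaries R ys M (Suc i) = cech_diff R ys M i ` carrier (cech_module R ys M i)"

definition local_cohomology ::
    "'a ring \<Rightarrow> 'a list \<Rightarrow> ('a, 'b) module \<Rightarrow> nat \<Rightarrow> ('a, (nat set \<Rightarrow> ('b \<times> 'a) set) set) module"
  where "local_cohomology R ys M i =
    quot_module ((cech_module R ys M i)\<lparr>carrier := cech_cocycles R ys M i\<rparr>)
      (cech_coboundaries R ys M i)"

text \<open>The set of indices below is bounded by \<open>length ys\<close>, so the supremum is a maximum as soon as
  some local cohomology module is nonzero.\<close>

definition cd :: "'a ring \<Rightarrow> 'a list \<Rightarrow> ('a, 'b) module \<Rightarrow> enat"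
  where "cd R ys M = (SUP i\<in>{i. nonzero_module (local_cohomology R ys M i)}. enat i)"

definition mgrade :: "'a ring \<Rightarrow> 'a list \<Rightarrow> ('a, 'b) module \<Rightarrow> enat"
  where "mgrade R ys M = (INF P\<in>associated_primes R M. cd R ys (quot_ring_module R P))"

text \<open>Maximal depth with respect to the ideal generated by \<open>ys\<close>.\<close>

definition has_maximal_depth :: "'a ring \<Rightarrow> 'a list \<Rightarrow> ('a, 'b) module \<Rightarrow> bool"
  where "has_maximal_depth R ys M \<longleftrightarrow> grade R (Idl\<^bsub>R\<^esub> (set ys)) M = mgrade R ys M"

section \<open>The bigraded polynomial ring\<close>

text \<open>Polynomials in countably many variables; a monomial is its finitely supported exponent
  function. In \<open>K[x\<^sub>1, \<dots>, x\<^sub>m, y\<^sub>1, \<dots>, y\<^sub>n]\<close> the variables with indices \<open>0, \<dots>, m - 1\<close> are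
  the \<open>x\<^sub>i\<close>, and those with indices \<open>m, \<dots>, m + n - 1\<close> are the \<open>y\<^sub>j\<close>.\<close>

type_synonym 'k mpoly = "(nat \<Rightarrow>\<^sub>0 nat) \<Rightarrow>\<^sub>0 'k"

definition bipoly_ring :: "nat \<Rightarrow> nat \<Rightarrow> 'k::field mpoly ring"
  where "bipoly_ring m n =
    \<lparr>carrier = {p. \<forall>t\<in>Poly_Mapping.keys p. Poly_Mapping.keys t \<subseteq> {..<m + n}},
     mult = (*), one = 1, zero = 0, add = (+)\<rparr>"

definition y_vars :: "nat \<Rightarrow> nat \<Rightarrow> 'k::field mpoly list"
  where "y_vars m n =
    map (\<lambda>j. Poly_Mapping.single (Poly_Mapping.single (m + j) 1) 1) [0..<n]"

text \<open>Membership in the graded component of degree \<open>(a, b)\<close>, which contains \<open>0\<close>.\<close>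

definition bihomogeneous :: "nat \<Rightarrow> nat \<Rightarrow> nat \<times> nat \<Rightarrow> 'k::field mpoly \<Rightarrow> bool"
  where "bihomogeneous m n d p \<longleftrightarrow>
    p \<in> carrier (bipoly_ring m n) \<and>
    (\<forall>t\<in>Poly_Mapping.keys p.
      ((\<Sum>i<m. Poly_Mapping.lookup t i), (\<Sum>j<n. Poly_Mapping.lookup t (m + j))) = d)"

end

theory Submission
  imports Defs "HOL-Computational_Algebra.Polynomial"
begin

text \<open>
  Both sides say that \<open>b = 0\<close> or that \<open>f\<close> has a factor of degree \<open>(0, \<beta>)\<close> with \<open>\<beta> > 0\<close>.
  Indeed \<open>grade(Q, S/f)\<close> is \<open>n\<close> if \<open>b = 0\<close>, and \<open>n - 1\<close> otherwise, since then \<open>f \<in> Q\<close>. As \<open>S\<close> is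
  factorial, the associated primes of \<open>S/f\<close> are the \<open>(p)\<close> for the prime factors \<open>p\<close> of \<open>f\<close>, which
  are bihomogeneous. Multiplication by \<open>p\<close> on \<open>H\<^sup>n\<^sub>Q(S)\<close>, the span of the Laurent monomials with
  negative exponents in all \<open>y\<^sub>j\<close>, has cokernel \<open>H\<^sup>n\<^sub>Q(S/p)\<close>. It does not reach
  \<open>1/(y\<^sub>1 \<dots> y\<^sub>n)\<close> if \<open>p\<close> lies in \<open>(x\<^sub>1, \<dots>, x\<^sub>m)\<close>, so that \<open>cd(Q, S/p) = n\<close>. If instead \<open>p\<close> has
  degree \<open>(0, \<beta>)\<close>, it is surjective, and it kills \<open>1/(y\<^sub>1 \<dots> y\<^sub>n)\<close>, which gives a nonzero element of
  \<open>H\<^sup>n\<^sup>-\<^sup>1\<^sub>Q(S/p)\<close>; so then \<open>cd(Q, S/p) = n - 1\<close>.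
\<close>

text \<open>The upper bounds for the grade come from counting. If more than n elements of Q formed a
  regular sequence, their power products with exponents in a large box would outnumber the monomials
  in the y_j that can occur in them; this forces a relation over K[x] that regularity forbids. For b
  > 0, f itself is put in front of the sequence, which costs one place. For the lower bounds, K may
  be finite, so that suitable linear forms in the y_j may be missing; elements y_j minus a power of
  y_l are used instead, since a nonzero polynomial has only finitely many roots among the powers of
  y_l. On the cohomological side, all localizations of S at monomials in the y_j lie side by side in
  one ring of Laurent polynomials, where the maps of the Cech complex are inclusions up to sign. A
  cochain over S/I is then a family of Laurent polynomials modulo the localizations of I, and
  nonvanishing is seen on a single coefficient, that of 1/(y_1 ... y_n).\<close>

abbreviation (input) "lookup \<equiv> Poly_Mapping.lookup"
abbreviation (input) "keys \<equiv> Poly_Mapping.keys"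
abbreviation (input) "single \<equiv> Poly_Mapping.single"

section \<open>Homomorphisms out of a polynomial ring\<close>

lemma pm_eq_sum_single:
  "(p :: 'a \<Rightarrow>\<^sub>0 'b::comm_monoid_add) = (\<Sum>s\<in>keys p. single s (lookup p s))"
proof (rule poly_mapping_eqI)
  fix k
  have "lookup (\<Sum>s\<in>keys p. single s (lookup p s)) k = (\<Sum>s\<in>keys p. (lookup p s when s = k))"
    by (simp add: lookup_sum lookup_single)
  also have "\<dots> = (\<Sum>s\<in>keys p. if s = k then lookup p s else 0)"
    by (rule sum.cong) (auto simp: when_def)
  also have "\<dots> = lookup p k"
    by (simp add: sum.delta not_in_keys_iff_lookup_eq_zero)
  finally show "lookup p k = lookup (\<Sum>s\<in>keys p. single s (lookup p s)) k" by simp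
qed

lemma pm_induct [case_names single add]:
  fixes p :: "'a \<Rightarrow>\<^sub>0 'b::comm_monoid_add"
  assumes "\<And>s c. P (single s c)" and "\<And>p q. P p \<Longrightarrow> P q \<Longrightarrow> P (p + q)"
  shows "P p"
proof -
  have P0: "P 0" using assms(1)[of undefined 0] by simp
  have "P (\<Sum>s\<in>A. single s (lookup p s))" if "finite A" for A
    using that by (induction A rule: finite_induct) (auto simp: assms P0)
  then show ?thesis by (metis finite_keys pm_eq_sum_single)
qed

definition pm_eval :: "('b::zero \<Rightarrow> 'r::comm_ring_1) \<Rightarrow> ('a \<Rightarrow> 'r) \<Rightarrow> ('a \<Rightarrow>\<^sub>0 'b) \<Rightarrow> 'r"
  where "pm_eval \<kappa> \<mu> p = (\<Sum>s\<in>keys p. \<kappa> (lookup p s) * \<mu> s)"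

text \<open>Recording a degree, isolating one variable, setting variables to zero and embedding into
  Laurent polynomials are all maps of this form, so that their additivity and multiplicativity are
  proved once.\<close>

locale pm_hom =
  fixes \<kappa> :: "'b::comm_ring_1 \<Rightarrow> 'r::comm_ring_1" and \<mu> :: "'a::comm_monoid_add \<Rightarrow> 'r"
  assumes coeff_zero: "\<kappa> 0 = 0" and coeff_one: "\<kappa> 1 = 1"
    and coeff_add: "\<And>a b. \<kappa> (a + b) = \<kappa> a + \<kappa> b"
    and coeff_mult: "\<And>a b. \<kappa> (a * b) = \<kappa> a * \<kappa> b"
    and mon_zero: "\<mu> 0 = 1" and mon_add: "\<And>s t. \<mu> (s + t) = \<mu> s * \<mu> t"
begin

lemma eval_superset:
  assumes "finite A" "keys p \<subseteq> A"
  shows "pm_eval \<kappa> \<mu> p = (\<Sum>s\<in>A. \<kappa> (lookup p s) * \<mu> s)"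
  unfolding pm_eval_def using assms
  by (intro sum.mono_neutral_left) (auto simp: coeff_zero not_in_keys_iff_lookup_eq_zero)

lemma eval_single: "pm_eval \<kappa> \<mu> (single s c) = \<kappa> c * \<mu> s"
  by (subst eval_superset[of "{s}"]) auto

lemma eval_0: "pm_eval \<kappa> \<mu> 0 = 0"
  by (simp add: pm_eval_def)

lemma eval_1: "pm_eval \<kappa> \<mu> 1 = 1"
  using eval_single[of 0 1] by (simp add: coeff_one mon_zero)

lemma eval_add: "pm_eval \<kappa> \<mu> (p + q) = pm_eval \<kappa> \<mu> p + pm_eval \<kappa> \<mu> q"
proof -
  let ?A = "keys p \<union> keys q"
  have "pm_eval \<kappa> \<mu> (p + q) = (\<Sum>s\<in>?A. \<kappa> (lookup (p + q) s) * \<mu> s)"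
    by (rule eval_superset) (auto dest: set_mp[OF keys_add])
  also have "\<dots> = (\<Sum>s\<in>?A. \<kappa> (lookup p s) * \<mu> s) + (\<Sum>s\<in>?A. \<kappa> (lookup q s) * \<mu> s)"
    by (simp add: lookup_add coeff_add distrib_right sum.distrib)
  finally show ?thesis by (simp add: eval_superset[of ?A])
qed

lemma eval_mult: "pm_eval \<kappa> \<mu> (p * q) = pm_eval \<kappa> \<mu> p * pm_eval \<kappa> \<mu> q"
proof (induction p rule: pm_induct)
  case (single s c)
  show ?case
  proof (induction q rule: pm_induct)
    case (single t d)
    show ?case by (simp add: mult_single eval_single coeff_mult mon_add)
  qed (simp add: distrib_left eval_add)
qed (simp add: distrib_right eval_add)

lemma eval_uminus: "pm_eval \<kappa> \<mu> (- p) = - pm_eval \<kappa> \<mu> p"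
  using eval_add[of "- p" p] by (simp add: eval_0 eq_neg_iff_add_eq_0)

lemma eval_diff: "pm_eval \<kappa> \<mu> (p - q) = pm_eval \<kappa> \<mu> p - pm_eval \<kappa> \<mu> q"
  using eval_add[of p "- q"] by (simp add: eval_uminus)

lemma eval_sum: "pm_eval \<kappa> \<mu> (\<Sum>i\<in>I. p i) = (\<Sum>i\<in>I. pm_eval \<kappa> \<mu> (p i))"
  by (induction I rule: infinite_finite_induct) (auto simp: eval_0 eval_add)

end

section \<open>Variables and gradings\<close>

definition pvar :: "nat \<Rightarrow> 'k::field mpoly"
  where "pvar i = single (single i 1) 1"

lemma pvar_power: "pvar i ^ k = single (single i k) 1"
  by (induction k) (auto simp: pvar_def mult_single simp flip: single_add)

text \<open>Records the weight \<open>w s\<close> of each monomial \<open>s\<close> as the power of a new variable, and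
  replaces the monomial by \<open>\<rho> s\<close>.\<close>

definition grade_hom ::
    "((nat \<Rightarrow>\<^sub>0 nat) \<Rightarrow> (nat \<Rightarrow>\<^sub>0 nat)) \<Rightarrow> ((nat \<Rightarrow>\<^sub>0 nat) \<Rightarrow> nat) \<Rightarrow> 'k::field mpoly \<Rightarrow> 'k mpoly poly"
  where "grade_hom \<rho> w = pm_eval (\<lambda>c. [:single 0 c:]) (\<lambda>s. monom (single (\<rho> s) 1) (w s))"

text \<open>Two kinds of instances matter: \<open>\<rho>\<close> the identity and \<open>w\<close> a
  partial degree, where the coefficients of the image are the homogeneous components; and
  \<open>\<rho>\<close> deleting the variable t with \<open>w\<close> its exponent, which presents
  the ring as a polynomial ring in t.\<close>

locale grading =
  fixes \<rho> :: "(nat \<Rightarrow>\<^sub>0 nat) \<Rightarrow> (nat \<Rightarrow>\<^sub>0 nat)" and w :: "(nat \<Rightarrow>\<^sub>0 nat) \<Rightarrow> nat"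
  assumes \<rho>_zero: "\<rho> 0 = 0" and \<rho>_add: "\<And>s t. \<rho> (s + t) = \<rho> s + \<rho> t"
    and w_zero: "w 0 = 0" and w_add: "\<And>s t. w (s + t) = w s + w t"
begin

sublocale H: pm_hom "\<lambda>c::'k::field. [:single 0 c:]"
    "\<lambda>s. monom (single (\<rho> s) 1) (w s) :: 'k mpoly poly"
  by standard
    (auto simp: \<rho>_zero \<rho>_add w_zero w_add single_add mult_single mult_monom add_monom simp flip: monom_0)

abbreviation (input) H :: "'k::field mpoly \<Rightarrow> 'k mpoly poly" where "H \<equiv> grade_hom \<rho> w"

lemmas H_0 = H.eval_0[folded grade_hom_def]
lemmas H_1 = H.eval_1[folded grade_hom_def]
lemmas H_add = H.eval_add[folded grade_hom_def]
lemmas H_mult = H.eval_mult[folded grade_hom_def]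
lemmas H_diff = H.eval_diff[folded grade_hom_def]

lemma H_single: "H (single s c) = monom (single (\<rho> s) c) (w s)"
  unfolding grade_hom_def H.eval_single by (simp add: smult_monom mult_single)

lemma coeff_H: "coeff (H p) i = (\<Sum>s\<in>{s \<in> keys p. w s = i}. single (\<rho> s) (lookup p s))"
proof -
  have "coeff (H p) i = (\<Sum>s\<in>keys p. if w s = i then single (\<rho> s) (lookup p s) else 0)"
    unfolding grade_hom_def pm_eval_def
    by (auto simp: coeff_sum smult_monom mult_single intro!: sum.cong)
  then show ?thesis by (simp add: sum.inter_filter)
qed

end

section \<open>Polynomials in a given set of variables\<close>

text \<open>The ring K[V] inside one ring with countably many variables, so that adding or removing
  variables changes no types.\<close>

definition polys_in :: "nat set \<Rightarrow> 'k::field mpoly set"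
  where "polys_in V = {p. \<forall>s\<in>keys p. keys s \<subseteq> V}"

lemma polys_in_single: "keys s \<subseteq> V \<Longrightarrow> single s c \<in> polys_in V"
  by (auto simp: polys_in_def split: if_splits)

lemma polys_in_0 [simp]: "0 \<in> polys_in V"
  by (simp add: polys_in_def)

lemma polys_in_1 [simp]: "1 \<in> polys_in V"
  using polys_in_single[of 0 V 1] by simp

lemma polys_in_add: "p \<in> polys_in V \<Longrightarrow> q \<in> polys_in V \<Longrightarrow> p + q \<in> polys_in V"
  unfolding polys_in_def using keys_add[of p q] by blast

lemma polys_in_uminus [simp]: "- p \<in> polys_in V \<longleftrightarrow> p \<in> polys_in V"
  by (auto simp: polys_in_def in_keys_iff)

lemma polys_in_diff: "p \<in> polys_in V \<Longrightarrow> q \<in> polys_in V \<Longrightarrow> p - q \<in> polys_in V"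
  using polys_in_add[of p V "- q"] by simp

lemma keys_add_nat: "keys (s + t :: nat \<Rightarrow>\<^sub>0 nat) = keys s \<union> keys t"
  by (auto simp: in_keys_iff lookup_add)

lemma polys_in_mult: "p \<in> polys_in V \<Longrightarrow> q \<in> polys_in V \<Longrightarrow> p * q \<in> polys_in V"
  unfolding polys_in_def using keys_mult[of p q] by (fastforce simp: keys_add_nat)

lemma polys_in_power: "p \<in> polys_in V \<Longrightarrow> p ^ k \<in> polys_in V"
  by (induction k) (auto intro: polys_in_mult)

lemma polys_in_sum: "(\<And>i. i \<in> I \<Longrightarrow> p i \<in> polys_in V) \<Longrightarrow> (\<Sum>i\<in>I. p i) \<in> polys_in V"
  by (induction I rule: infinite_finite_induct) (auto intro: polys_in_add)

lemma polys_in_mono: "V \<subseteq> W \<Longrightarrow> polys_in V \<subseteq> polys_in W"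
  by (auto simp: polys_in_def)

lemma pvar_in: "i \<in> V \<Longrightarrow> pvar i \<in> polys_in V"
  unfolding pvar_def by (rule polys_in_single) auto

lemma ex_polys_in: "\<exists>V. finite V \<and> p \<in> polys_in V"
  by (rule exI[of _ "\<Union>s\<in>keys p. keys s"]) (auto simp: polys_in_def)

lemma polys_in_poly:
  "(\<And>i. coeff F i \<in> polys_in V) \<Longrightarrow> u \<in> polys_in V \<Longrightarrow> poly F u \<in> polys_in V"
  unfolding poly_altdef by (intro polys_in_sum polys_in_mult polys_in_power)

section \<open>Polynomials as univariate polynomials in one of the variables\<close>

definition rest_of :: "nat \<Rightarrow> (nat \<Rightarrow>\<^sub>0 nat) \<Rightarrow> (nat \<Rightarrow>\<^sub>0 nat)"
  where "rest_of t s = Poly_Mapping.update t 0 s"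

lemma lookup_rest_of: "lookup (rest_of t s) i = (if i = t then 0 else lookup s i)"
  by (simp add: rest_of_def lookup_update)

lemma keys_rest_of: "keys (rest_of t s) = keys s - {t}"
  by (auto simp: in_keys_iff lookup_rest_of split: if_splits)

lemma rest_of_plus: "rest_of t s + single t (lookup s t) = s"
  by (rule poly_mapping_eqI) (auto simp: lookup_add lookup_rest_of lookup_single when_def)

interpretation uni: grading "rest_of t" "\<lambda>s. lookup s t" for t
  by standard (auto intro!: poly_mapping_eqI simp: lookup_rest_of lookup_add)

definition to_uni :: "nat \<Rightarrow> 'k::field mpoly \<Rightarrow> 'k mpoly poly"
  where "to_uni t = grade_hom (rest_of t) (\<lambda>s. lookup s t)"

lemmas to_uni_0 [simp] = uni.H_0[folded to_uni_def]
lemmas to_uni_1 [simp] = uni.H_1[folded to_uni_def]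
lemmas to_uni_add = uni.H_add[folded to_uni_def]
lemmas to_uni_mult = uni.H_mult[folded to_uni_def]
lemmas to_uni_diff = uni.H_diff[folded to_uni_def]
lemmas to_uni_single = uni.H_single[folded to_uni_def]
lemmas coeff_to_uni = uni.coeff_H[folded to_uni_def]

lemma poly_to_uni [simp]: "poly (to_uni t p) (pvar t) = p"
  by (induction p rule: pm_induct)
    (auto simp: to_uni_single poly_monom pvar_power mult_single rest_of_plus to_uni_add)

lemma to_uni_eq_0_iff [simp]: "to_uni t p = 0 \<longleftrightarrow> p = 0"
  by (metis poly_0 poly_to_uni to_uni_0)

lemma coeff_to_uni_in: "p \<in> polys_in V \<Longrightarrow> coeff (to_uni t p) i \<in> polys_in (V - {t})"
  unfolding coeff_to_uni
  by (intro polys_in_sum polys_in_single) (auto simp: polys_in_def keys_rest_of)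

lemma to_uni_const:
  assumes "p \<in> polys_in V" "t \<notin> V"
  shows "to_uni t p = [:p:]"
proof (rule poly_eqI)
  fix i
  have "lookup s t = 0 \<and> rest_of t s = s" if "s \<in> keys p" for s
  proof -
    have "t \<notin> keys s" using that assms by (auto simp only: polys_in_def)
    then have "lookup s t = 0" by (simp add: in_keys_iff)
    then show ?thesis using rest_of_plus[of t s] by simp
  qed
  then have "coeff (to_uni t p) i = (\<Sum>s\<in>{s \<in> keys p. 0 = i}. single s (lookup p s))"
    unfolding coeff_to_uni by (intro sum.cong) auto
  also have "\<dots> = (if i = 0 then p else 0)"
    by (simp flip: pm_eq_sum_single)
  finally show "coeff (to_uni t p) i = coeff [:p:] i"
    by (cases i) auto
qed

lemma to_uni_degree_0: "degree (to_uni t p) = 0 \<Longrightarrow> p \<in> polys_in V \<Longrightarrow> p \<in> polys_in (V - {t})"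
proof -
  assume "degree (to_uni t p) = 0" and p: "p \<in> polys_in V"
  then obtain c where c: "to_uni t p = [:c:]" by (elim degree_eq_zeroE)
  then have "p = c" using poly_to_uni[of t p] by simp
  then show ?thesis using coeff_to_uni_in[OF p, of t 0] c by simp
qed

lemma to_uni_pvar: "to_uni t (pvar t) = [:0, 1:]"
proof -
  have "rest_of t (single t 1) = 0"
    by (rule poly_mapping_eqI) (auto simp: lookup_rest_of lookup_single)
  then show ?thesis
    by (simp add: pvar_def to_uni_single monom_altdef)
qed

text \<open>The degree in t is additive over a domain, so both factors of a nonzero polynomial free
  of t have degree 0 in t.\<close>

lemma polys_in_factor_remove:
  assumes "p * q \<in> polys_in V" "p * q \<noteq> 0" "t \<notin> V" "p \<in> polys_in W"
  shows "p \<in> polys_in (W - {t})"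
proof -
  have "degree (to_uni t p * to_uni t q) = 0"
    using to_uni_const[OF assms(1,3)] by (simp add: to_uni_mult)
  then have "degree (to_uni t p) = 0"
    using assms(2) by (subst (asm) degree_mult_eq) auto
  then show ?thesis using assms(4) by (rule to_uni_degree_0)
qed

text \<open>A polynomial involves finitely many variables, and those outside V are discarded one at
  a time. This is why \<open>dvd\<close> in the ring of all variables also expresses divisibility
  within K[V].\<close>

lemma polys_in_factor:
  assumes "p * q \<in> polys_in V" "p * q \<noteq> 0"
  shows "p \<in> polys_in V"
proof -
  obtain W where W: "finite W" "p \<in> polys_in W" using ex_polys_in by blast
  have "p \<in> polys_in (W - U)" if "finite U" "U \<inter> V = {}" for U
    using that
  proof (induction U rule: finite_induct)
    case (insert t U)
    then have "p \<in> polys_in (W - U - {t})"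
      by (intro polys_in_factor_remove[OF assms]) auto
    then show ?case by (subst Diff_insert)
  qed (use W in auto)
  from this[of "W - V"] W have "p \<in> polys_in (W - (W - V))" by auto
  then show ?thesis by (auto simp: polys_in_def)
qed

lemma polys_in_dvd: "p dvd f \<Longrightarrow> f \<noteq> 0 \<Longrightarrow> f \<in> polys_in V \<Longrightarrow> p \<in> polys_in V"
  using polys_in_factor by (metis dvdE)

lemma polys_in_quot: "f = p * q \<Longrightarrow> f \<noteq> 0 \<Longrightarrow> f \<in> polys_in V \<Longrightarrow> q \<in> polys_in V"
  by (metis polys_in_dvd dvd_triv_right)

section \<open>Unique factorization\<close>

text \<open>Taken as the degree of the graded image, it inherits additivity on products from
  univariate polynomials over a domain. It serves to recognize units and as an induction
  measure.\<close>

definition deg_on :: "nat set \<Rightarrow> 'k::field mpoly \<Rightarrow> nat"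
  where "deg_on V p = degree (grade_hom (\<lambda>s. s) (\<lambda>s. \<Sum>i\<in>V. lookup s i) p)"

lemma grading_sum: "grading (\<lambda>s. s) (\<lambda>s. \<Sum>i\<in>V. lookup s i)"
  by standard (auto simp: lookup_add sum.distrib)

lemma poly_grade_hom_1:
  assumes "grading (\<lambda>s. s) w"
  shows "poly (grade_hom (\<lambda>s. s) w p) 1 = p"
proof -
  interpret grading "\<lambda>s. s" w by fact
  show ?thesis by (induction p rule: pm_induct) (auto simp: H_single H_add poly_monom)
qed

lemma deg_on_mult: "p \<noteq> 0 \<Longrightarrow> q \<noteq> 0 \<Longrightarrow> deg_on V (p * q) = deg_on V p + deg_on V q"
  unfolding deg_on_def grading.H_mult[OF grading_sum]
  by (rule degree_mult_eq) (metis poly_0 poly_grade_hom_1 grading_sum)+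

lemma deg_on_0_const:
  assumes "p \<in> polys_in V" "finite V" "deg_on V p = 0"
  shows "\<exists>c. p = single 0 c"
proof -
  let ?w = "\<lambda>s. \<Sum>i\<in>V. lookup s i"
  interpret grading "\<lambda>s. s" ?w by (rule grading_sum)
  obtain c where c: "H p = [:c:]"
    using assms(3) unfolding deg_on_def by (elim degree_eq_zeroE)
  then have "p = coeff (H p) 0"
    using poly_grade_hom_1[OF grading_sum, of V p] by simp
  also have "\<dots> = (\<Sum>s\<in>{s \<in> keys p. ?w s = 0}. single s (lookup p s))"
    by (simp add: coeff_H)
  also have "{s \<in> keys p. ?w s = 0} \<subseteq> {0}"
  proof
    fix s assume s: "s \<in> {s \<in> keys p. ?w s = 0}"
    then have "keys s \<subseteq> V" using assms(1) by (auto simp only: polys_in_def)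
    then have "lookup s i = 0" for i
      using s assms(2) by (cases "i \<in> V") (auto simp: in_keys_iff)
    then show "s \<in> {0}" by (simp add: poly_mapping_eqI)
  qed
  then have "(\<Sum>s\<in>{s \<in> keys p. ?w s = 0}. single s (lookup p s)) = (\<Sum>s\<in>{0}. single s (lookup p s))"
    by (intro sum.mono_neutral_left) (auto simp: in_keys_iff)
  finally show ?thesis by auto
qed

lemma const_dvd_1: "c \<noteq> 0 \<Longrightarrow> (single 0 c :: 'k::field mpoly) dvd 1"
  by (rule dvdI[of _ _ "single 0 (inverse c)"]) (simp add: mult_single)

lemma deg_on_0_unit:
  assumes "p \<in> polys_in V" "finite V" "deg_on V p = 0" "p \<noteq> 0"
  shows "p dvd 1"
  using deg_on_0_const[OF assms(1-3)] assms(4) const_dvd_1 by (metis single_zero)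

lemma deg_on_1: "deg_on V 1 = 0"
  unfolding deg_on_def by (simp add: grading.H_1[OF grading_sum])

lemma deg_on_unit: "p dvd 1 \<Longrightarrow> deg_on V p = 0"
  by (metis add_is_0 deg_on_1 deg_on_mult dvdE mult_zero_left mult_zero_right one_neq_zero)

lemma unit_const:
  assumes "(p::'k::field mpoly) dvd 1"
  shows "\<exists>c. p = single 0 c"
  using ex_polys_in deg_on_0_const deg_on_unit[OF assms] by metis

section \<open>Products of primes\<close>

lemma unit_mult: "u dvd 1 \<Longrightarrow> v dvd 1 \<Longrightarrow> u * v dvd (1 :: 'a::idom)"
  using mult_dvd_mono[of u 1 v 1] by simp

text \<open>A unit times finitely many prime elements: with primes in place of irreducibles,
  uniqueness of the factorization is built in.\<close>

inductive prime_product :: "'a::idom \<Rightarrow> bool" where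
  prime_product_unit: "u dvd 1 \<Longrightarrow> prime_product u"
| prime_product_mult: "prime_elem p \<Longrightarrow> prime_product c \<Longrightarrow> prime_product (p * c)"

lemma prime_product_times: "prime_product c \<Longrightarrow> prime_product d \<Longrightarrow> prime_product (c * d)"
proof (induction rule: prime_product.induct)
  case (prime_product_unit u)
  from prime_product_unit(2,1) show ?case
  proof (induction rule: prime_product.induct)
    case (prime_product_mult p c)
    then show ?case by (metis prime_product.prime_product_mult mult.left_commute)
  qed (auto intro!: prime_product.prime_product_unit intro: unit_mult)
qed (auto simp: mult.assoc intro: prime_product.prime_product_mult)

text \<open>Each prime factor of c divides one of the two factors and is cancelled there; the primes
  are distributed in this way one by one.\<close>

lemma prime_product_dvd_mult:
  assumes "prime_product c" "c dvd q * d"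
  shows "\<exists>c1 c2. c = c1 * c2 \<and> c1 dvd q \<and> c2 dvd d"
  using assms
proof (induction c arbitrary: q d rule: prime_product.induct)
  case (prime_product_unit u)
  then show ?case by (metis dvd_trans mult.right_neutral one_dvd)
next
  case (prime_product_mult p c)
  then have p: "p \<noteq> 0" by auto
  have "p dvd q \<or> p dvd d"
    using prime_product_mult by (meson dvd_mult_left prime_elem_dvd_multD)
  then show ?case
  proof
    assume "p dvd q"
    then obtain q' where q: "q = p * q'" by (elim dvdE)
    then have "c dvd q' * d" using prime_product_mult.prems p by (simp add: mult.assoc)
    then show ?case using prime_product_mult.IH[of q' d] q
      by (metis mult.assoc mult_dvd_mono dvd_refl)
  next
    assume "p dvd d"
    then obtain d' where d: "d = p * d'" by (elim dvdE)
    then have "c dvd q * d'" using prime_product_mult.prems p by (simp add: mult.left_commute)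
    then show ?case using prime_product_mult.IH[of q d'] d
      by (metis mult.left_commute mult_dvd_mono dvd_refl)
  qed
qed

text \<open>A reducible element is a product of two nonunits. Both have positive degree in V, hence
  smaller degree than the product, so the splitting ends.\<close>

lemma prime_product_if_irreducibles_prime:
  assumes V: "finite V" and c: "(c::'k::field mpoly) \<in> polys_in V" "c \<noteq> 0"
    and irr: "\<And>q::'k::field mpoly. q \<in> polys_in V \<Longrightarrow> irreducible q \<Longrightarrow> prime_elem q"
  shows "prime_product c"
  using c
proof (induction "deg_on V c" arbitrary: c rule: less_induct)
  case less
  show ?case
  proof (cases "c dvd 1 \<or> irreducible c")
    case True
    then show ?thesis
      using irr[of c] less.prems prime_product_mult[of c 1] prime_product_unit[of 1]
      by (auto intro: prime_product_unit)
  next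
    case False
    then obtain a b where ab: "c = a * b" "\<not> a dvd 1" "\<not> b dvd 1"
      using less.prems(2) by (auto simp: irreducible_def)
    then have in_V: "a \<in> polys_in V" "b \<in> polys_in V"
      using less.prems by (metis dvd_triv_left polys_in_dvd, metis dvd_triv_right polys_in_dvd)
    have nz: "a \<noteq> 0" "b \<noteq> 0" using less.prems ab by auto
    have "deg_on V a \<noteq> 0" "deg_on V b \<noteq> 0"
      using deg_on_0_unit V in_V nz ab by blast+
    then have "deg_on V a < deg_on V c" "deg_on V b < deg_on V c"
      using deg_on_mult[OF nz, of V] ab(1) by auto
    then show ?thesis
      using less.hyps in_V nz ab(1) by (metis prime_product_times)
  qed
qed

section \<open>Primes and irreducibles under adjunction of variables\<close>

definition prime_within :: "nat set \<Rightarrow> 'k::field mpoly \<Rightarrow> bool"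
  where "prime_within V p \<longleftrightarrow>
    (\<forall>g\<in>polys_in V. \<forall>h\<in>polys_in V. p dvd g * h \<longrightarrow> p dvd g \<or> p dvd h)"

lemma const_dvd_iff_dvd_coeffs:
  assumes "p \<in> polys_in V" "t \<notin> V"
  shows "p dvd g \<longleftrightarrow> (\<forall>i. p dvd coeff (to_uni t g) i)"
proof
  assume "p dvd g"
  then obtain k where "g = p * k" by (elim dvdE)
  then show "\<forall>i. p dvd coeff (to_uni t g) i"
    by (simp add: to_uni_mult to_uni_const[OF assms])
next
  assume "\<forall>i. p dvd coeff (to_uni t g) i"
  then have "p dvd poly (to_uni t g) (pvar t)"
    unfolding poly_altdef by (intro dvd_sum dvd_mult2) auto
  then show "p dvd g" by simp
qed

text \<open>Gauss's lemma: the lowest coefficients that \<open>p\<close> does not divide would multiply to one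
  that \<open>p\<close> divides.\<close>

lemma prime_within_insert:
  assumes p: "p \<in> polys_in V" "prime_within V p" and t: "t \<notin> V"
  shows "prime_within (insert t V) p"
  unfolding prime_within_def
proof (intro ballI impI, rule ccontr)
  fix g h assume gh: "g \<in> polys_in (insert t V)" "h \<in> polys_in (insert t V)" "p dvd g * h"
  define G where "G = to_uni t g"
  define H where "H = to_uni t h"
  have GH: "coeff G i \<in> polys_in V" "coeff H i \<in> polys_in V" for i
    using coeff_to_uni_in[OF gh(1), of t i] coeff_to_uni_in[OF gh(2), of t i] t
    by (auto simp: G_def H_def)
  assume "\<not> (p dvd g \<or> p dvd h)"
  then have ex: "\<exists>i. \<not> p dvd coeff G i" "\<exists>j. \<not> p dvd coeff H j"
    using const_dvd_iff_dvd_coeffs[OF p(1) t, of g] const_dvd_iff_dvd_coeffs[OF p(1) t, of h]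
    unfolding G_def H_def by blast+
  define i where "i = (LEAST i. \<not> p dvd coeff G i)"
  define j where "j = (LEAST j. \<not> p dvd coeff H j)"
  have i: "\<not> p dvd coeff G i" "\<And>k. k < i \<Longrightarrow> p dvd coeff G k"
    unfolding i_def using LeastI_ex[OF ex(1)] not_less_Least by blast+
  have j: "\<not> p dvd coeff H j" "\<And>k. k < j \<Longrightarrow> p dvd coeff H k"
    unfolding j_def using LeastI_ex[OF ex(2)] not_less_Least by blast+
  have "p dvd coeff (G * H) (i + j)"
    using gh(3) const_dvd_iff_dvd_coeffs[OF p(1) t, of "g * h"] by (simp add: G_def H_def to_uni_mult)
  also have "coeff (G * H) (i + j) =
      coeff G i * coeff H j + (\<Sum>k\<in>{..i+j} - {i}. coeff G k * coeff H (i + j - k))"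
    unfolding coeff_mult by (subst sum.remove[of _ i]) auto
  finally have "p dvd coeff G i * coeff H j"
  proof (subst (asm) dvd_add_left_iff)
    show "p dvd (\<Sum>k\<in>{..i+j} - {i}. coeff G k * coeff H (i + j - k))"
    proof (rule dvd_sum)
      fix k assume "k \<in> {..i+j} - {i}"
      then have "k < i \<or> i + j - k < j" by auto
      then show "p dvd coeff G k * coeff H (i + j - k)" using i(2) j(2) by auto
    qed
  qed
  then show False using p(2) GH i(1) j(1) unfolding prime_within_def by blast
qed

text \<open>Two given polynomials involve finitely many variables. Adding these to V one at a time
  by Gauss's lemma turns primality relative to K[V] into primality in the whole ring.\<close>

lemma prime_within_imp_prime_elem:
  assumes p: "p \<in> polys_in V" "prime_within V p" "p \<noteq> 0" "\<not> p dvd 1"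
  shows "prime_elem p"
proof (rule prime_elemI)
  fix g h assume "p dvd g * h"
  obtain W where W: "finite W" "g \<in> polys_in W" "h \<in> polys_in W"
    by (metis ex_polys_in finite_UnI polys_in_mono subset_iff sup_ge1 sup_ge2)
  have "prime_within (V \<union> U) p" if "finite U" "U \<inter> V = {}" for U
    using that
  proof (induction U rule: finite_induct)
    case (insert t U)
    have "p \<in> polys_in (V \<union> U)" using p(1) polys_in_mono[of V "V \<union> U"] by auto
    then show ?case using prime_within_insert[of p "V \<union> U" t] insert by auto
  qed (use p in auto)
  from this[of "W - V"] W(1) have "prime_within (V \<union> W) p" by (simp add: Int_commute)
  then show "p dvd g \<or> p dvd h"
    using W(2,3) \<open>p dvd g * h\<close> polys_in_mono[of W "V \<union> W"] by (auto simp: prime_within_def)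
qed (use p in auto)

text \<open>The coefficients form no field, so before each cancellation of a leading term a is
  multiplied by the leading coefficient of d; the exponent k counts these multiplications.\<close>

lemma pseudo_division:
  fixes d :: "'k::field mpoly"
  assumes d: "d \<in> polys_in (insert t V)" "d \<noteq> 0" and t: "t \<notin> V"
    and a: "a \<in> polys_in (insert t V)"
  shows "\<exists>k q r. q \<in> polys_in (insert t V) \<and> r \<in> polys_in (insert t V) \<and>
    lead_coeff (to_uni t d) ^ k * a = q * d + r \<and>
    (r = 0 \<or> degree (to_uni t r) < degree (to_uni t d))"
  using a
proof (induction "degree (to_uni t a)" arbitrary: a rule: less_induct)
  case less
  define D where "D = to_uni t d"
  define A where "A = to_uni t a"
  define l where "l = lead_coeff D"
  have lV: "lead_coeff D \<in> polys_in V" "lead_coeff A \<in> polys_in V"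
    using coeff_to_uni_in[OF d(1), of t] coeff_to_uni_in[OF less.prems, of t] t
    by (auto simp: D_def A_def)
  then have l_in: "l \<in> polys_in (insert t V)" "lead_coeff A \<in> polys_in (insert t V)"
    using polys_in_mono[of V "insert t V"] by (auto simp: l_def)
  have x_in: "pvar t \<in> polys_in (insert t V)" by (rule pvar_in) simp
  show ?case
  proof (cases "degree A < degree D")
    case True
    then show ?thesis
      using less.prems by (intro exI[of _ 0] exI[of _ 0] exI[of _ a]) (auto simp: A_def D_def)
  next
    case False
    define e where "e = degree A - degree D"
    \<comment> \<open>Makes \<open>u * d\<close> and \<open>l * a\<close> agree in the leading term
      in t.\<close>
    define u where "u = lead_coeff A * pvar t ^ e"
    define a' where "a' = l * a - u * d"
    have u_in: "u \<in> polys_in (insert t V)"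
      unfolding u_def using l_in x_in by (intro polys_in_mult polys_in_power)
    have a'_in: "a' \<in> polys_in (insert t V)"
      unfolding a'_def using u_in l_in d less.prems by (intro polys_in_diff polys_in_mult)
    have pw: "to_uni t (pvar t ^ e) = monom 1 e"
      by (induction e) (auto simp: to_uni_mult to_uni_pvar monom_altdef)
    have A': "to_uni t a' = smult l A - monom (lead_coeff A) e * D"
      unfolding a'_def u_def to_uni_diff to_uni_mult pw A_def[symmetric] D_def[symmetric]
      using to_uni_const[OF lV(1) t] to_uni_const[OF lV(2) t]
      by (simp add: l_def smult_monom)
    have D0: "D \<noteq> 0" using d by (simp add: D_def)
    have deg: "a' = 0 \<or> degree (to_uni t a') < degree A \<or> degree (to_uni t a') = 0 \<and> degree D = 0"
    proof -
      have le: "degree (to_uni t a') \<le> degree A"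
        unfolding A'
      proof (rule degree_diff_le)
        show "degree (smult l A) \<le> degree A" by simp
        show "degree (monom (lead_coeff A) e * D) \<le> degree A"
          using degree_mult_le[of "monom (lead_coeff A) e" D] degree_monom_le[of "lead_coeff A" e]
            False by (simp add: e_def)
      qed
      have "coeff (to_uni t a') (degree A) = 0"
        unfolding A' using False by (simp add: coeff_monom_mult e_def l_def)
      then have "degree (to_uni t a') \<noteq> degree A \<or> to_uni t a' = 0"
        by (metis leading_coeff_0_iff)
      then show ?thesis using le by auto
    qed
    show ?thesis
    proof (cases "a' = 0")
      case True
      then show ?thesis using u_in
        by (intro exI[of _ 1] exI[of _ u] exI[of _ 0]) (simp add: a'_def l_def D_def)
    next
      case nz: False
      have "degree (to_uni t a') < degree A"
      proof (rule ccontr)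
        assume "\<not> ?thesis"
        with deg nz have 0: "degree (to_uni t a') = 0" "degree D = 0" "degree A = 0"
          by auto
        have "coeff (to_uni t a') 0 = 0"
          unfolding A' using 0 by (simp add: coeff_monom_mult e_def l_def)
        with 0(1) nz show False
          by (metis leading_coeff_0_iff to_uni_eq_0_iff)
      qed
      then obtain k q r where IH: "q \<in> polys_in (insert t V)" "r \<in> polys_in (insert t V)"
        "l ^ k * a' = q * d + r" "r = 0 \<or> degree (to_uni t r) < degree D"
        using less.hyps[of a'] a'_in by (auto simp: A_def l_def D_def)
      have "l ^ Suc k * a = (q + l ^ k * u) * d + r"
        using IH(3) by (simp add: a'_def algebra_simps)
      moreover have "q + l ^ k * u \<in> polys_in (insert t V)"
        using IH(1) l_in u_in by (intro polys_in_add polys_in_mult polys_in_power)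
      ultimately show ?thesis using IH(2,4) unfolding l_def D_def by blast
    qed
  qed
qed

text \<open>In \<open>c * g = f * s\<close>, the primes of c are distributed over f and s. The part
  that divides f lies in K[V] and is a unit, as otherwise the irreducible f would be a unit multiple
  of it and lie in K[V]. So c divides s up to a unit.\<close>

lemma irreducible_not_in_cancel:
  fixes f :: "'k::field mpoly"
  assumes f: "irreducible f" "f \<notin> polys_in V"
    and c: "prime_product c" "c \<in> polys_in V" "c \<noteq> 0" and dvd: "f dvd c * g"
  shows "f dvd g"
proof -
  obtain s where s: "c * g = f * s" using dvd by (elim dvdE)
  then have "c dvd f * s" by (metis dvd_triv_left)
  then obtain e1 e2 where e: "c = e1 * e2" "e1 dvd f" "e2 dvd s"
    using prime_product_dvd_mult[OF c(1)] by blast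
  obtain f' s' where f': "f = e1 * f'" and s': "s = e2 * s'" using e by (elim dvdE)
  have "e1 dvd 1 \<or> f' dvd 1" using irreducibleD[OF f(1) f'] .
  moreover have "\<not> f' dvd 1"
  proof
    assume "f' dvd 1"
    then obtain k where "f' = single 0 k" using unit_const by blast
    then have "f' \<in> polys_in V" by (simp add: polys_in_single)
    moreover have "e1 \<in> polys_in V" using e(1) c by (metis dvd_triv_left polys_in_dvd)
    ultimately show False using f' f(2) polys_in_mult by blast
  qed
  ultimately have "e1 dvd 1" by blast
  then have "f dvd f'" by (simp add: f' mult_unit_dvd_iff')
  moreover have "g = f' * s'"
  proof -
    have "c * g = c * (f' * s')" using s f' s' e(1) by (simp add: ac_simps)
    then show ?thesis using c(3) by simp
  qed
  ultimately show ?thesis by simp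
qed

text \<open>An element of least degree in \<open>t\<close> of the ideal \<open>(f, g)\<close> divides \<open>f\<close> and \<open>g\<close> up to
  factors that do not involve \<open>t\<close>.\<close>

lemma irreducible_imp_prime_within_insert:
  fixes f :: "'k::field mpoly"
  assumes V: "finite V" "t \<notin> V" and irr: "\<And>q::'k mpoly. q \<in> polys_in V \<Longrightarrow> irreducible q \<Longrightarrow> prime_elem q"
    and f: "f \<in> polys_in (insert t V)" "f \<notin> polys_in V" "irreducible f"
  shows "prime_within (insert t V) f"
  unfolding prime_within_def
proof (intro ballI impI, rule ccontr)
  let ?B = "polys_in (insert t V) :: 'k mpoly set"
  fix g h assume gh: "g \<in> ?B" "h \<in> ?B" "f dvd g * h" "\<not> (f dvd g \<or> f dvd h)"
  have fnz: "f \<noteq> 0" using f(3) by auto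
  \<comment> \<open>The ideal generated by f and g in K[V, t], the ring in which pseudo-division by
    its elements takes place.\<close>
  define I where "I = {u * f + v * g | u v. u \<in> ?B \<and> v \<in> ?B}"
  have "f \<in> I" unfolding I_def by (rule CollectI, rule exI[of _ 1], rule exI[of _ 0]) simp
  have "g \<in> I" unfolding I_def by (rule CollectI, rule exI[of _ 0], rule exI[of _ 1]) simp
  have I_B: "I \<subseteq> ?B"
    unfolding I_def using f(1) gh(1) by (auto intro: polys_in_add polys_in_mult)
  have I_comb: "a * x - b * y \<in> I" if ab: "x \<in> I" "y \<in> I" "a \<in> ?B" "b \<in> ?B" for a b x y
  proof -
    obtain u v u' v' where uv: "x = u * f + v * g" "y = u' * f + v' * g"
      "u \<in> ?B" "v \<in> ?B" "u' \<in> ?B" "v' \<in> ?B"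
      using ab(1,2) unfolding I_def by blast
    have "a * x - b * y = (a * u - b * u') * f + (a * v - b * v') * g"
      by (simp add: uv algebra_simps)
    moreover have "a * u - b * u' \<in> ?B" "a * v - b * v' \<in> ?B"
      using uv ab by (auto intro!: polys_in_diff polys_in_mult)
    ultimately show ?thesis unfolding I_def by blast
  qed
  define d where "d = arg_min (\<lambda>d. degree (to_uni t d)) (\<lambda>d. d \<in> I \<and> d \<noteq> 0)"
  have d: "d \<in> I" "d \<noteq> 0"
    using arg_min_natI[of "\<lambda>d. d \<in> I \<and> d \<noteq> 0" f] \<open>f \<in> I\<close> fnz by (auto simp: d_def)
  have d_min: "\<not> degree (to_uni t r) < degree (to_uni t d)" if "r \<in> I" "r \<noteq> 0" for r
    using arg_min_nat_le[of "\<lambda>d. d \<in> I \<and> d \<noteq> 0" r "\<lambda>d. degree (to_uni t d)"] that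
    by (auto simp: d_def)
  define l where "l = lead_coeff (to_uni t d)"
  have l: "l \<in> polys_in V" "l \<noteq> 0"
    using coeff_to_uni_in[of d "insert t V" t] d I_B V(2) by (auto simp: l_def)
  have cancel: "f dvd y" if "x \<in> polys_in V" "x \<noteq> 0" "f dvd x * y" for x y
    using irreducible_not_in_cancel[OF f(3,2) _ that] prime_product_if_irreducibles_prime[OF V(1) that(1,2) irr]
    by blast
  have l_pow: "l ^ k \<in> polys_in V" "l ^ k \<noteq> 0" for k
    using l by (auto intro: polys_in_power)
  have d_dvd: "\<exists>k q. l ^ k * a = q * d" if a: "a \<in> I" for a
  proof -
    have a_B: "a \<in> ?B" and d_B: "d \<in> ?B" using a d(1) I_B by auto
    obtain k q r where *: "q \<in> ?B" "r \<in> ?B" "l ^ k * a = q * d + r"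
      "r = 0 \<or> degree (to_uni t r) < degree (to_uni t d)"
      using pseudo_division[OF d_B d(2) V(2) a_B] unfolding l_def by blast
    have "l ^ k * a - q * d \<in> I"
      using a d * l_pow(1) polys_in_mono[of V "insert t V"] by (intro I_comb) auto
    then have "r \<in> I" using *(3) by simp
    then have "r = 0" using *(4) d_min by blast
    then have "l ^ k * a = q * d" using *(3) by simp
    then show ?thesis by blast
  qed
  \<comment> \<open>The primes of the power of l are shared between q and d. Removing them leaves f
    as the product of the remaining parts \<open>q'\<close> and \<open>d'\<close>, one of which is a
    unit by irreducibility.\<close>
  obtain k q where kq: "l ^ k * f = q * d" using d_dvd \<open>f \<in> I\<close> by blast
  have lk_dvd: "l ^ k dvd q * d" unfolding kq[symmetric] by simp
  obtain c1 c2 where c: "l ^ k = c1 * c2" "c1 dvd q" "c2 dvd d"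
    using prime_product_dvd_mult[OF prime_product_if_irreducibles_prime[OF V(1) l_pow irr] lk_dvd]
    by blast
  obtain q' d' where q': "q = c1 * q'" and d': "d = c2 * d'" using c by (elim dvdE)
  have "l ^ k * f = l ^ k * (q' * d')" using kq c(1) q' d' by (simp add: ac_simps)
  then have "f = q' * d'" using l(2) by simp
  then consider "q' dvd 1" | "d' dvd 1" using irreducibleD[OF f(3)] by blast
  then show False
  proof cases
    case 1
    \<comment> \<open>Here d is a multiple of f, so f divides a power of l times g, and the power of
      l can be cancelled.\<close>
    then have "f dvd d'" by (simp add: \<open>f = q' * d'\<close> mult_unit_dvd_iff')
    then have "f dvd d" using d' by simp
    obtain k' r where "l ^ k' * g = r * d" using d_dvd \<open>g \<in> I\<close> by blast
    then have "f dvd l ^ k' * g" using \<open>f dvd d\<close> by simp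
    then show False using cancel[OF l_pow] gh(4) by blast
  next
    case 2
    \<comment> \<open>Here d is free of t. As d is a combination of f and g, f divides d h, and d
      can be cancelled.\<close>
    have "c2 \<in> polys_in V" using c(1) l_pow by (metis dvd_triv_right polys_in_dvd)
    moreover obtain z where "d' = single 0 z" using 2 unit_const by blast
    ultimately have dV: "d \<in> polys_in V"
      unfolding d' by (intro polys_in_mult) (auto simp: polys_in_single)
    obtain u v where "d = u * f + v * g" using d(1) by (auto simp: I_def)
    then have "d * h = f * (u * h) + v * (g * h)" by (simp add: algebra_simps)
    then have "f dvd d * h" using gh(3) by (simp add: dvd_add)
    then show False using cancel[OF dV d(2)] gh(4) by blast
  qed
qed

text \<open>Induction on the variables. When the new variable occurs in f, the induction hypothesis
  supplies the prime factorizations of polynomials free of it, which are needed to cancel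
  them.\<close>

lemma irreducible_in_imp_prime_elem:
  fixes f :: "'k::field mpoly"
  assumes "finite V" "f \<in> polys_in V" "irreducible f"
  shows "prime_elem f"
  using assms
proof (induction V arbitrary: f rule: finite_induct)
  case empty
  have "deg_on {} f = 0"
    unfolding deg_on_def le_zero_eq[symmetric]
    by (intro degree_le allI impI) (auto simp only: grading.coeff_H[OF grading_sum] intro: sum.neutral, simp)
  then have "f dvd 1"
    using empty by (intro deg_on_0_unit[of _ "{}"]) auto
  then show ?case using empty irreducible_not_unit by blast
next
  case (insert t V)
  show ?case
  proof (cases "f \<in> polys_in V")
    case False
    then have "prime_within (insert t V) f"
      using insert irreducible_imp_prime_within_insert by blast
    then show ?thesis
      using insert.prems irreducible_not_unit
      by (intro prime_within_imp_prime_elem[of f "insert t V"]) auto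
  qed (use insert in auto)
qed

lemma mpoly_irreducible_imp_prime_elem: "irreducible (f :: 'k::field mpoly) \<Longrightarrow> prime_elem f"
  using ex_polys_in irreducible_in_imp_prime_elem by blast

lemma mpoly_prime_product: "(f :: 'k::field mpoly) \<noteq> 0 \<Longrightarrow> prime_product f"
  using ex_polys_in prime_product_if_irreducibles_prime mpoly_irreducible_imp_prime_elem by blast

section \<open>Factors of bihomogeneous polynomials\<close>

text \<open>The order of vanishing at 0 and the degree are both additive. They agree on the product,
  and the order never exceeds the degree, so they agree on each factor.\<close>

lemma mult_eq_monom:
  fixes a b :: "'a::idom poly"
  assumes "a * b = monom c d" "c \<noteq> 0"
  shows "\<exists>a' e. a = monom a' e"
proof -
  have nz: "a * b \<noteq> 0" using assms by simp
  then have [simp]: "a \<noteq> 0" "b \<noteq> 0" by auto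
  have "Polynomial.order 0 a + Polynomial.order 0 b = degree a + degree b"
    using order_mult[OF nz, of 0] degree_mult_eq[of a b] assms by (simp add: degree_monom_eq)
  moreover have "Polynomial.order 0 a \<le> degree a" "Polynomial.order 0 b \<le> degree b"
    by (simp_all add: order_degree)
  ultimately have "Polynomial.order 0 a = degree a" by linarith
  then have "[:-0, 1:] ^ degree a dvd a" using order_1[of 0 a] by simp
  then obtain k where k: "a = monom 1 (degree a) * k"
    by (auto simp: monom_altdef elim: dvdE)
  then have "degree a = degree a + degree k"
    by (metis \<open>a \<noteq> 0\<close> degree_monom_eq degree_mult_eq mult_not_zero one_neq_zero)
  then obtain c where "k = [:c:]" by (metis add_cancel_right_right degree_eq_zeroE)
  then have "a = monom c (degree a)"
    using k by (metis monom_0 mult.right_neutral mult_monom mult.commute add_0_right mult_1)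
  then show ?thesis by blast
qed

lemma lookup_coeff_grade_hom:
  fixes p :: "'k::field mpoly"
  assumes "grading (\<lambda>s. s) w"
  shows "lookup (coeff (grade_hom (\<lambda>s. s) w p) i) s = (if w s = i then lookup p s else 0)"
proof -
  have "lookup (coeff (grade_hom (\<lambda>s. s) w p) i) s =
      (\<Sum>t\<in>{t \<in> keys p. w t = i}. if t = s then lookup p t else 0)"
    unfolding grading.coeff_H[OF assms] lookup_sum
    by (rule sum.cong) (auto simp: lookup_single when_def)
  also have "\<dots> = (if w s = i then lookup p s else 0)"
    by (simp add: not_in_keys_iff_lookup_eq_zero)
  finally show ?thesis .
qed

text \<open>Homogeneity becomes a statement about a ring map: p is sent to p times a power of the
  new variable. In this form it passes to factors.\<close>

lemma grade_hom_eq_monom_iff: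
  fixes p :: "'k::field mpoly"
  assumes "grading (\<lambda>s. s) w"
  shows "(\<forall>s\<in>keys p. w s = d) \<longleftrightarrow> grade_hom (\<lambda>s. s) w p = monom p d"
proof -
  have "grade_hom (\<lambda>s. s) w p = monom p d \<longleftrightarrow>
      (\<forall>i s. (if w s = i then lookup p s else 0) = (if i = d then lookup p s else 0))"
    by (simp add: poly_eq_iff poly_mapping_eq_iff fun_eq_iff lookup_coeff_grade_hom[OF assms]) auto
  also have "\<dots> \<longleftrightarrow> (\<forall>s\<in>keys p. w s = d)"
    by (auto simp: in_keys_iff)
  finally show ?thesis by simp
qed

lemma homogeneous_factor:
  fixes p q :: "'k::field mpoly"
  assumes w: "grading (\<lambda>s. s) w" and pq: "p * q \<noteq> 0" "\<forall>s\<in>keys (p * q). w s = d"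
  shows "\<exists>e. \<forall>s\<in>keys p. w s = e"
proof -
  have "grade_hom (\<lambda>s. s) w p * grade_hom (\<lambda>s. s) w q = monom (p * q) d"
    using pq(2) grade_hom_eq_monom_iff[OF w] grading.H_mult[OF w] by metis
  then obtain a e where "grade_hom (\<lambda>s. s) w p = monom a e"
    using mult_eq_monom pq(1) by blast
  moreover from this have "p = a" using poly_grade_hom_1[OF w, of p] by (simp add: poly_monom)
  ultimately show ?thesis using grade_hom_eq_monom_iff[OF w] by blast
qed

lemma grading_bideg:
  "grading (\<lambda>s. s) (\<lambda>s. \<Sum>i<m. lookup s i)" "grading (\<lambda>s. s) (\<lambda>s. \<Sum>j<n. lookup s (m + j))"
  by (standard; auto simp: lookup_add sum.distrib)+

lemma carrier_bipoly: "carrier (bipoly_ring m n) = polys_in {..<m + n}"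
  by (simp add: bipoly_ring_def polys_in_def)

lemma bihomogeneous_factor:
  assumes "bihomogeneous m n d (p * q)" "p * q \<noteq> 0"
  shows "\<exists>e. bihomogeneous m n e p"
proof -
  have "p \<in> carrier (bipoly_ring m n)"
    using assms polys_in_factor unfolding bihomogeneous_def carrier_bipoly by blast
  moreover have "\<exists>e. \<forall>s\<in>keys p. (\<Sum>i<m. lookup s i) = e"
    by (rule homogeneous_factor[OF grading_bideg(1) assms(2), where d = "fst d"])
      (use assms(1) in \<open>auto simp: bihomogeneous_def\<close>)
  moreover have "\<exists>e. \<forall>s\<in>keys p. (\<Sum>j<n. lookup s (m + j)) = e"
    by (rule homogeneous_factor[OF grading_bideg(2) assms(2), where d = "snd d"])
      (use assms(1) in \<open>auto simp: bihomogeneous_def\<close>)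
  ultimately show ?thesis by (auto simp: bihomogeneous_def)
qed

lemma bihomogeneous_dvd:
  "bihomogeneous m n d f \<Longrightarrow> f \<noteq> 0 \<Longrightarrow> p dvd f \<Longrightarrow> \<exists>e. bihomogeneous m n e p"
  using bihomogeneous_factor by (metis dvdE)

lemma bihomogeneous_degree_unique:
  assumes "bihomogeneous m n d p" "bihomogeneous m n d' p" "p \<noteq> 0"
  shows "d = d'"
proof -
  obtain s where "s \<in> keys p" using assms(3) by fastforce
  then show ?thesis using assms by (auto simp: bihomogeneous_def)
qed

lemma bihomogeneous_mult:
  assumes "bihomogeneous m n (a, b) p" "bihomogeneous m n (a', b') q"
  shows "bihomogeneous m n (a + a', b + b') (p * q)"
proof -
  have "p * q \<in> carrier (bipoly_ring m n)"
    using assms by (auto simp: bihomogeneous_def carrier_bipoly intro: polys_in_mult)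
  moreover have "((\<Sum>i<m. lookup s i), (\<Sum>j<n. lookup s (m + j))) = (a + a', b + b')"
    if s: "s \<in> keys (p * q)" for s
  proof -
    obtain t u where "s = t + u" "t \<in> keys p" "u \<in> keys q" using keys_mult[of p q] s by blast
    then show ?thesis using assms by (auto simp: bihomogeneous_def lookup_add sum.distrib)
  qed
  ultimately show ?thesis by (auto simp: bihomogeneous_def)
qed

lemma bihomogeneous_1: "bihomogeneous m n (0, 0) 1"
  by (auto simp: bihomogeneous_def carrier_bipoly)

section \<open>The polynomial ring and its cyclic modules\<close>

lemma bipoly_simps [simp]:
  "x \<otimes>\<^bsub>bipoly_ring m n\<^esub> y = x * y" "x \<oplus>\<^bsub>bipoly_ring m n\<^esub> y = x + y"
  "\<zero>\<^bsub>bipoly_ring m n\<^esub> = 0" "\<one>\<^bsub>bipoly_ring m n\<^esub> = 1"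
  by (simp_all add: bipoly_ring_def)

lemma cring_bipoly: "cring (bipoly_ring m n)"
proof (rule cringI)
  show "abelian_group (bipoly_ring m n)"
  proof (rule abelian_groupI)
    fix x assume "x \<in> carrier (bipoly_ring m n)"
    then show "\<exists>y\<in>carrier (bipoly_ring m n). y \<oplus>\<^bsub>bipoly_ring m n\<^esub> x = \<zero>\<^bsub>bipoly_ring m n\<^esub>"
      by (intro bexI[of _ "- x"]) (auto simp: carrier_bipoly)
  qed (auto simp: carrier_bipoly ac_simps intro: polys_in_add)
  show "comm_monoid (bipoly_ring m n)"
    by (rule comm_monoidI) (auto simp: carrier_bipoly ac_simps intro: polys_in_mult)
qed (simp add: distrib_right)

lemma bipoly_a_inv: "x \<in> carrier (bipoly_ring m n) \<Longrightarrow> \<ominus>\<^bsub>bipoly_ring m n\<^esub> x = - x"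
proof -
  assume x: "x \<in> carrier (bipoly_ring m n)"
  interpret cring "bipoly_ring m n" by (rule cring_bipoly)
  show ?thesis by (rule minus_equality) (use x in \<open>auto simp: carrier_bipoly\<close>)
qed

lemma bipoly_minus:
  "x \<in> carrier (bipoly_ring m n) \<Longrightarrow> y \<in> carrier (bipoly_ring m n) \<Longrightarrow>
    x \<ominus>\<^bsub>bipoly_ring m n\<^esub> y = x - y"
  by (simp add: a_minus_def bipoly_a_inv)

lemma bipoly_Units: "x \<in> Units (bipoly_ring m n) \<longleftrightarrow> x dvd 1"
proof
  assume "x dvd 1"
  then obtain y where y: "1 = x * y" by (elim dvdE)
  moreover have "x \<in> polys_in {..<m + n}" "y \<in> polys_in {..<m + n}"
    using y polys_in_factor[of x y] polys_in_factor[of y x] by (auto simp: mult.commute)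
  ultimately show "x \<in> Units (bipoly_ring m n)"
    unfolding Units_def by (auto simp: carrier_bipoly mult.commute)
qed (auto simp: Units_def intro: dvdI[OF sym])

text \<open>For nonzero f, the cofactor of a multiple of f in S lies in S again by
  \<open>polys_in_quot\<close>, so membership in (f) can be stated with \<open>dvd\<close>.\<close>

lemma bipoly_PIdl:
  assumes "f \<in> polys_in {..<m + n}"
  shows "PIdl\<^bsub>bipoly_ring m n\<^esub> f = {v \<in> polys_in {..<m + n}. f dvd v}"
proof (cases "f = 0")
  case True
  then show ?thesis by (auto simp: cgenideal_def carrier_bipoly intro: exI[of _ 0])
next
  case False
  show ?thesis
    unfolding cgenideal_def carrier_bipoly bipoly_simps
  proof (intro equalityI subsetI)
    fix v assume "v \<in> {x * f | x. x \<in> polys_in {..<m + n}}"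
    then obtain x where "v = x * f" "x \<in> polys_in {..<m + n}" by blast
    then show "v \<in> {v \<in> polys_in {..<m + n}. f dvd v}"
      using assms by (simp add: polys_in_mult)
  next
    fix v assume v: "v \<in> {v \<in> polys_in {..<m + n}. f dvd v}"
    then obtain k where k: "v = f * k" by (auto elim: dvdE)
    then have "k \<in> polys_in {..<m + n}"
      using False v polys_in_quot[OF k] by (cases "v = 0") auto
    then show "v \<in> {x * f | x. x \<in> polys_in {..<m + n}}"
      using k by (auto simp: mult.commute)
  qed
qed

lemma bipoly_ideal_iff:
  "ideal I (bipoly_ring m n) \<longleftrightarrow>
    I \<subseteq> polys_in {..<m + n} \<and> 0 \<in> I \<and> (\<forall>x\<in>I. \<forall>y\<in>I. x + y \<in> I) \<and>
    (\<forall>x\<in>polys_in {..<m + n}. \<forall>y\<in>I. x * y \<in> I)" (is "_ \<longleftrightarrow> ?rhs")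
proof
  interpret cring "bipoly_ring m n" by (rule cring_bipoly)
  assume "ideal I (bipoly_ring m n)"
  then interpret ideal I "bipoly_ring m n" .
  show ?rhs
    using a_subset zero_closed a_closed I_l_closed by (auto simp: carrier_bipoly)
next
  assume rhs: ?rhs
  have neg: "- x \<in> I" if "x \<in> I" for x
  proof -
    have "(- 1) * x \<in> I" using rhs that by (metis polys_in_1 polys_in_uminus)
    then show ?thesis by simp
  qed
  show "ideal I (bipoly_ring m n)"
  proof (rule idealI)
    show "ring (bipoly_ring m n)" by (rule cring.axioms(1)[OF cring_bipoly])
    show "subgroup I (add_monoid (bipoly_ring m n))"
    proof (unfold_locales)
      fix x assume "x \<in> I"
      then show "inv\<^bsub>add_monoid (bipoly_ring m n)\<^esub> x \<in> I"
        using neg rhs bipoly_a_inv[of x m n] by (auto simp: a_inv_def carrier_bipoly)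
    qed (use rhs in \<open>auto simp: carrier_bipoly\<close>)
  qed (use rhs in \<open>auto simp: carrier_bipoly\<close>, metis mult.commute)
qed

text \<open>Moves computations in S/I to representatives: \<open>cs v\<close> is the class of v, and
  the operations of \<open>M\<close> are rewritten as operations of S.\<close>

locale bipoly_ideal =
  fixes m n :: nat and I :: "'k::field mpoly set"
  assumes is_ideal: "ideal I (bipoly_ring m n)"
begin

abbreviation (input) R where "R \<equiv> bipoly_ring m n :: 'k mpoly ring"
abbreviation (input) S where "S \<equiv> polys_in {..<m + n} :: 'k mpoly set"
abbreviation (input) cs where "cs v \<equiv> I +>\<^bsub>R\<^esub> v"
abbreviation (input) M where "M \<equiv> quot_ring_module R I"

sublocale ideal I R by (rule is_ideal)
sublocale cring R by (rule cring_bipoly)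

lemma I_S: "v \<in> I \<Longrightarrow> v \<in> S" and I_0: "0 \<in> I"
  and I_add: "v \<in> I \<Longrightarrow> w \<in> I \<Longrightarrow> v + w \<in> I" and I_mult: "x \<in> S \<Longrightarrow> v \<in> I \<Longrightarrow> x * v \<in> I"
  using is_ideal[unfolded bipoly_ideal_iff] by auto

lemma I_uminus: "v \<in> I \<Longrightarrow> - v \<in> I"
  using I_mult[of "- 1" v] by simp

lemma I_diff: "v \<in> I \<Longrightarrow> w \<in> I \<Longrightarrow> v - w \<in> I"
  using I_add[of v "- w"] I_uminus by simp

lemma cs_def: "cs v = {i + v | i. i \<in> I}"
  by (auto simp: a_r_coset_def')

lemma cs_eq_iff: "v \<in> S \<Longrightarrow> w \<in> S \<Longrightarrow> cs v = cs w \<longleftrightarrow> v - w \<in> I"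
  using quotient_eq_iff_same_a_r_cos[OF is_ideal, of v w] by (simp add: carrier_bipoly bipoly_minus)

lemma cs_0: "cs 0 = I"
  by (auto simp: cs_def)

lemma cs_eq_I_iff: "v \<in> S \<Longrightarrow> cs v = I \<longleftrightarrow> v \<in> I"
  using cs_eq_iff[of v 0] by (simp add: cs_0)

lemma M_carrier: "carrier M = cs ` S"
  by (auto simp: quot_ring_module_def FactRing_def A_RCOSETS_def' carrier_bipoly)

lemma M_zero: "\<zero>\<^bsub>M\<^esub> = cs 0"
  by (simp add: quot_ring_module_def FactRing_def cs_0)

lemma M_add: "v \<in> S \<Longrightarrow> w \<in> S \<Longrightarrow> cs v \<oplus>\<^bsub>M\<^esub> cs w = cs (v + w)"
  using a_rcos_sum[of v w] by (simp add: quot_ring_module_def FactRing_def carrier_bipoly)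

lemma M_smult: "r \<in> S \<Longrightarrow> v \<in> S \<Longrightarrow> r \<odot>\<^bsub>M\<^esub> cs v = cs (r * v)"
  using rcoset_mult_add[of r v] by (simp add: quot_ring_module_def FactRing_def carrier_bipoly)

lemma M_abelian_group: "abelian_group M"
proof (rule abelian_groupI)
  fix x assume "x \<in> carrier M"
  then obtain v where "v \<in> S" "x = cs v" by (auto simp: M_carrier)
  then show "\<exists>y\<in>carrier M. y \<oplus>\<^bsub>M\<^esub> x = \<zero>\<^bsub>M\<^esub>"
    by (intro bexI[of _ "cs (- v)"]) (auto simp: M_carrier M_zero M_add)
qed (auto simp: M_carrier M_zero M_add polys_in_add ac_simps)

sublocale M: abelian_group M by (rule M_abelian_group)

lemma M_finsum:
  assumes "\<And>i. i \<in> A \<Longrightarrow> g i \<in> S"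
  shows "(\<Oplus>\<^bsub>M\<^esub>i\<in>A. cs (g i)) = cs (\<Sum>i\<in>A. g i)"
  using assms
proof (induction A rule: infinite_finite_induct)
  case (insert a A)
  then have "(\<Oplus>\<^bsub>M\<^esub>i\<in>insert a A. cs (g i)) = cs (g a) \<oplus>\<^bsub>M\<^esub> (\<Oplus>\<^bsub>M\<^esub>i\<in>A. cs (g i))"
    by (intro M.finsum_insert) (auto simp: M_carrier)
  then show ?case using insert by (simp add: M_add polys_in_sum)
qed (auto simp: M_zero)

end

subsection \<open>Associated primes of a hypersurface ring\<close>

abbreviation (input) hypersurface :: "nat \<Rightarrow> nat \<Rightarrow> 'k::field mpoly \<Rightarrow> ('k mpoly, 'k mpoly set) module"
  where "hypersurface m n f \<equiv> quot_ring_module (bipoly_ring m n) (PIdl\<^bsub>bipoly_ring m n\<^esub> f)"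

lemma PIdl_bipoly_ideal:
  "f \<in> polys_in {..<m + n} \<Longrightarrow> bipoly_ideal m n (PIdl\<^bsub>bipoly_ring m n\<^esub> f)"
  by (rule bipoly_ideal.intro) (simp add: cring.cgenideal_ideal[OF cring_bipoly] carrier_bipoly)

context
  fixes m n :: nat and f :: "'k::field mpoly"
  assumes f: "f \<in> polys_in {..<m + n}" "f \<noteq> 0"
begin

interpretation J: bipoly_ideal m n "PIdl\<^bsub>bipoly_ring m n\<^esub> f"
  by (rule PIdl_bipoly_ideal[OF f(1)])

lemma annihilator_hypersurface:
  assumes "g \<in> polys_in {..<m + n}"
  shows "annihilator (bipoly_ring m n) (hypersurface m n f)
      (PIdl\<^bsub>bipoly_ring m n\<^esub> f +>\<^bsub>bipoly_ring m n\<^esub> g) = {r \<in> polys_in {..<m + n}. f dvd r * g}"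
proof -
  have "r \<odot>\<^bsub>J.M\<^esub> J.cs g = \<zero>\<^bsub>J.M\<^esub> \<longleftrightarrow> f dvd r * g" if r: "r \<in> J.S" for r
    using J.cs_eq_I_iff[of "r * g"] polys_in_mult[OF r assms] r assms
    by (simp add: J.M_smult J.M_zero J.cs_0) (simp add: bipoly_PIdl[OF f(1)])
  then show ?thesis
    unfolding annihilator_def carrier_bipoly by blast
qed

text \<open>If P is the annihilator of the class of g, it contains f and, being prime, a prime
  factor p of f. In p g = f r, p does not divide r, as otherwise f would divide g. For v in P with v
  g = f u this gives v r = p u, so p divides v.\<close>

lemma associated_prime_hypersurface:
  assumes "P \<in> associated_primes (bipoly_ring m n)
    (hypersurface m n f)"
  shows "\<exists>p. prime_elem p \<and> p dvd f \<and> p \<in> polys_in {..<m + n} \<and> P = PIdl\<^bsub>bipoly_ring m n\<^esub> p"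
proof -
  let ?S = "polys_in {..<m + n} :: 'k mpoly set"
  obtain g where g: "g \<in> ?S" "primeideal P (bipoly_ring m n)" "P = {r \<in> ?S. f dvd r * g}"
    using assms unfolding associated_primes_def J.M_carrier
    by (auto simp: annihilator_hypersurface)
  interpret primeideal P "bipoly_ring m n" by fact
  have "1 \<notin> P" using I_notcarr one_imp_carrier by auto
  then have fg: "\<not> f dvd g" using g(3) by auto
  have "f \<in> P" using f(1) by (simp add: g(3))
  have "\<exists>p. prime_elem p \<and> p dvd h \<and> p \<in> P" if "prime_product h" "h \<in> P" "h \<in> ?S" "h \<noteq> 0" for h
    using that
  proof (induction h rule: prime_product.induct)
    case (prime_product_unit u)
    then obtain k where k: "1 = u * k" by (elim dvdE)
    then have "k \<in> ?S" using polys_in_factor[of k u] by (auto simp: mult.commute)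
    then have "1 \<in> P" using k I_r_closed[of u k] prime_product_unit by (simp add: carrier_bipoly)
    then show ?case using \<open>1 \<notin> P\<close> by blast
  next
    case (prime_product_mult p c)
    have S: "p \<in> ?S" "c \<in> ?S"
      using prime_product_mult.prems by (metis dvd_triv_left polys_in_dvd, metis dvd_triv_right polys_in_dvd)
    then have "p \<in> P \<or> c \<in> P"
      using I_prime[of p c] prime_product_mult.prems by (simp add: carrier_bipoly)
    then show ?case
      using prime_product_mult S by (auto intro: dvd_mult)
  qed
  then obtain p where p: "prime_elem p" "p dvd f" "p \<in> P"
    using mpoly_prime_product f \<open>f \<in> P\<close> by blast
  have pS: "p \<in> ?S" using p(2) f polys_in_dvd by blast
  have "P = {v \<in> ?S. p dvd v}"
  proof (intro equalityI subsetI)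
    fix v assume v: "v \<in> P"
    obtain u where u: "v * g = f * u" using v g(3) by (auto elim: dvdE)
    obtain r where r: "p * g = f * r" using p(3) g(3) by (auto elim: dvdE)
    have "f * (v * r) = f * (p * u)"
    proof -
      have "f * (v * r) = v * (p * g)" using r by (simp add: ac_simps)
      also have "\<dots> = f * (p * u)" using u by (simp add: ac_simps)
      finally show ?thesis .
    qed
    then have "p dvd v * r" using f by simp
    moreover have "\<not> p dvd r"
    proof
      assume "p dvd r"
      then obtain r' where "r = p * r'" by (elim dvdE)
      then have "p * g = p * (f * r')" using r by (simp add: ac_simps)
      then show False using fg p(1) by auto
    qed
    ultimately show "v \<in> {v \<in> ?S. p dvd v}"
      using p(1) v g(3) prime_elem_dvd_multD by blast
  next
    fix v assume "v \<in> {v \<in> ?S. p dvd v}"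
    then show "v \<in> P" using p(3) g(3) by (auto intro: dvd_trans mult_dvd_mono)
  qed
  then show ?thesis using p pS bipoly_PIdl[OF pS] by auto
qed

text \<open>With f = p g, the annihilator of the class of g is (p).\<close>

lemma prime_factor_associated:
  assumes p: "prime_elem p" "p dvd f"
  shows "PIdl\<^bsub>bipoly_ring m n\<^esub> p \<in> associated_primes (bipoly_ring m n)
    (hypersurface m n f)"
proof -
  let ?S = "polys_in {..<m + n} :: 'k mpoly set"
  obtain g where g: "f = p * g" using p by (elim dvdE)
  have S: "p \<in> ?S" "g \<in> ?S" using p(2) f polys_in_dvd polys_in_quot[OF g f(2,1)] by blast+
  have "g \<noteq> 0" using g f by auto
  have P: "PIdl\<^bsub>bipoly_ring m n\<^esub> p = {v \<in> ?S. f dvd v * g}"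
    unfolding bipoly_PIdl[OF S(1)] using \<open>g \<noteq> 0\<close> by (simp add: g)
  have "primeideal (PIdl\<^bsub>bipoly_ring m n\<^esub> p) (bipoly_ring m n)"
  proof (intro primeidealI)
    show "ideal (PIdl\<^bsub>bipoly_ring m n\<^esub> p) (bipoly_ring m n)"
      by (simp add: cring.cgenideal_ideal[OF cring_bipoly] carrier_bipoly S)
    have "1 \<notin> PIdl\<^bsub>bipoly_ring m n\<^esub> p"
      using p(1) by (simp add: bipoly_PIdl[OF S(1)] prime_elem_not_unit)
    then show "carrier (bipoly_ring m n) \<noteq> PIdl\<^bsub>bipoly_ring m n\<^esub> p"
      by (metis carrier_bipoly polys_in_1)
  qed (use p(1) in \<open>auto simp: cring_bipoly bipoly_PIdl[OF S(1)] carrier_bipoly dest: prime_elem_dvd_multD\<close>)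
  then show ?thesis
    unfolding associated_primes_def J.M_carrier using S(2)
    by (auto simp: P annihilator_hypersurface)
qed

end

section \<open>Regular sequences on cyclic modules\<close>

definition ideal_adjoin :: "nat \<Rightarrow> nat \<Rightarrow> 'k::field mpoly set \<Rightarrow> 'k mpoly \<Rightarrow> 'k mpoly set"
  where "ideal_adjoin m n J z = {w + z * v | w v. w \<in> J \<and> v \<in> polys_in {..<m + n}}"

abbreviation (input) "ideal_adjoin_list m n \<equiv> foldl (ideal_adjoin m n)"

text \<open>The nonzerodivisor conditions of a regular sequence without the final one that the
  quotient be nonzero. They are moved from quotient modules to ideals of S, where recursion on the
  list is possible.\<close>

fun weakly_regular :: "nat \<Rightarrow> nat \<Rightarrow> 'k::field mpoly set \<Rightarrow> 'k mpoly list \<Rightarrow> bool" where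
  "weakly_regular m n J [] \<longleftrightarrow> True"
| "weakly_regular m n J (z # zs) \<longleftrightarrow>
    (\<forall>v\<in>polys_in {..<m + n}. z * v \<in> J \<longrightarrow> v \<in> J) \<and> weakly_regular m n (ideal_adjoin m n J z) zs"

lemma weakly_regular_iff_nth:
  "weakly_regular m n J zs \<longleftrightarrow>
    (\<forall>i<length zs. \<forall>v\<in>polys_in {..<m + n}.
      zs ! i * v \<in> ideal_adjoin_list m n J (take i zs) \<longrightarrow> v \<in> ideal_adjoin_list m n J (take i zs))"
  by (induction zs arbitrary: J) (simp_all add: All_less_Suc2)

lemma ideal_ideal_adjoin:
  assumes "ideal J (bipoly_ring m n)" "z \<in> polys_in {..<m + n}"
  shows "ideal (ideal_adjoin m n J z) (bipoly_ring m n)"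
proof -
  interpret bipoly_ideal m n J by (rule bipoly_ideal.intro) fact
  show ?thesis
    unfolding bipoly_ideal_iff
  proof (intro conjI ballI)
    show "ideal_adjoin m n J z \<subseteq> S"
      using assms(2) I_S by (auto simp: ideal_adjoin_def intro!: polys_in_add polys_in_mult)
    show "0 \<in> ideal_adjoin m n J z"
      using I_0 by (auto simp: ideal_adjoin_def intro!: exI[of _ 0])
    fix x y assume y: "y \<in> ideal_adjoin m n J z"
    then obtain w v where wv: "y = w + z * v" "w \<in> J" "v \<in> S"
      by (auto simp: ideal_adjoin_def)
    {
      assume "x \<in> ideal_adjoin m n J z"
      then obtain w' v' where wv': "x = w' + z * v'" "w' \<in> J" "v' \<in> S"
        by (auto simp: ideal_adjoin_def)
      have "x + y = (w' + w) + z * (v' + v)" by (simp add: wv wv' algebra_simps)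
      then show "x + y \<in> ideal_adjoin m n J z"
        unfolding ideal_adjoin_def using wv wv' I_add polys_in_add by blast
    next
      assume x: "x \<in> S"
      have "x * y = x * w + z * (x * v)" by (simp add: wv algebra_simps)
      then show "x * y \<in> ideal_adjoin m n J z"
        unfolding ideal_adjoin_def using wv x I_mult polys_in_mult by blast
    }
  qed
qed

lemma ideal_ideal_adjoin_list:
  "ideal J (bipoly_ring m n) \<Longrightarrow> set zs \<subseteq> polys_in {..<m + n} \<Longrightarrow>
    ideal (ideal_adjoin_list m n J zs) (bipoly_ring m n)"
  by (induction zs arbitrary: J) (auto simp: ideal_ideal_adjoin)

lemma ideal_adjoin_superset: "J \<subseteq> ideal_adjoin m n J z"
proof
  fix v assume "v \<in> J"
  then show "v \<in> ideal_adjoin m n J z"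
    unfolding ideal_adjoin_def by (intro CollectI exI[of _ v] exI[of _ 0]) simp
qed

lemma ideal_adjoin_list_superset: "J \<subseteq> ideal_adjoin_list m n J zs"
  by (induction zs arbitrary: J) (auto dest: set_mp[OF ideal_adjoin_superset])

lemma ideal_adjoin_subset:
  assumes "ideal N (bipoly_ring m n)" "J \<subseteq> N" "z \<in> N"
  shows "ideal_adjoin m n J z \<subseteq> N"
proof -
  interpret bipoly_ideal m n N by (rule bipoly_ideal.intro) fact
  show ?thesis
    using assms(2,3) I_add I_mult by (auto simp: ideal_adjoin_def mult.commute[of z])
qed

lemma ideal_adjoin_list_subset:
  "ideal N (bipoly_ring m n) \<Longrightarrow> J \<subseteq> N \<Longrightarrow> set zs \<subseteq> N \<Longrightarrow> ideal_adjoin_list m n J zs \<subseteq> N"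
  by (induction zs arbitrary: J) (auto dest: ideal_adjoin_subset)

lemma ideal_adjoin_list_eq_sum:
  "ideal_adjoin_list m n J zs =
    {w + (\<Sum>j<length zs. zs ! j * v j) | w v. w \<in> J \<and> v \<in> {..<length zs} \<rightarrow> polys_in {..<m + n}}"
proof (induction zs rule: rev_induct)
  case (snoc z zs)
  let ?r = "length zs"
  have sum: "(\<Sum>j<length (zs @ [z]). (zs @ [z]) ! j * v j) = (\<Sum>j<?r. zs ! j * v j) + z * v ?r" for v
    by (simp add: nth_append)
  have L: "ideal_adjoin_list m n J (zs @ [z]) = ideal_adjoin m n {w + (\<Sum>j<?r. zs ! j * v j) | w v.
      w \<in> J \<and> v \<in> {..<?r} \<rightarrow> polys_in {..<m + n}} z"
    by (simp add: snoc)
  show ?case (is "?L = ?R")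
  proof (intro equalityI subsetI)
    fix x assume "x \<in> ?L"
    then obtain w u v where "x = w + (\<Sum>j<?r. zs ! j * v j) + z * u" "w \<in> J" "u \<in> polys_in {..<m + n}"
      "v \<in> {..<?r} \<rightarrow> polys_in {..<m + n}"
      unfolding L unfolding ideal_adjoin_def by blast
    then show "x \<in> ?R"
      unfolding sum by (intro CollectI exI[of _ w] exI[of _ "v(?r := u)"]) (auto simp: Pi_iff less_Suc_eq)
  next
    fix x assume "x \<in> ?R"
    then obtain w v where "x = w + ((\<Sum>j<?r. zs ! j * v j) + z * v ?r)" "w \<in> J"
      "v \<in> {..<Suc ?r} \<rightarrow> polys_in {..<m + n}"
      unfolding sum by auto
    moreover from this(3) have "v \<in> {..<?r} \<rightarrow> polys_in {..<m + n}" "v ?r \<in> polys_in {..<m + n}"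
      by auto
    ultimately show "x \<in> ?L"
      unfolding L unfolding ideal_adjoin_def by (intro CollectI exI[of _ "w + (\<Sum>j<?r. zs ! j * v j)"]
          exI[of _ "v ?r"]) (auto simp: add.assoc)
  qed
qed auto

section \<open>Translation from quotient modules to ideals of S\<close>

context bipoly_ideal
begin

lemma sum_mem_I: "(\<And>i. i \<in> X \<Longrightarrow> g i \<in> I) \<Longrightarrow> (\<Sum>i\<in>X. g i) \<in> I"
  by (induction X rule: infinite_finite_induct) (auto simp: I_0 I_add)

lemma list_submodule_M:
  assumes "set xs \<subseteq> S"
  shows "list_submodule xs M = cs ` ideal_adjoin_list m n I xs"
proof -
  let ?r = "length xs"
  have xs: "xs ! j \<in> S" if "j < ?r" for j using that assms by auto
  have fs: "(\<Oplus>\<^bsub>M\<^esub>j\<in>{..<?r}. xs ! j \<odot>\<^bsub>M\<^esub> V j) = cs (\<Sum>j<?r. xs ! j * v j)"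
    if "\<And>j. j < ?r \<Longrightarrow> v j \<in> S" "\<And>j. j < ?r \<Longrightarrow> V j = cs (v j)" for V v
  proof -
    have "(\<Oplus>\<^bsub>M\<^esub>j\<in>{..<?r}. xs ! j \<odot>\<^bsub>M\<^esub> V j) = (\<Oplus>\<^bsub>M\<^esub>j\<in>{..<?r}. cs (xs ! j * v j))"
      using that xs by (intro M.finsum_cong') (auto simp: M_smult M_carrier polys_in_mult)
    also have "\<dots> = cs (\<Sum>j<?r. xs ! j * v j)"
      using that xs by (intro M_finsum polys_in_mult) auto
    finally show ?thesis .
  qed
  have sumS: "(\<Sum>j<?r. xs ! j * v j) \<in> S" if "\<And>j. j < ?r \<Longrightarrow> v j \<in> S" for v
    using that xs by (intro polys_in_sum polys_in_mult) auto
  show ?thesis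
    unfolding list_submodule_def ideal_adjoin_list_eq_sum
  proof (intro equalityI subsetI)
    fix A assume "A \<in> {\<Oplus>\<^bsub>M\<^esub>j\<in>{..<?r}. xs ! j \<odot>\<^bsub>M\<^esub> V j | V. V \<in> {..<?r} \<rightarrow> carrier M}"
    then obtain V where V: "A = (\<Oplus>\<^bsub>M\<^esub>j\<in>{..<?r}. xs ! j \<odot>\<^bsub>M\<^esub> V j)" "V \<in> {..<?r} \<rightarrow> carrier M"
      by blast
    then have "\<forall>j\<in>{..<?r}. \<exists>v. v \<in> S \<and> V j = cs v" by (auto simp: M_carrier)
    then obtain v where v: "\<forall>j\<in>{..<?r}. v j \<in> S \<and> V j = cs (v j)" by metis
    then have "A = cs (0 + (\<Sum>j<?r. xs ! j * v j))" using V(1) fs[of v V] by simp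
    then show "A \<in> cs ` {w + (\<Sum>j<?r. xs ! j * v j) | w v. w \<in> I \<and> v \<in> {..<?r} \<rightarrow> S}"
      using v I_0 by blast
  next
    fix A assume "A \<in> cs ` {w + (\<Sum>j<?r. xs ! j * v j) | w v. w \<in> I \<and> v \<in> {..<?r} \<rightarrow> S}"
    then obtain w v where wv: "A = cs (w + (\<Sum>j<?r. xs ! j * v j))" "w \<in> I" "v \<in> {..<?r} \<rightarrow> S"
      by blast
    have v: "v j \<in> S" if "j < ?r" for j using that wv(3) by auto
    have "A = cs (\<Sum>j<?r. xs ! j * v j)"
      unfolding wv(1) using wv(2) sumS[OF v] I_S by (subst cs_eq_iff) (auto intro: polys_in_add)
    also have "\<dots> = (\<Oplus>\<^bsub>M\<^esub>j\<in>{..<?r}. xs ! j \<odot>\<^bsub>M\<^esub> cs (v j))"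
      using fs[of v "\<lambda>j. cs (v j)"] v by simp
    finally show "A \<in> {\<Oplus>\<^bsub>M\<^esub>j\<in>{..<?r}. xs ! j \<odot>\<^bsub>M\<^esub> V j | V. V \<in> {..<?r} \<rightarrow> carrier M}"
      using v by (intro CollectI exI[of _ "\<lambda>j. cs (v j)"]) (auto simp: M_carrier)
  qed
qed

context
  fixes J assumes J: "ideal J R" "I \<subseteq> J"
begin

interpretation J: bipoly_ideal m n J by (rule bipoly_ideal.intro) (rule J(1))

text \<open>The submodule J/I of S/I appears as the image of J under \<open>cs\<close>. Its cosets
  are images of cosets of J in S, so that (S/I)/(J/I) is computed as S/J.\<close>

lemma coset_J: "v \<in> S \<Longrightarrow> cs ` J +>\<^bsub>M\<^esub> cs v = cs ` {j + v | j. j \<in> J}"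
  unfolding a_r_coset_def'[of M] using M_add[OF J.I_S, of _ v] by fastforce

lemma coset_J_eq_iff:
  assumes "v \<in> S"
  shows "cs ` J +>\<^bsub>M\<^esub> cs v = cs ` J \<longleftrightarrow> v \<in> J"
proof
  assume *: "cs ` J +>\<^bsub>M\<^esub> cs v = cs ` J"
  have "cs (0 + v) \<in> cs ` {j + v | j. j \<in> J}" using J.I_0 by blast
  then obtain j where j: "j \<in> J" "cs v = cs j" using * coset_J[OF assms] by auto
  then have "v - j \<in> J" using cs_eq_iff[OF assms J.I_S] J(2) by auto
  from J.I_add[OF this j(1)] show "v \<in> J" by simp
next
  assume v: "v \<in> J"
  have "{j + v | j. j \<in> J} = J"
    using v J.I_add J.I_diff by (auto intro!: exI[of _ "_ - v"])
  then show "cs ` J +>\<^bsub>M\<^esub> cs v = cs ` J" by (simp add: coset_J assms)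
qed

lemma coset_J_shift:
  assumes "v \<in> S" "j \<in> J"
  shows "cs ` J +>\<^bsub>M\<^esub> cs (j + v) = cs ` J +>\<^bsub>M\<^esub> cs v"
proof -
  have "{i + (j + v) | i. i \<in> J} = {i + v | i. i \<in> J}" (is "?A = ?B")
  proof (intro equalityI subsetI)
    fix x assume "x \<in> ?A"
    then obtain i where "i \<in> J" "x = (i + j) + v" by (auto simp: add.assoc)
    then show "x \<in> ?B" using J.I_add assms(2) by blast
  next
    fix x assume "x \<in> ?B"
    then obtain i where "i \<in> J" "x = (i - j) + (j + v)" by auto
    then show "x \<in> ?A" using J.I_diff assms(2) by blast
  qed
  then show ?thesis using assms J.I_S by (simp add: coset_J polys_in_add)
qed

lemma quot_module_carrier: "carrier (quot_module M (cs ` J)) = (\<lambda>v. cs ` J +>\<^bsub>M\<^esub> cs v) ` S"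
  by (auto simp: quot_module_def A_RCOSETS_def' M_carrier)

lemma quot_module_smult:
  assumes "x \<in> S" "v \<in> S"
  shows "x \<odot>\<^bsub>quot_module M (cs ` J)\<^esub> (cs ` J +>\<^bsub>M\<^esub> cs v) = cs ` J +>\<^bsub>M\<^esub> cs (x * v)"
proof -
  have "cs ` J +>\<^bsub>M\<^esub> (x \<odot>\<^bsub>M\<^esub> A) = cs ` J +>\<^bsub>M\<^esub> cs (x * v)" if A: "A \<in> cs ` {j + v | j. j \<in> J}" for A
  proof -
    obtain j where j: "j \<in> J" "A = cs (j + v)" using A by auto
    then have "x \<odot>\<^bsub>M\<^esub> A = cs (x * j + x * v)"
      using assms J.I_S by (simp add: M_smult polys_in_add distrib_left)
    then show ?thesis using coset_J_shift[of "x * v" "x * j"] assms j J.I_mult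
      by (simp add: polys_in_mult)
  qed
  moreover have "cs ` {j + v | j. j \<in> J} \<noteq> {}" using J.I_0 by auto
  ultimately show ?thesis
    unfolding quot_module_def by (simp add: coset_J[OF assms(2)])
qed

lemma nonzerodivisor_on_quot_iff:
  assumes "x \<in> S"
  shows "nonzerodivisor_on x (quot_module M (cs ` J)) \<longleftrightarrow> (\<forall>v\<in>S. x * v \<in> J \<longrightarrow> v \<in> J)"
proof -
  have "\<zero>\<^bsub>quot_module M (cs ` J)\<^esub> = cs ` J" by (simp add: quot_module_def)
  then show ?thesis
    using assms by (simp add: nonzerodivisor_on_def quot_module_carrier quot_module_smult
        coset_J_eq_iff polys_in_mult)
qed

lemma nonzero_quot_iff: "nonzero_module (quot_module M (cs ` J)) \<longleftrightarrow> 1 \<notin> J"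
proof -
  have z: "\<zero>\<^bsub>quot_module M (cs ` J)\<^esub> = cs ` J" by (simp add: quot_module_def)
  have "nonzero_module (quot_module M (cs ` J)) \<longleftrightarrow> (\<exists>v\<in>S. cs ` J +>\<^bsub>M\<^esub> cs v \<noteq> cs ` J)"
    unfolding nonzero_module_def quot_module_carrier z
    by (auto simp: image_def set_eq_iff[of "{_. _}"]) (metis polys_in_0)+
  also have "\<dots> \<longleftrightarrow> (\<exists>v\<in>S. v \<notin> J)" by (simp add: coset_J_eq_iff)
  also have "\<dots> \<longleftrightarrow> 1 \<notin> J" using J.I_mult[of _ 1] by auto
  finally show ?thesis .
qed

end

lemma regular_sequence_iff:
  "regular_sequence R M xs \<longleftrightarrow>
    set xs \<subseteq> S \<and> weakly_regular m n I xs \<and> 1 \<notin> ideal_adjoin_list m n I xs"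
proof (cases "set xs \<subseteq> S")
  case True
  have J: "ideal (ideal_adjoin_list m n I ys) R" "I \<subseteq> ideal_adjoin_list m n I ys"
    "list_submodule ys M = cs ` ideal_adjoin_list m n I ys" if "set ys \<subseteq> S" for ys
    using that by (auto simp: ideal_ideal_adjoin_list is_ideal list_submodule_M
        dest: set_mp[OF ideal_adjoin_list_superset])
  have take: "set (take i xs) \<subseteq> S" for i using True set_take_subset[of i xs] by auto
  have "nonzerodivisor_on (xs ! i) (quot_module M (list_submodule (take i xs) M)) \<longleftrightarrow>
     (\<forall>v\<in>S. xs ! i * v \<in> ideal_adjoin_list m n I (take i xs) \<longrightarrow>
       v \<in> ideal_adjoin_list m n I (take i xs))"
    if "i < length xs" for i
    unfolding J(3)[OF take] using True that
    by (intro nonzerodivisor_on_quot_iff[OF J(1,2)[OF take]]) auto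
  moreover have "nonzero_module (quot_module M (list_submodule xs M)) \<longleftrightarrow>
      1 \<notin> ideal_adjoin_list m n I xs"
    unfolding J(3)[OF True] by (rule nonzero_quot_iff[OF J(1,2)[OF True]])
  ultimately show ?thesis
    unfolding regular_sequence_def weakly_regular_iff_nth using True
    by (simp add: carrier_bipoly)
qed (simp add: regular_sequence_def carrier_bipoly)

end

abbreviation (input) irrelevant_ideal :: "nat \<Rightarrow> nat \<Rightarrow> 'k::field mpoly set"
  where "irrelevant_ideal m n \<equiv> Idl\<^bsub>bipoly_ring m n\<^esub> (set (y_vars m n))"

section \<open>Setting variables to zero\<close>

definition restrict_vars :: "nat set \<Rightarrow> 'k::field mpoly \<Rightarrow> 'k mpoly"
  where "restrict_vars V = pm_eval (single 0) (\<lambda>s. if keys s \<subseteq> V then single s 1 else 0)"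

interpretation restrict: pm_hom "single 0 :: 'k::field \<Rightarrow> 'k mpoly" "\<lambda>s. if keys s \<subseteq> V then single s 1 else 0"
  for V
  by standard (auto simp: single_add mult_single keys_add_nat)

lemmas restrict_vars_0 [simp] = restrict.eval_0[folded restrict_vars_def]
lemmas restrict_vars_add = restrict.eval_add[folded restrict_vars_def]
lemmas restrict_vars_mult = restrict.eval_mult[folded restrict_vars_def]

lemma restrict_vars_single: "restrict_vars V (single s c) = (if keys s \<subseteq> V then single s c else 0)"
  by (simp add: restrict_vars_def restrict.eval_single mult_single)

lemma lookup_restrict_vars: "lookup (restrict_vars V p) s = (if keys s \<subseteq> V then lookup p s else 0)"
  by (induction p rule: pm_induct)
    (auto simp: restrict_vars_single restrict_vars_add lookup_single lookup_add when_def)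

lemma restrict_vars_id: "p \<in> polys_in V \<Longrightarrow> restrict_vars V p = p"
  by (rule poly_mapping_eqI) (auto simp: lookup_restrict_vars polys_in_def in_keys_iff)

lemma restrict_vars_eq_0_iff: "restrict_vars V p = 0 \<longleftrightarrow> (\<forall>s\<in>keys p. \<not> keys s \<subseteq> V)"
  by (auto simp: poly_mapping_eq_iff fun_eq_iff lookup_restrict_vars in_keys_iff)

text \<open>The ideal Q as the kernel of the map that sets all y_j to zero, which makes properness
  and membership of single polynomials easy to test.\<close>

definition y_ideal :: "nat \<Rightarrow> nat \<Rightarrow> 'k::field mpoly set"
  where "y_ideal m n = {v \<in> polys_in {..<m + n}. restrict_vars {..<m} v = 0}"

lemma y_ideal_subset: "y_ideal m n \<subseteq> polys_in {..<m + n}"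
  by (auto simp: y_ideal_def)

text \<open>The preimage of a principal ideal under a ring map. For V the x-variables it is Q if g =
  0, and (g) + Q if g lies in K[x].\<close>

lemma ideal_restrict_dvd:
  "ideal {v \<in> polys_in {..<m + n}. g dvd restrict_vars V v} (bipoly_ring m n)"
  unfolding bipoly_ideal_iff
  by (auto simp: restrict_vars_add restrict_vars_mult polys_in_add polys_in_mult)

lemma ideal_y_ideal: "ideal (y_ideal m n) (bipoly_ring m n)"
  using ideal_restrict_dvd[of m n 0 "{..<m}"] by (simp add: y_ideal_def)

lemma set_y_vars: "set (y_vars m n) = (\<lambda>j. pvar (m + j)) ` {..<n}"
  by (auto simp: y_vars_def pvar_def)

lemma y_var_in_Idl: "j < n \<Longrightarrow> pvar (m + j) \<in> irrelevant_ideal m n"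
proof -
  assume j: "j < n"
  interpret cring "bipoly_ring m n" by (rule cring_bipoly)
  have "set (y_vars m n) \<subseteq> carrier (bipoly_ring m n)"
    by (auto simp: set_y_vars carrier_bipoly intro!: pvar_in)
  then show ?thesis using genideal_self j by (auto simp: set_y_vars)
qed

lemma Idl_y_vars_ideal: "ideal (irrelevant_ideal m n) (bipoly_ring m n)"
proof -
  interpret cring "bipoly_ring m n" by (rule cring_bipoly)
  show ?thesis
    by (rule genideal_ideal) (auto simp: set_y_vars carrier_bipoly intro!: pvar_in)
qed

lemma Idl_y_vars_subset: "irrelevant_ideal m n \<subseteq> y_ideal m n"
proof -
  interpret cring "bipoly_ring m n" by (rule cring_bipoly)
  have "pvar (m + j) \<in> y_ideal m n" if "j < n" for j
    using that by (auto simp: y_ideal_def pvar_in) (simp add: pvar_def restrict_vars_single)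
  then show ?thesis
    by (intro genideal_minimal ideal_y_ideal) (auto simp: set_y_vars)
qed

section \<open>Regular sequences obtained by substitution\<close>

text \<open>A retraction of S onto K[W], where W consists of the variables not yet eliminated. The
  ideal \<open>kernel_ideal f\<close> is the preimage of the ideal generated by
  \<open>\<phi> f\<close>, so that S modulo it is K[W] modulo \<open>\<phi> f\<close>.\<close>

locale substitution =
  fixes m n :: nat and W :: "nat set" and \<phi> :: "'k::field mpoly \<Rightarrow> 'k mpoly"
  assumes W: "W \<subseteq> {..<m + n}"
    and sub_add: "\<And>a b. \<phi> (a + b) = \<phi> a + \<phi> b"
    and sub_mult: "\<And>a b. \<phi> (a * b) = \<phi> a * \<phi> b"
    and sub_range: "\<And>v. v \<in> polys_in {..<m + n} \<Longrightarrow> \<phi> v \<in> polys_in W"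
    and sub_id: "\<And>v. v \<in> polys_in W \<Longrightarrow> \<phi> v = v"
begin

lemma sub_diff: "\<phi> (a - b) = \<phi> a - \<phi> b"
  using sub_add[of "a - b" b] by simp

definition kernel_ideal :: "'k mpoly \<Rightarrow> 'k mpoly set"
  where "kernel_ideal f = {v \<in> polys_in {..<m + n}. \<phi> f dvd \<phi> v}"

context
  fixes t :: nat and g f :: "'k mpoly"
  assumes t: "t \<in> W" and g: "g \<in> polys_in (W - {t})" and f: "f \<in> polys_in {..<m + n}"
begin

definition "subst_var v = poly (to_uni t v) g"

lemma subst_var_add: "subst_var (a + b) = subst_var a + subst_var b"
  and subst_var_mult: "subst_var (a * b) = subst_var a * subst_var b"
  and subst_var_diff: "subst_var (a - b) = subst_var a - subst_var b"
  by (simp_all add: subst_var_def to_uni_add to_uni_mult to_uni_diff)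

lemma subst_var_const: "v \<in> polys_in (W - {t}) \<Longrightarrow> subst_var v = v"
  by (simp add: subst_var_def to_uni_const[of v "W - {t}" t])

lemma subst_var_range:
  assumes "v \<in> polys_in W" shows "subst_var v \<in> polys_in (W - {t})"
  unfolding subst_var_def by (rule polys_in_poly) (use assms coeff_to_uni_in g in auto)

lemma subst_var_eq_0: "subst_var v = 0 \<Longrightarrow> pvar t - g dvd v"
proof -
  assume "subst_var v = 0"
  then have "[:- g, 1:] dvd to_uni t v" by (simp add: subst_var_def poly_eq_0_iff_dvd)
  then obtain q where "to_uni t v = [:- g, 1:] * q" by (elim dvdE)
  then have "v = poly ([:- g, 1:] * q) (pvar t)" by (metis poly_to_uni)
  then have "v = (pvar t - g) * poly q (pvar t)" by (simp add: algebra_simps)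
  then show ?thesis by (metis dvd_triv_left)
qed

lemma subst_var_root: "subst_var (pvar t - g) = 0"
  using subst_var_const[OF g] by (simp add: subst_var_diff) (simp add: subst_var_def to_uni_pvar)

lemma root_in: "pvar t - g \<in> polys_in W"
  using t g polys_in_mono[of "W - {t}" W] by (intro polys_in_diff pvar_in) auto

lemma substitution_step: "substitution m n (W - {t}) (\<lambda>v. subst_var (\<phi> v))"
proof
  fix v :: "'k mpoly" assume v: "v \<in> polys_in (W - {t})"
  then have "v \<in> polys_in W" using polys_in_mono[of "W - {t}" W] by auto
  then show "subst_var (\<phi> v) = v" by (simp add: sub_id subst_var_const v)
qed (use W in \<open>auto simp: sub_add sub_mult subst_var_add subst_var_mult
    intro: subst_var_range sub_range\<close>)

text \<open>The hypothesis says that (t - g) times \<open>\<phi> v\<close> equals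
  \<open>\<phi> f * u\<close> for some u. Substituting g for t kills the left side but not
  \<open>\<phi> f\<close>, so it kills u; hence t - g divides u and can be cancelled.\<close>

lemma root_regular:
  assumes nz: "subst_var (\<phi> f) \<noteq> 0" and v: "v \<in> polys_in {..<m + n}"
    and zv: "(pvar t - g) * v \<in> kernel_ideal f"
  shows "v \<in> kernel_ideal f"
proof -
  let ?z = "pvar t - g"
  obtain u where u: "?z * \<phi> v = \<phi> f * u"
    using zv by (auto simp: kernel_ideal_def sub_mult sub_id[OF root_in] elim: dvdE)
  then have "subst_var (\<phi> f) * subst_var u = 0"
    using subst_var_root by (metis mult_zero_left subst_var_mult)
  then have "?z dvd u" using nz subst_var_eq_0 by auto
  then obtain u' where "u = ?z * u'" by (elim dvdE)
  then have "?z * \<phi> v = ?z * (\<phi> f * u')" using u by (simp add: ac_simps)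
  moreover have "?z \<noteq> 0"
  proof
    assume "?z = 0"
    then have "pvar t = g" by simp
    then have "to_uni t g = [:0, 1:]" using to_uni_pvar[of t, where 'a = 'k] by metis
    then show False using to_uni_const[OF g, of t] by simp
  qed
  ultimately have "\<phi> v = \<phi> f * u'" by (simp only: mult_cancel_left) simp
  then show ?thesis using v by (simp add: kernel_ideal_def)
qed

text \<open>On K[W], the element t - g generates the kernel of substituting g for t. Adjoining it
  therefore composes the retraction with this substitution, and the construction can be repeated
  with one variable less.\<close>

lemma ideal_adjoin_root:
  assumes nz: "subst_var (\<phi> f) \<noteq> 0"
  shows "ideal_adjoin m n (kernel_ideal f) (pvar t - g) =
    {v \<in> polys_in {..<m + n}. subst_var (\<phi> f) dvd subst_var (\<phi> v)}"
proof (intro equalityI subsetI)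
  let ?z = "pvar t - g"
  have W_S: "polys_in W \<subseteq> polys_in {..<m + n}" by (rule polys_in_mono[OF W])
  fix x
  {
    assume "x \<in> ideal_adjoin m n (kernel_ideal f) ?z"
    then obtain w v u where wv: "x = w + ?z * v" "w \<in> polys_in {..<m + n}" "\<phi> w = \<phi> f * u"
      "v \<in> polys_in {..<m + n}"
      by (auto simp: ideal_adjoin_def kernel_ideal_def elim!: dvdE)
    have "subst_var (\<phi> x) = subst_var (\<phi> f) * subst_var u"
      unfolding wv(1) sub_add sub_mult sub_id[OF root_in] subst_var_add subst_var_mult wv(3)
        subst_var_root by simp
    moreover have "x \<in> polys_in {..<m + n}"
      unfolding wv(1) using wv root_in W_S by (intro polys_in_add polys_in_mult) auto
    ultimately show "x \<in> {v \<in> polys_in {..<m + n}. subst_var (\<phi> f) dvd subst_var (\<phi> v)}" by simp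
  next
    assume "x \<in> {v \<in> polys_in {..<m + n}. subst_var (\<phi> f) dvd subst_var (\<phi> v)}"
    then obtain u where x: "x \<in> polys_in {..<m + n}" "subst_var (\<phi> x) = subst_var (\<phi> f) * u"
      by (auto elim: dvdE)
    have "subst_var (\<phi> x) \<in> polys_in (W - {t})" by (intro subst_var_range sub_range x)
    then have u: "u \<in> polys_in (W - {t})"
      using x(2) nz polys_in_quot[OF x(2)] by (cases "u = 0") auto
    then have uW: "u \<in> polys_in W" using polys_in_mono[of "W - {t}" W] by auto
    have "subst_var (\<phi> x - \<phi> f * u) = 0"
      using x(2) by (simp add: subst_var_diff subst_var_mult subst_var_const[OF u])
    then obtain s where s: "\<phi> x - \<phi> f * u = ?z * s" using dvdE[OF subst_var_eq_0] by blast
    have "?z * s \<in> polys_in W"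
      unfolding s[symmetric] using sub_range x f uW by (intro polys_in_diff polys_in_mult) auto
    then have sW: "s \<in> polys_in W \<or> ?z * s = 0"
      using polys_in_quot[of "?z * s" ?z s] by auto
    \<comment> \<open>\<open>polys_in_quot\<close> applies to nonzero products only; if the product
      vanishes and s lies outside K[W], s is replaced by 0.\<close>
    define s' where "s' = (if s \<in> polys_in W then s else 0)"
    have s': "s' \<in> polys_in W" "?z * s' = ?z * s" using sW by (auto simp: s'_def)
    define w where "w = x - ?z * s'"
    have "\<phi> w = \<phi> x - ?z * s'"
      by (simp only: w_def sub_diff[of x "?z * s'"] sub_mult[of ?z s'] sub_id[OF root_in] sub_id[OF s'(1)])
    then have "\<phi> w = \<phi> f * u" by (simp only: s'(2) s[symmetric]) simp
    moreover have "w \<in> polys_in {..<m + n}"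
      unfolding w_def
      by (rule polys_in_diff[OF x(1) polys_in_mult[OF set_mp[OF W_S root_in] set_mp[OF W_S s'(1)]]])
    ultimately have "w \<in> kernel_ideal f" by (simp add: kernel_ideal_def)
    then show "x \<in> ideal_adjoin m n (kernel_ideal f) ?z"
      unfolding ideal_adjoin_def using s'(1) W_S by (intro CollectI exI[of _ w] exI[of _ s']) (auto simp: w_def)
  }
qed

end

end

text \<open>Setting the y_j to zero one after the other, that is g = 0 in each step, leaves f in
  K[x] unchanged, so its image never becomes zero.\<close>

lemma regular_y_vars:
  fixes f :: "'k::field mpoly"
  assumes sub: "substitution m n W \<phi>" and f: "f \<in> polys_in {..<m}" "f \<noteq> 0"
    and js: "distinct js" "set js \<subseteq> {..<n}" "(+) m ` set js \<subseteq> W" "{..<m} \<subseteq> W"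
  shows "weakly_regular m n (substitution.kernel_ideal m n \<phi> f) (map (\<lambda>j. pvar (m + j)) js)"
  using assms
proof (induction js arbitrary: W \<phi>)
  case (Cons j js)
  interpret substitution m n W \<phi> by fact
  have t: "m + j \<in> W" using Cons.prems by auto
  have g: "0 \<in> polys_in (W - {m + j})" by simp
  have fS: "f \<in> polys_in {..<m + n}" "f \<in> polys_in W" "f \<in> polys_in (W - {m + j})"
    using polys_in_mono[of "{..<m}" "{..<m + n}"] polys_in_mono[of "{..<m}" "W - {m + j}"]
      polys_in_mono[of "{..<m}" W] Cons.prems by auto
  have "subst_var (m + j) 0 (\<phi> f) = f"
    using fS by (simp add: sub_id subst_var_const[OF t g fS(1)])
  then have nz: "subst_var (m + j) 0 (\<phi> f) \<noteq> 0" using f by simp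
  note step = substitution_step[OF t g fS(1)]
  have "weakly_regular m n (substitution.kernel_ideal m n (\<lambda>v. subst_var (m + j) 0 (\<phi> v)) f)
      (map (\<lambda>j. pvar (m + j)) js)"
    using Cons.prems by (intro Cons.IH[OF step f]) auto
  then show ?case
    using ideal_adjoin_root[OF t g fS(1) nz] root_regular[OF t g fS(1) nz]
    unfolding substitution.kernel_ideal_def[OF step] by auto
qed simp

text \<open>Each step substitutes for y_j a power of y_l, a variable kept to the end. As a
  polynomial in y_j, the image of f has finitely many roots, while y_l has infinitely many powers,
  so some power keeps the image nonzero, over finite K as well. The exponent is positive so that the
  new element lies in Q.\<close>

lemma regular_y_powers:
  fixes f :: "'k::field mpoly"
  assumes sub: "substitution m n W \<phi>" and f: "f \<in> polys_in {..<m + n}" "\<phi> f \<noteq> 0"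
    and js: "distinct js" "set js \<subseteq> {..<n} - {l}" "(+) m ` set js \<subseteq> W" "m + l \<in> W" "l < n"
  shows "\<exists>zs. length zs = length js \<and> set zs \<subseteq> irrelevant_ideal m n \<and>
    weakly_regular m n (substitution.kernel_ideal m n \<phi> f) zs"
  using sub f(2) js
proof (induction js arbitrary: W \<phi>)
  case (Cons j js)
  interpret substitution m n W \<phi> by fact
  interpret Q: bipoly_ideal m n "irrelevant_ideal m n"
    by (rule bipoly_ideal.intro) (rule Idl_y_vars_ideal)
  have t: "m + j \<in> W" using Cons.prems by auto
  have inj: "inj (\<lambda>k. pvar (m + l) ^ Suc k :: 'k mpoly)"
  proof (rule injI)
    fix a b assume "pvar (m + l) ^ Suc a = (pvar (m + l) ^ Suc b :: 'k mpoly)"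
    then have "keys (single (single (m + l) (Suc a)) (1::'k)) = keys (single (single (m + l) (Suc b)) (1::'k))"
      by (simp only: pvar_power)
    then have "single (m + l) (Suc a) = single (m + l) (Suc b)" by simp
    then have "lookup (single (m + l) (Suc a)) (m + l) = lookup (single (m + l) (Suc b)) (m + l)" by simp
    then show "a = b" by simp
  qed
  have "finite {x. poly (to_uni (m + j) (\<phi> f)) x = 0}"
    using Cons.prems(2) by (intro poly_roots_finite) simp
  then have "\<not> range (\<lambda>k. pvar (m + l) ^ Suc k) \<subseteq> {x. poly (to_uni (m + j) (\<phi> f)) x = 0}"
    using range_inj_infinite[OF inj] by (metis finite_subset)
  then obtain k where k: "poly (to_uni (m + j) (\<phi> f)) (pvar (m + l) ^ Suc k) \<noteq> 0"
    by auto
  define g where "g = (pvar (m + l) ^ Suc k :: 'k mpoly)"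
  have g: "g \<in> polys_in (W - {m + j})"
    unfolding g_def using Cons.prems by (intro polys_in_power pvar_in) auto
  have nz: "subst_var (m + j) g (\<phi> f) \<noteq> 0"
    unfolding subst_var_def[OF t g f(1)] unfolding g_def by (rule k)
  note step = substitution_step[OF t g f(1)]
  obtain zs where zs: "length zs = length js" "set zs \<subseteq> irrelevant_ideal m n"
    "weakly_regular m n (substitution.kernel_ideal m n (\<lambda>v. subst_var (m + j) g (\<phi> v)) f) zs"
  proof -
    have "(+) m ` set js \<subseteq> W - {m + j}" using Cons.prems by auto
    then have "\<exists>zs. length zs = length js \<and> set zs \<subseteq> irrelevant_ideal m n \<and>
        weakly_regular m n (substitution.kernel_ideal m n (\<lambda>v. subst_var (m + j) g (\<phi> v)) f) zs"
      using Cons.prems by (intro Cons.IH[OF step nz]) auto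
    then show ?thesis using that by blast
  qed
  have "g \<in> irrelevant_ideal m n"
    unfolding g_def power_Suc2 using Cons.prems
    by (intro Q.I_mult polys_in_power pvar_in y_var_in_Idl) auto
  then have "pvar (m + j) - g \<in> irrelevant_ideal m n"
    using Cons.prems by (intro Q.I_diff y_var_in_Idl) auto
  then show ?case
    using zs ideal_adjoin_root[OF t g f(1) nz] root_regular[OF t g f(1) nz]
    unfolding substitution.kernel_ideal_def[OF step]
    by (intro exI[of _ "(pvar (m + j) - g) # zs"]) auto
qed simp

section \<open>The length of a regular sequence in the ideal of the \<open>y\<^sub>j\<close>\<close>

definition zpow :: "'a::comm_semiring_1 list \<Rightarrow> nat list \<Rightarrow> 'a"
  where "zpow zs es = prod_list (map2 (^) zs es)"

text \<open>A box of exponent vectors, rather than those of bounded total degree, so that peeling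
  off the first element of the sequence leaves a box again.\<close>

definition exps :: "nat \<Rightarrow> nat \<Rightarrow> nat list set"
  where "exps r d = {es. set es \<subseteq> {..d} \<and> length es = r}"

lemma exps_0: "exps 0 d = {[]}"
  by (auto simp: exps_def)

lemma sum_exps_Suc: "(\<Sum>es\<in>exps (Suc r) d. F es) = (\<Sum>k\<le>d. \<Sum>es\<in>exps r d. F (k # es))"
proof -
  have "exps (Suc r) d = (\<lambda>(k, es). k # es) ` ({..d} \<times> exps r d)"
    by (force simp: exps_def length_Suc_conv image_iff)
  moreover have "inj_on (\<lambda>(k, es). k # es) ({..d} \<times> exps r d)"
    by (auto simp: inj_on_def)
  ultimately show ?thesis
    by (simp add: sum.reindex sum.cartesian_product split_def)
qed

lemma finite_exps: "finite (exps r d)" and card_exps: "card (exps r d) = Suc d ^ r"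
  unfolding exps_def using finite_lists_length_eq[of "{..d}" r] card_lists_length_eq[of "{..d}" r]
  by auto

lemma zpow_Cons: "zpow (z # zs) (k # es) = z ^ k * zpow zs es"
  by (simp add: zpow_def)

text \<open>A relation among the powers of \<open>z\<close> can be read modulo \<open>z\<close> and then divided by \<open>z\<close>.\<close>

lemma weakly_regular_independent:
  fixes zs :: "'k::field mpoly list"
  assumes "ideal I (bipoly_ring m n)" "weakly_regular m n I zs" "set zs \<subseteq> N"
    and N: "ideal N (bipoly_ring m n)" "\<And>c. c \<in> A \<Longrightarrow> c \<in> N \<Longrightarrow> c \<in> I0"
    and "I0 \<subseteq> I" "I \<subseteq> N" "A \<subseteq> polys_in {..<m + n}"
    and "\<And>es. es \<in> exps (length zs) d \<Longrightarrow> c es \<in> A"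
    and "(\<Sum>es\<in>exps (length zs) d. c es * zpow zs es) \<in> I"
    and "es \<in> exps (length zs) d"
  shows "c es \<in> I0"
  using assms(1-3,6-)
proof (induction zs arbitrary: I c es)
  case Nil
  \<comment> \<open>With no z left, the relation puts the coefficient into I, hence into N. This is
    what N is for: the ideals grow along the recursion but stay inside N, which meets A only within
    \<open>I0\<close>.\<close>
  then show ?case using N(2) by (auto simp: exps_0 zpow_def)
next
  case (Cons z zs)
  let ?S = "polys_in {..<m + n}"
  interpret bipoly_ideal m n I by (rule bipoly_ideal.intro) fact
  interpret N: bipoly_ideal m n N by (rule bipoly_ideal.intro) fact
  have zN: "z \<in> N" "set zs \<subseteq> N" and zS: "z \<in> ?S" "set zs \<subseteq> ?S"
    using Cons.prems(3) N.I_S by auto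
  have zpowS: "zpow zs es \<in> ?S" for es
    using zS(2)
  proof (induction zs arbitrary: es)
    case (Cons z zs)
    then show ?case
      by (cases es) (auto simp: zpow_def intro!: polys_in_mult polys_in_power)
  qed (simp add: zpow_def)
  define F where "F k = (\<Sum>es\<in>exps (length zs) d. c (k # es) * zpow zs es)" for k
  have cA: "c (k # es) \<in> A" if "k \<le> d" "es \<in> exps (length zs) d" for k es
    using Cons.prems(7)[of "k # es"] that by (auto simp: exps_def)
  have FS: "F k \<in> ?S" if "k \<le> d" for k
    unfolding F_def using cA[OF that] Cons.prems(6) zpowS by (intro polys_in_sum polys_in_mult) auto
  \<comment> \<open>The induction hypothesis for the remaining elements, applied modulo z.\<close>
  have coeffs: "\<forall>es\<in>exps (length zs) d. c (k # es) \<in> I0"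
    if k: "k \<le> d" and Fk: "F k \<in> ideal_adjoin m n I z" for k
  proof
    fix es assume es: "es \<in> exps (length zs) d"
    show "c (k # es) \<in> I0"
    proof (rule Cons.IH[of "ideal_adjoin m n I z" "\<lambda>es. c (k # es)"])
      show "ideal (ideal_adjoin m n I z) (bipoly_ring m n)"
        using ideal_ideal_adjoin[OF is_ideal zS(1)] .
      show "ideal_adjoin m n I z \<subseteq> N"
        using ideal_adjoin_subset[OF N(1)] Cons.prems zN by blast
      show "I0 \<subseteq> ideal_adjoin m n I z"
        using Cons.prems(4) ideal_adjoin_superset by blast
    qed (use Cons.prems zN es Fk cA[OF k] in \<open>auto simp: F_def\<close>)
  qed
  \<comment> \<open>Invariant of dividing k times by z. The term with index k then carries no power
    of z, so it can be read modulo z and dropped before the next division.\<close>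
  have tail: "(\<Sum>j=k..d. z ^ (j - k) * F j) \<in> I \<and> (\<forall>j<k. j \<le> d \<longrightarrow> (\<forall>es\<in>exps (length zs) d. c (j # es) \<in> I0))"
    if "k \<le> Suc d" for k
    using that
  proof (induction k)
    case 0
    have "(\<Sum>j=0..d. z ^ j * F j) = (\<Sum>es\<in>exps (Suc (length zs)) d. c es * zpow (z # zs) es)"
      unfolding sum_exps_Suc F_def
      by (simp add: zpow_Cons sum_distrib_left ac_simps atLeast0AtMost)
    then show ?case using Cons.prems(8) by simp
  next
    case (Suc k)
    then have k: "k \<le> d" by simp
    define T where "T = (\<Sum>j=Suc k..d. z ^ (j - Suc k) * F j)"
    have TS: "T \<in> ?S"
      unfolding T_def using FS zS by (intro polys_in_sum polys_in_mult polys_in_power) auto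
    have split: "(\<Sum>j=k..d. z ^ (j - k) * F j) = F k + z * T"
    proof -
      have "(\<Sum>j=k..d. z ^ (j - k) * F j) = F k + (\<Sum>j=Suc k..d. z ^ (j - k) * F j)"
        using k by (simp add: sum.atLeast_Suc_atMost)
      also have "(\<Sum>j=Suc k..d. z ^ (j - k) * F j) = z * T"
        unfolding T_def sum_distrib_left
      proof (rule sum.cong)
        fix j assume "j \<in> {Suc k..d}"
        then have "j - k = Suc (j - Suc k)" by auto
        then show "z ^ (j - k) * F j = z * (z ^ (j - Suc k) * F j)" by (simp add: mult.assoc)
      qed simp
      finally show ?thesis .
    qed
    have in_I: "F k + z * T \<in> I" using Suc split by simp
    have "F k \<in> ideal_adjoin m n I z"
      unfolding ideal_adjoin_def using in_I TS
      by (intro CollectI exI[of _ "F k + z * T"] exI[of _ "- T"]) simp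
    then have ck: "\<forall>es\<in>exps (length zs) d. c (k # es) \<in> I0" by (rule coeffs[OF k])
    have "F k \<in> I"
      unfolding F_def
    proof (rule sum_mem_I)
      fix es assume "es \<in> exps (length zs) d"
      then have "c (k # es) \<in> I" using ck Cons.prems(4) by blast
      from I_mult[OF zpowS this] show "c (k # es) * zpow zs es \<in> I" by (metis mult.commute)
    qed
    then have "z * T \<in> I" using I_diff[OF in_I \<open>F k \<in> I\<close>] by simp
    then have "T \<in> I" using Cons.prems(2) TS by simp
    then show ?case using Suc.IH k ck by (auto simp: T_def less_Suc_eq)
  qed
  obtain k es' where es: "es = k # es'" "k \<le> d" "es' \<in> exps (length zs) d"
    using Cons.prems(9) by (auto simp: exps_def length_Suc_conv)
  then show ?case using tail[of "Suc d"] by auto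
qed

text \<open>By Gaussian elimination, cross-multiplying instead of dividing.\<close>

lemma homogeneous_system:
  fixes p :: "'a::idom"
  assumes p: "prime_elem p \<or> p = 0"
    and A: "1 \<in> A" "0 \<in> A" "\<And>x y. x \<in> A \<Longrightarrow> y \<in> A \<Longrightarrow> x * y \<in> A"
      "\<And>x y. x \<in> A \<Longrightarrow> y \<in> A \<Longrightarrow> x - y \<in> A"
    and "finite T" "finite E" "card T < card E"
    and "\<And>t e. t \<in> T \<Longrightarrow> e \<in> E \<Longrightarrow> b t e \<in> A"
  shows "\<exists>c. (\<forall>e\<in>E. c e \<in> A) \<and> (\<exists>e\<in>E. \<not> p dvd c e) \<and> (\<forall>t\<in>T. p dvd (\<Sum>e\<in>E. c e * b t e))"
  using assms(6-)
proof (induction T arbitrary: E b rule: finite_induct)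
  case empty
  have "\<not> p dvd 1" using p by (auto simp: prime_elem_def)
  moreover have "E \<noteq> {}" using empty by auto
  ultimately show ?case using empty A by (intro exI[of _ "\<lambda>_. 1"]) auto
next
  case (insert t T)
  have pmult: "\<not> p dvd x * y" if "\<not> p dvd x" "\<not> p dvd y" for x y
    using p that prime_elem_dvd_multD by auto
  show ?case
  proof (cases "\<forall>e\<in>E. p dvd b t e")
    case True
    obtain c where "\<forall>e\<in>E. c e \<in> A" "\<exists>e\<in>E. \<not> p dvd c e" "\<forall>t\<in>T. p dvd (\<Sum>e\<in>E. c e * b t e)"
      using insert.IH[of E b] insert.prems insert.hyps by auto
    then show ?thesis using True by (intro exI[of _ c]) (auto intro!: dvd_sum)
  next
    case False
    then obtain e0 where e0: "e0 \<in> E" "\<not> p dvd b t e0" by blast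
    define E' where "E' = E - {e0}"
    \<comment> \<open>Eliminates the unknown \<open>e0\<close> by means of equation t, with all
      entries staying in A.\<close>
    define b' where "b' s e = b t e0 * b s e - b s e0 * b t e" for s e
    have E: "E = insert e0 E'" "e0 \<notin> E'" "finite E'" using e0 insert.prems by (auto simp: E'_def)
    have "b' s e \<in> A" if "s \<in> T" "e \<in> E'" for s e
      unfolding b'_def using that insert.prems(3) E by (intro A) auto
    moreover have "card T < card E'" using insert.prems insert.hyps E by simp
    ultimately obtain c where c: "\<forall>e\<in>E'. c e \<in> A" "\<exists>e\<in>E'. \<not> p dvd c e"
      "\<forall>s\<in>T. p dvd (\<Sum>e\<in>E'. c e * b' s e)"
      using insert.IH[of E' b'] E(3) by blast
    have A_add: "x + y \<in> A" if "x \<in> A" "y \<in> A" for x y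
      using A(4)[OF that(1) A(4)[OF A(2) that(2)]] by simp
    have A_sum: "(\<Sum>e\<in>E'. x e) \<in> A" if "\<And>e. e \<in> E' \<Longrightarrow> x e \<in> A" for x
      using E(3) that by (induction E' rule: finite_induct) (auto intro: A_add A(2))
    \<comment> \<open>The pivot coordinate makes equation t hold exactly. The others are scaled by
      the pivot \<open>b t e0\<close>, which p does not divide, so a coordinate not divisible by p
      stays so.\<close>
    define c' where "c' e = (if e = e0 then 0 - (\<Sum>e\<in>E'. c e * b t e) else b t e0 * c e)" for e
    have c'0: "c' e0 = - (\<Sum>e\<in>E'. c e * b t e)" by (simp add: c'_def)
    have sum: "(\<Sum>e\<in>E. c' e * b s e) = (\<Sum>e\<in>E'. c e * b' s e)" for s
    proof -
      have "(\<Sum>e\<in>E. c' e * b s e) = c' e0 * b s e0 + (\<Sum>e\<in>E'. b t e0 * c e * b s e)"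
        unfolding E(1) using E(2,3) by (simp add: c'_def) (rule sum.cong, auto)
      also have "\<dots> = (\<Sum>e\<in>E'. c e * b' s e)"
        unfolding c'0 b'_def
        by (simp add: sum_distrib_right sum_distrib_left right_diff_distrib sum_subtractf ac_simps)
      finally show ?thesis .
    qed
    show ?thesis
    proof (intro exI[of _ c'] conjI ballI)
      fix e assume e: "e \<in> E"
      have "(\<Sum>e\<in>E'. c e * b t e) \<in> A"
        using c(1) insert.prems(3) E by (intro A_sum A(3)) auto
      then have "0 - (\<Sum>e\<in>E'. c e * b t e) \<in> A" by (rule A(4)[OF A(2)])
      then show "c' e \<in> A"
        unfolding c'_def using e c(1) insert.prems(3) E by (auto intro!: A(3))
    next
      obtain e1 where e1: "e1 \<in> E'" "\<not> p dvd c e1" using c(2) by blast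
      then have "e1 \<noteq> e0" using E(2) by auto
      then have "\<not> p dvd c' e1" using pmult[OF e0(2) e1(2)] by (simp add: c'_def)
      then show "\<exists>e\<in>E. \<not> p dvd c' e" using e1(1) E(1) by auto
    next
      fix s assume "s \<in> insert t T"
      then show "p dvd (\<Sum>e\<in>E. c' e * b s e)"
        unfolding sum using c(3) by (auto simp: b'_def ac_simps)
    qed
  qed
qed

section \<open>Counting monomials in the y_j\<close>

definition y_exps :: "nat \<Rightarrow> nat \<Rightarrow> nat \<Rightarrow> (nat \<Rightarrow>\<^sub>0 nat) set"
  where "y_exps m n d = {t. keys t \<subseteq> {m..<m + n} \<and> (\<forall>i. lookup t i \<le> d)}"

lemma y_exps_finite_card: "finite (y_exps m n d) \<and> card (y_exps m n d) \<le> Suc d ^ n"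
proof -
  let ?f = "\<lambda>t. map (\<lambda>j. lookup t (m + j)) [0..<n]"
  have "inj_on ?f (y_exps m n d)"
  proof (rule inj_onI, rule poly_mapping_eqI)
    fix s t i assume st: "s \<in> y_exps m n d" "t \<in> y_exps m n d" "?f s = ?f t"
    show "lookup s i = lookup t i"
    proof (cases "i \<in> {m..<m + n}")
      case True
      then have "i - m < n" "m + (i - m) = i" by auto
      then show ?thesis using arg_cong[OF st(3), of "\<lambda>xs. xs ! (i - m)"] by simp
    next
      case False
      then have "i \<notin> keys s" "i \<notin> keys t" using st by (auto simp only: y_exps_def)
      then show ?thesis by (simp add: in_keys_iff)
    qed
  qed
  moreover have "?f ` y_exps m n d \<subseteq> exps n d" by (auto simp: y_exps_def exps_def)
  ultimately show ?thesis
    using finite_exps card_exps card_inj_on_le inj_on_finite by metis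
qed

lemma split_exponent:
  assumes "keys s \<subseteq> {..<m + n}" "\<forall>i. lookup s i \<le> d"
  shows "\<exists>u t. s = u + t \<and> keys u \<subseteq> {..<m} \<and> t \<in> y_exps m n d"
proof -
  define u where "u = (\<Sum>i<m. single i (lookup s i))"
  define t where "t = (\<Sum>i\<in>{m..<m+n}. single i (lookup s i))"
  have lu: "lookup u i = (if i < m then lookup s i else 0)" for i
  proof -
    have "lookup u i = (\<Sum>j<m. if j = i then lookup s j else 0)"
      unfolding u_def lookup_sum by (rule sum.cong) (auto simp: lookup_single when_def)
    then show ?thesis by simp
  qed
  have lt: "lookup t i = (if i \<in> {m..<m+n} then lookup s i else 0)" for i
  proof -
    have "lookup t i = (\<Sum>j\<in>{m..<m+n}. if j = i then lookup s j else 0)"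
      unfolding t_def lookup_sum by (rule sum.cong) (auto simp: lookup_single when_def)
    then show ?thesis by simp
  qed
  have "lookup s i = 0" if "\<not> i < m + n" for i
    using assms(1) that by (meson in_keys_iff lessThan_iff subsetD)
  then have "s = u + t"
    by (intro poly_mapping_eqI) (auto simp: lookup_add lu lt)
  moreover have "keys u \<subseteq> {..<m}" "t \<in> y_exps m n d"
    using assms(2) by (auto simp: y_exps_def in_keys_iff lu lt split: if_splits)
  ultimately show ?thesis by blast
qed

lemma y_expansion:
  fixes v :: "'k::field mpoly"
  assumes "v \<in> polys_in {..<m + n}" "\<And>s i. s \<in> keys v \<Longrightarrow> lookup s i \<le> d"
  shows "\<exists>b. (\<forall>t\<in>y_exps m n d. b t \<in> polys_in {..<m}) \<and> v = (\<Sum>t\<in>y_exps m n d. b t * single t 1)"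
proof -
  have "\<exists>b. (\<forall>t\<in>y_exps m n d. b t \<in> polys_in {..<m}) \<and>
      (\<Sum>s\<in>X. single s (lookup v s)) = (\<Sum>t\<in>y_exps m n d. b t * single t 1)" if "finite X" "X \<subseteq> keys v" for X
    using that
  proof (induction X rule: finite_induct)
    case empty
    then show ?case by (intro exI[of _ "\<lambda>_. 0"]) auto
  next
    case (insert s X)
    obtain b where b: "\<forall>t\<in>y_exps m n d. b t \<in> polys_in {..<m}"
      "(\<Sum>s\<in>X. single s (lookup v s)) = (\<Sum>t\<in>y_exps m n d. b t * single t 1)"
      using insert by auto
    have "s \<in> keys v" using insert by simp
    then obtain u t where ut: "s = u + t" "keys u \<subseteq> {..<m}" "t \<in> y_exps m n d"
      using split_exponent[of s m n d] assms by (auto simp: polys_in_def)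
    define b' where "b' t' = b t' + (if t' = t then single u (lookup v s) else 0)" for t'
    have "(\<Sum>t\<in>y_exps m n d. b' t * single t 1) =
        (\<Sum>t\<in>y_exps m n d. b t * single t 1) + (\<Sum>t'\<in>y_exps m n d. if t' = t then single s (lookup v s) else 0)"
      unfolding sum.distrib[symmetric]
      by (rule sum.cong) (auto simp: b'_def distrib_right mult_single ut(1))
    also have "\<dots> = (\<Sum>s\<in>insert s X. single s (lookup v s))"
      using insert b(2) ut(3) y_exps_finite_card by (simp add: add.commute)
    finally show ?case
      using b(1) ut(2) by (intro exI[of _ b']) (auto simp: b'_def intro!: polys_in_add polys_in_single)
  qed
  from this[of "keys v"] show ?thesis by (simp flip: pm_eq_sum_single)
qed

text \<open>Exponents add under multiplication, and each of the \<open>length zs\<close> powers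
  contributes at most \<open>d * D\<close>.\<close>

lemma zpow_exponent_bound:
  assumes "\<And>z s i. z \<in> set zs \<Longrightarrow> s \<in> keys z \<Longrightarrow> lookup s i \<le> D" "length es = length zs" "set es \<subseteq> {..d}"
    and "s \<in> keys (zpow zs es :: 'k::field mpoly)"
  shows "lookup s i \<le> length zs * (d * D)"
  using assms
proof (induction zs arbitrary: es s)
  case Nil
  then show ?case by (auto simp: zpow_def)
next
  case (Cons z zs)
  obtain k es' where es: "es = k # es'" using Cons.prems(2) by (cases es) auto
  obtain u v where uv: "s = u + v" "u \<in> keys (z ^ k)" "v \<in> keys (zpow zs es')"
    using Cons.prems(4) keys_mult[of "z ^ k" "zpow zs es'"] unfolding es zpow_Cons by blast
  have pow: "lookup u i \<le> k * D" if "u \<in> keys (z ^ k)" for u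
    using that
  proof (induction k arbitrary: u)
    case (Suc k)
    then obtain x y where "u = x + y" "x \<in> keys z" "y \<in> keys (z ^ k)"
      using keys_mult[of z "z ^ k"] by auto
    then show ?case using Suc.IH[of y] Cons.prems(1)[of z x i] by (simp add: lookup_add)
  qed auto
  have "lookup v i \<le> length zs * (d * D)"
    using Cons.IH[of es' v] Cons.prems es uv by auto
  moreover have "lookup u i \<le> d * D"
    using pow[OF uv(2)] Cons.prems(3) es by (meson atMost_iff le_trans list.set_intros(1) mult_le_mono1 subsetD)
  ultimately show ?case using uv(1) by (simp add: lookup_add)
qed

lemma zpow_in: "set zs \<subseteq> polys_in V \<Longrightarrow> zpow zs es \<in> polys_in V"
proof (induction zs arbitrary: es)
  case (Cons z zs)
  then show ?case by (cases es) (auto simp: zpow_def intro!: polys_in_mult polys_in_power)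
qed (simp add: zpow_def)

text \<open>More than \<open>n\<close> elements satisfy a nontrivial relation over \<open>K[x]/(p)\<close>, by counting monomials
  in the \<open>y\<^sub>j\<close>; multiplied by \<open>q\<close>, it is a relation modulo \<open>pq\<close>.\<close>

lemma weakly_regular_length_le:
  fixes p q :: "'k::field mpoly"
  assumes p: "prime_elem p \<or> p = 0" and pq: "p \<in> polys_in {..<m}" "q \<in> polys_in {..<m}" "\<not> p * q dvd q"
    and zs: "set zs \<subseteq> y_ideal m n"
    and reg: "weakly_regular m n {v \<in> polys_in {..<m + n}. p * q dvd v} zs"
  shows "length zs \<le> n"
proof (rule ccontr)
  assume "\<not> length zs \<le> n"
  then have r: "Suc n \<le> length zs" by simp
  define r where "r = length zs"
  let ?S = "polys_in {..<m + n} :: 'k mpoly set"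
  let ?A = "polys_in {..<m} :: 'k mpoly set"
  have AS: "?A \<subseteq> ?S" by (rule polys_in_mono) auto
  have zsS: "set zs \<subseteq> ?S" using zs y_ideal_subset by blast
  obtain D where D: "\<And>z s i. z \<in> set zs \<Longrightarrow> s \<in> keys z \<Longrightarrow> lookup s i \<le> D"
  proof -
    let ?X = "\<Union>z\<in>set zs. \<Union>s\<in>keys z. insert 0 (lookup s ` keys s)"
    have "lookup s i \<le> Max ?X" if "z \<in> set zs" "s \<in> keys z" for z s i
    proof (rule Max_ge)
      show "finite ?X" by auto
      have "lookup s i \<in> insert 0 (lookup s ` keys s)"
        by (cases "i \<in> keys s") (auto simp: not_in_keys_iff_lookup_eq_zero)
      then show "lookup s i \<in> ?X" using that by blast
    qed
    then show ?thesis using that by blast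
  qed
  \<comment> \<open>Large enough for the count: the y-exponents of the power products are at most E
    = r d D, and (E + 1)^n is at most (r D + 1)^n (d + 1)^n = d (d + 1)^n, which is less than (d +
    1)^(n + 1) and so less than the number (d + 1)^r of power products.\<close>
  define d where "d = Suc (r * D) ^ n"
  define E where "E = r * (d * D)"
  have "Suc E \<le> Suc (r * D) * Suc d" by (simp add: E_def algebra_simps)
  then have "Suc E ^ n \<le> d * Suc d ^ n"
    unfolding d_def by (metis power_mono power_mult_distrib zero_le)
  also have "\<dots> < Suc d ^ Suc n" by simp
  also have "\<dots> \<le> Suc d ^ r" using r by (intro power_increasing) (auto simp: r_def)
  finally have card: "card (y_exps m n E) < card (exps r d)"
    using y_exps_finite_card[of m n E] by (simp add: card_exps)
  have "\<exists>b. (\<forall>t\<in>y_exps m n E. b t \<in> ?A) \<and> zpow zs es = (\<Sum>t\<in>y_exps m n E. b t * single t 1)"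
    if es: "es \<in> exps r d" for es
  proof (rule y_expansion)
    fix s i assume "s \<in> keys (zpow zs es)"
    then show "lookup s i \<le> E"
      unfolding E_def r_def using zpow_exponent_bound[of zs D es d s i] D es
      by (auto simp: exps_def r_def)
  qed (rule zpow_in[OF zsS])
  then have "\<forall>es\<in>exps r d. \<exists>b. (\<forall>t\<in>y_exps m n E. b t \<in> ?A) \<and>
      zpow zs es = (\<Sum>t\<in>y_exps m n E. b t * single t 1)"
    by blast
  from bchoice[OF this] obtain b where b: "\<And>es t. es \<in> exps r d \<Longrightarrow> t \<in> y_exps m n E \<Longrightarrow> b es t \<in> ?A"
    "\<And>es. es \<in> exps r d \<Longrightarrow> zpow zs es = (\<Sum>t\<in>y_exps m n E. b es t * single t 1)"
    by blast
  obtain c where c: "\<forall>es\<in>exps r d. c es \<in> ?A" "\<exists>es\<in>exps r d. \<not> p dvd c es"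
    "\<forall>t\<in>y_exps m n E. p dvd (\<Sum>es\<in>exps r d. c es * b es t)"
    using homogeneous_system[OF p, of ?A "y_exps m n E" "exps r d" "\<lambda>t es. b es t"]
      b(1) card y_exps_finite_card[of m n E] finite_exps[of r d]
    by (auto intro: polys_in_mult polys_in_diff)
  have "(\<Sum>es\<in>exps r d. c es * zpow zs es) =
      (\<Sum>es\<in>exps r d. \<Sum>t\<in>y_exps m n E. c es * b es t * single t 1)"
    by (rule sum.cong) (auto simp: b(2) sum_distrib_left mult.assoc)
  also have "\<dots> = (\<Sum>t\<in>y_exps m n E. (\<Sum>es\<in>exps r d. c es * b es t) * single t 1)"
    by (subst sum.swap) (simp add: sum_distrib_right)
  finally have "p dvd (\<Sum>es\<in>exps r d. c es * zpow zs es)"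
    using c(3) by (simp only:) (rule dvd_sum, rule dvd_mult2, blast)
  then have "q * p dvd q * (\<Sum>es\<in>exps r d. c es * zpow zs es)"
    by (rule mult_dvd_mono[OF dvd_refl])
  then have dvd: "p * q dvd (\<Sum>es\<in>exps r d. q * c es * zpow zs es)"
    by (simp only: mult.commute[of p q] sum_distrib_left mult.assoc)
  let ?I = "{v \<in> ?S. p * q dvd v}"
  \<comment> \<open>The ideal (p q) + Q: it contains the sequence and meets K[x] in the multiples of
    p q only.\<close>
  let ?N = "{v \<in> ?S. p * q dvd restrict_vars {..<m} v}"
  have pqA: "p * q \<in> ?A" using pq by (intro polys_in_mult)
  have "q * c es \<in> ?I" if es: "es \<in> exps r d" for es
  proof (rule weakly_regular_independent[of ?I m n zs ?N ?A ?I d "\<lambda>es. q * c es" es])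
    show "ideal ?I (bipoly_ring m n)"
      unfolding bipoly_ideal_iff by (auto intro: polys_in_add polys_in_mult)
    show "ideal ?N (bipoly_ring m n)" by (rule ideal_restrict_dvd)
    show "set zs \<subseteq> ?N" using zs by (auto simp: y_ideal_def)
    show "?I \<subseteq> ?N"
      using restrict_vars_id[OF pqA] by (auto simp: restrict_vars_mult elim!: dvdE)
    show "x \<in> ?I" if "x \<in> ?A" "x \<in> ?N" for x
      using that restrict_vars_id[OF that(1)] by auto
    show "q * c es \<in> ?A" if "es \<in> exps (length zs) d" for es
      using that c(1) pq(2) by (auto simp: r_def intro: polys_in_mult)
    have "(\<Sum>es\<in>exps r d. q * c es * zpow zs es) \<in> ?S"
      using c(1) pq(2) AS zpow_in[OF zsS] by (intro polys_in_sum polys_in_mult) auto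
    then show "(\<Sum>es\<in>exps (length zs) d. q * c es * zpow zs es) \<in> ?I"
      using dvd by (simp add: r_def)
  qed (use reg AS es in \<open>auto simp: r_def\<close>)
  \<comment> \<open>Cancelling q makes p divide every coefficient, against the nontriviality of the
    relation.\<close>
  then have "p * q dvd q * c es" if "es \<in> exps r d" for es using that by auto
  moreover have "q \<noteq> 0" using pq(3) by auto
  ultimately have "p dvd c es" if "es \<in> exps r d" for es
    using that by (simp add: mult.commute[of p q])
  then show False using c(2) by blast
qed

section \<open>The grade of a hypersurface ring\<close>

lemma bihomogeneous_y_degree_0:
  assumes "bihomogeneous m n (a, 0) f" shows "f \<in> polys_in {..<m}"
  unfolding polys_in_def
proof (intro CollectI ballI subsetI)
  fix s i assume s: "s \<in> keys f" and i: "i \<in> keys s"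
  have "keys s \<subseteq> {..<m + n}" using s assms by (auto simp: bihomogeneous_def carrier_bipoly polys_in_def)
  moreover have "lookup s (m + j) = 0" if "j < n" for j
    using s that assms by (auto simp: bihomogeneous_def)
  ultimately show "i \<in> {..<m}"
    using i by (metis add_diff_inverse_nat in_keys_iff lessThan_iff nat_add_left_cancel_less subsetD)
qed

lemma bihomogeneous_y_degree_pos:
  assumes "bihomogeneous m n (a, b) f" "b > 0" shows "f \<in> y_ideal m n"
proof -
  have "\<not> keys s \<subseteq> {..<m}" if s: "s \<in> keys f" for s
  proof
    assume "keys s \<subseteq> {..<m}"
    then have "lookup s (m + j) = 0" for j by (metis in_keys_iff lessThan_iff not_add_less1 subsetD)
    then have "(\<Sum>j<n. lookup s (m + j)) = 0" by simp
    then show False using s assms by (auto simp: bihomogeneous_def)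
  qed
  then show ?thesis
    using assms(1) by (auto simp: y_ideal_def restrict_vars_eq_0_iff bihomogeneous_def carrier_bipoly)
qed

lemma ideal_y_ideal_proper: "1 \<notin> y_ideal m n"
  by (simp add: y_ideal_def restrict_vars_id)

lemma enat_Sup_lengths:
  assumes "\<And>xs. P xs \<Longrightarrow> length xs \<le> k" "P xs0" "length xs0 = k"
  shows "(SUP xs\<in>{xs. P xs}. enat (length xs)) = enat k"
  using assms by (intro antisym SUP_least) (auto intro!: SUP_upper2[of xs0])

lemma mpoly_prime_factor:
  fixes f :: "'k::field mpoly"
  assumes "f \<noteq> 0" "\<not> f dvd 1"
  shows "\<exists>p. prime_elem p \<and> p dvd f"
  using mpoly_prime_product[OF assms(1)] assms(2) by (cases rule: prime_product.cases) auto

context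
  fixes m n a b :: nat and f :: "'k::field mpoly"
  assumes f: "bihomogeneous m n (a, b) f" "f \<noteq> 0" "\<not> f dvd 1"
begin

private lemma f_S: "f \<in> polys_in {..<m + n}"
  using f by (simp add: bihomogeneous_def carrier_bipoly)

interpretation F: bipoly_ideal m n "PIdl\<^bsub>bipoly_ring m n\<^esub> f"
  by (rule PIdl_bipoly_ideal[OF f_S])

private lemma substitution_id: "substitution m n {..<m + n} (\<lambda>v. v)"
  by standard auto

private lemma kernel_id: "substitution.kernel_ideal m n (\<lambda>v. v) f = PIdl\<^bsub>bipoly_ring m n\<^esub> f"
  by (simp add: substitution.kernel_ideal_def[OF substitution_id] bipoly_PIdl[OF f_S])

text \<open>Here f lies in K[x], so the y_j themselves form a regular sequence. With a prime factor
  p of f and its cofactor q, both in K[x], the counting bound excludes anything longer.\<close>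

lemma grade_hypersurface_0:
  assumes b: "b = 0"
  shows "grade (bipoly_ring m n) (irrelevant_ideal m n)
    (hypersurface m n f) = enat n"
  unfolding grade_def
proof (rule enat_Sup_lengths)
  have f_x: "f \<in> polys_in {..<m}" using f(1) b bihomogeneous_y_degree_0 by blast
  fix xs
  assume xs: "set xs \<subseteq> irrelevant_ideal m n \<and> regular_sequence (bipoly_ring m n)
    (hypersurface m n f) xs"
  obtain p where p: "prime_elem p" "p dvd f" using mpoly_prime_factor[OF f(2,3)] by blast
  then obtain q where q: "f = p * q" by (elim dvdE)
  have pq: "p \<in> polys_in {..<m}" "q \<in> polys_in {..<m}"
    using polys_in_dvd[OF p(2) f(2) f_x] polys_in_quot[OF q f(2) f_x] .
  have "\<not> p * q dvd q"
  proof
    assume "p * q dvd q"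
    then have "q * p dvd q * 1" by (simp add: mult.commute)
    then have "p dvd 1" using q f(2) by (simp only: dvd_mult_cancel_left) auto
    then show False using p(1) prime_elem_not_unit by blast
  qed
  moreover have "weakly_regular m n {v \<in> polys_in {..<m + n}. p * q dvd v} xs"
    unfolding q[symmetric] using xs bipoly_PIdl[OF f_S] F.regular_sequence_iff by metis
  moreover have "set xs \<subseteq> y_ideal m n" using xs Idl_y_vars_subset by blast
  ultimately show "length xs \<le> n"
    using p(1) pq by (intro weakly_regular_length_le[of p m q xs n]) auto
next
  have f_x: "f \<in> polys_in {..<m}" using f(1) b bihomogeneous_y_degree_0 by blast
  let ?xs = "map (\<lambda>j. pvar (m + j)) [0..<n] :: 'k mpoly list"
  let ?N = "{v \<in> polys_in {..<m + n}. f dvd restrict_vars {..<m} v}"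
  have "weakly_regular m n (PIdl\<^bsub>bipoly_ring m n\<^esub> f) ?xs"
    unfolding kernel_id[symmetric]
    by (rule regular_y_vars[OF substitution_id f_x f(2)]) auto
  moreover have xs_Q: "set ?xs \<subseteq> irrelevant_ideal m n"
    using y_var_in_Idl by auto
  moreover have "ideal_adjoin_list m n (PIdl\<^bsub>bipoly_ring m n\<^esub> f) ?xs \<subseteq> ?N"
  proof (rule ideal_adjoin_list_subset[OF ideal_restrict_dvd])
    show "PIdl\<^bsub>bipoly_ring m n\<^esub> f \<subseteq> ?N"
      unfolding bipoly_PIdl[OF f_S] using restrict_vars_id[OF f_x]
      by (auto simp: restrict_vars_mult elim!: dvdE)
    show "set ?xs \<subseteq> ?N"
      using subset_trans[OF xs_Q Idl_y_vars_subset] unfolding y_ideal_def by (auto simp del: set_map)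
  qed
  moreover have "1 \<notin> ?N" using f(3) by (simp add: restrict_vars_id)
  moreover have "set ?xs \<subseteq> polys_in {..<m + n}" by (auto intro!: pvar_in)
  ultimately show "set ?xs \<subseteq> irrelevant_ideal m n \<and> regular_sequence (bipoly_ring m n)
    (hypersurface m n f) ?xs"
    unfolding F.regular_sequence_iff by blast
qed simp

text \<open>Since f lies in Q and is regular on S, a regular sequence on S/f with f put in front is
  weakly regular on S and has length at most n. The value n - 1 is reached by eliminating every y_j
  except the last. There is a last one, since b > 0 forces n > 0.\<close>

lemma grade_hypersurface_pos:
  assumes b: "b > 0"
  shows "n > 0 \<and> grade (bipoly_ring m n) (irrelevant_ideal m n)
    (hypersurface m n f) = enat (n - 1)"
proof
  have f_y: "f \<in> y_ideal m n" using f(1) b bihomogeneous_y_degree_pos by blast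
  show n: "n > 0"
  proof (rule ccontr)
    assume "\<not> n > 0"
    then have "f = 0" using f_y by (auto simp: y_ideal_def restrict_vars_id)
    then show False using f by simp
  qed
  obtain zs where zs: "length zs = length [0..<n - 1]"
    "set zs \<subseteq> irrelevant_ideal m n"
    "weakly_regular m n (PIdl\<^bsub>bipoly_ring m n\<^esub> f) zs"
    unfolding kernel_id[symmetric]
  proof -
    have "set [0..<n - 1] \<subseteq> {..<n} - {n - 1}" "(+) m ` set [0..<n - 1] \<subseteq> {..<m + n}"
      by auto
    then show ?thesis
      using regular_y_powers[OF substitution_id f_S f(2), where js = "[0..<n - 1]" and l = "n - 1"]
        n that unfolding kernel_id by auto
  qed
  show "grade (bipoly_ring m n) (irrelevant_ideal m n)
    (hypersurface m n f) = enat (n - 1)"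
    unfolding grade_def
  proof (rule enat_Sup_lengths)
    fix xs
    assume xs: "set xs \<subseteq> irrelevant_ideal m n \<and> regular_sequence (bipoly_ring m n)
      (hypersurface m n f) xs"
    \<comment> \<open>The zero ideal is written with \<open>0 * 1\<close> to match the counting
      bound for p = 0 and q = 1.\<close>
    have adj: "ideal_adjoin m n {v \<in> polys_in {..<m + n}. 0 * 1 dvd v} f = PIdl\<^bsub>bipoly_ring m n\<^esub> f"
      by (auto simp: ideal_adjoin_def cgenideal_def carrier_bipoly mult.commute)
    have "weakly_regular m n {v \<in> polys_in {..<m + n}. 0 * 1 dvd v} (f # xs)"
      unfolding weakly_regular.simps adj using xs f(2) by (auto simp: F.regular_sequence_iff)
    moreover have "set (f # xs) \<subseteq> y_ideal m n" using f_y xs Idl_y_vars_subset[of m n] by auto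
    ultimately have "length (f # xs) \<le> n"
      by (intro weakly_regular_length_le[of 0 m 1]) auto
    then show "length xs \<le> n - 1" by simp
  next
    have "ideal_adjoin_list m n (PIdl\<^bsub>bipoly_ring m n\<^esub> f) zs \<subseteq> y_ideal m n"
    proof (rule ideal_adjoin_list_subset[OF ideal_y_ideal])
      interpret cring "bipoly_ring m n" by (rule cring_bipoly)
      show "PIdl\<^bsub>bipoly_ring m n\<^esub> f \<subseteq> y_ideal m n" by (rule cgenideal_minimal[OF ideal_y_ideal f_y])
      show "set zs \<subseteq> y_ideal m n" using zs(2) Idl_y_vars_subset by blast
    qed
    then have "1 \<notin> ideal_adjoin_list m n (PIdl\<^bsub>bipoly_ring m n\<^esub> f) zs"
      using ideal_y_ideal_proper by blast
    moreover have "set zs \<subseteq> polys_in {..<m + n}"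
      using zs(2) Idl_y_vars_subset y_ideal_subset by blast
    ultimately show "set zs \<subseteq> irrelevant_ideal m n \<and> regular_sequence (bipoly_ring m n)
      (hypersurface m n f) zs"
      unfolding F.regular_sequence_iff using zs(2,3) by blast
  qed (use zs in simp)
qed

end

section \<open>Localizations at monomials as quotients of Laurent polynomials\<close>

type_synonym 'k laurent = "(nat \<Rightarrow>\<^sub>0 int) \<Rightarrow>\<^sub>0 'k"

definition int_exp :: "(nat \<Rightarrow>\<^sub>0 nat) \<Rightarrow> (nat \<Rightarrow>\<^sub>0 int)"
  where "int_exp = Poly_Mapping.map int"

lemma lookup_int_exp [simp]: "lookup (int_exp s) i = int (lookup s i)"
  by (simp add: int_exp_def Poly_Mapping.map.rep_eq when_def)

lemma int_exp_add: "int_exp (s + t) = int_exp s + int_exp t"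
  by (rule poly_mapping_eqI) (simp add: lookup_add)

lemma int_exp_0 [simp]: "int_exp 0 = 0"
  by (rule poly_mapping_eqI) simp

lemma int_exp_eq_iff [simp]: "int_exp s = int_exp t \<longleftrightarrow> s = t"
  by (metis lookup_int_exp of_nat_eq_iff poly_mapping_eqI)

definition to_laurent :: "'k::field mpoly \<Rightarrow> 'k laurent"
  where "to_laurent = pm_eval (single 0) (\<lambda>s. single (int_exp s) 1)"

interpretation laurent: pm_hom "single 0 :: 'k::field \<Rightarrow> 'k laurent" "\<lambda>s. single (int_exp s) 1"
  by standard (auto simp: single_add mult_single int_exp_add)

lemmas to_laurent_0 [simp] = laurent.eval_0[folded to_laurent_def]
lemmas to_laurent_add = laurent.eval_add[folded to_laurent_def]
lemmas to_laurent_mult = laurent.eval_mult[folded to_laurent_def]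
lemmas to_laurent_uminus = laurent.eval_uminus[folded to_laurent_def]
lemmas to_laurent_diff = laurent.eval_diff[folded to_laurent_def]
lemmas to_laurent_sum = laurent.eval_sum[folded to_laurent_def]

lemma to_laurent_single: "to_laurent (single s c) = single (int_exp s) c"
  by (simp add: to_laurent_def laurent.eval_single mult_single)

lemma lookup_to_laurent: "lookup (to_laurent p) (int_exp s) = lookup p s"
  by (induction p rule: pm_induct)
    (auto simp: to_laurent_single to_laurent_add lookup_single lookup_add when_def)

lemma to_laurent_eq_iff [simp]: "to_laurent p = to_laurent q \<longleftrightarrow> p = q"
  by (metis lookup_to_laurent poly_mapping_eqI)

lemma keys_to_laurent: "keys (to_laurent p) \<subseteq> int_exp ` keys p"
proof -
  have "to_laurent p = (\<Sum>s\<in>keys p. single (int_exp s) (lookup p s))"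
    by (subst pm_eq_sum_single[of p]) (simp add: to_laurent_sum to_laurent_single)
  then have "keys (to_laurent p) \<subseteq> (\<Union>s\<in>keys p. keys (single (int_exp s) (lookup p s)))"
    using keys_sum by metis
  then show ?thesis by (auto split: if_splits)
qed

definition laurent_frac :: "'k::field mpoly \<Rightarrow> (nat \<Rightarrow>\<^sub>0 nat) \<Rightarrow> 'k laurent"
  where "laurent_frac v t = to_laurent v * single (- int_exp t) 1"

lemma mult_laurent_frac: "single (int_exp (t + t')) 1 * laurent_frac v t = to_laurent (single t' 1 * v)"
proof -
  have "single (int_exp (t + t')) 1 * laurent_frac v t =
      (single (int_exp (t + t')) 1 * single (- int_exp t) 1) * to_laurent v"
    by (simp only: laurent_frac_def mult.assoc mult.commute mult.left_commute)
  also have "\<dots> = single (int_exp t') 1 * to_laurent v"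
    by (simp add: mult_single int_exp_add)
  finally show ?thesis by (simp add: to_laurent_mult to_laurent_single)
qed

lemma laurent_frac_eq_iff:
  "laurent_frac v t = laurent_frac v' t' \<longleftrightarrow> single t' 1 * v = single t 1 * v'"
proof -
  let ?u = "single (int_exp (t + t')) 1 :: 'a laurent"
  have "?u * single (- int_exp (t + t')) 1 = 1" by (simp add: mult_single)
  then have "?u \<noteq> 0" by auto
  then have "laurent_frac v t = laurent_frac v' t' \<longleftrightarrow> ?u * laurent_frac v t = ?u * laurent_frac v' t'"
    by (simp only: mult_cancel_left) simp
  also have "\<dots> \<longleftrightarrow> to_laurent (single t' 1 * v) = to_laurent (single t 1 * v')"
    using mult_laurent_frac[of t t' v] mult_laurent_frac[of t' t v'] by (simp only: add.commute)
  finally show ?thesis by simp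
qed

lemma laurent_frac_expand: "laurent_frac (single t' 1 * v) (t' + t) = laurent_frac v t"
  by (simp add: laurent_frac_eq_iff mult_single flip: mult.assoc) (simp add: add.commute)

lemma laurent_frac_add: "laurent_frac v t + laurent_frac v' t = laurent_frac (v + v') t"
  and laurent_frac_diff: "laurent_frac v t - laurent_frac v' t = laurent_frac (v - v') t"
  by (simp_all add: laurent_frac_def to_laurent_add to_laurent_diff algebra_simps)

lemma laurent_frac_0 [simp]: "laurent_frac 0 t = 0"
  by (simp add: laurent_frac_def)

lemma laurent_frac_add':
  "laurent_frac v t + laurent_frac v' t' = laurent_frac (single t' 1 * v + single t 1 * v') (t + t')"
  using laurent_frac_expand[of t' v t] laurent_frac_expand[of t v' t']
  by (simp add: add.commute flip: laurent_frac_add)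

lemma laurent_frac_diff':
  "laurent_frac v t - laurent_frac v' t' = laurent_frac (single t' 1 * v - single t 1 * v') (t + t')"
  using laurent_frac_expand[of t' v t] laurent_frac_expand[of t v' t']
  by (simp add: add.commute flip: laurent_frac_diff)

lemma laurent_frac_mult:
  "laurent_frac v t * laurent_frac v' t' = laurent_frac (v * v') (t + t')"
  by (simp add: laurent_frac_def to_laurent_mult int_exp_add mult_single ac_simps
      mult.left_commute[of "single _ _"])

definition y_exponents :: "nat \<Rightarrow> nat set \<Rightarrow> (nat \<Rightarrow>\<^sub>0 nat) set"
  where "y_exponents m X = {t. keys t \<subseteq> (+) m ` X}"

lemma y_exponents_0 [simp]: "0 \<in> y_exponents m X"
  by (simp add: y_exponents_def)

lemma y_exponents_add: "t \<in> y_exponents m X \<Longrightarrow> t' \<in> y_exponents m X \<Longrightarrow> t + t' \<in> y_exponents m X"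
  by (auto simp: y_exponents_def keys_add_nat)

lemma y_exponents_mono: "X \<subseteq> Y \<Longrightarrow> y_exponents m X \<subseteq> y_exponents m Y"
  unfolding y_exponents_def using image_mono[of X Y "(+) m"] by blast

lemma y_monomial_in: "t \<in> y_exponents m X \<Longrightarrow> X \<subseteq> {..<n} \<Longrightarrow> single t c \<in> polys_in {..<m + n}"
proof (rule polys_in_single)
  assume "t \<in> y_exponents m X" "X \<subseteq> {..<n}"
  moreover from this(2) have "(+) m ` X \<subseteq> {..<m + n}" by auto
  ultimately show "keys t \<subseteq> {..<m + n}" unfolding y_exponents_def by blast
qed

lemma bipoly_nat_pow: "x [^]\<^bsub>bipoly_ring m n\<^esub> (k :: nat) = x ^ k"
  by (induction k) (simp_all add: nat_pow_def bipoly_ring_def mult.commute)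

lemma y_vars_nth: "i < n \<Longrightarrow> y_vars m n ! i = pvar (m + i)"
  by (simp add: y_vars_def pvar_def)

lemma length_y_vars [simp]: "length (y_vars m n) = n"
  by (simp add: y_vars_def)

lemma y_vars_finprod:
  assumes "finite X" "X \<subseteq> {..<n}"
  shows "(\<Otimes>\<^bsub>bipoly_ring m n\<^esub>i\<in>X. (y_vars m n ! i) [^]\<^bsub>bipoly_ring m n\<^esub> (e i :: nat)) =
    (single (\<Sum>i\<in>X. single (m + i) (e i)) 1 :: 'k::field mpoly)"
  using assms
proof (induction X rule: finite_induct)
  case empty
  interpret cring "bipoly_ring m n :: 'k mpoly ring" by (rule cring_bipoly)
  show ?case by simp
next
  case (insert i X)
  interpret cring "bipoly_ring m n :: 'k mpoly ring" by (rule cring_bipoly)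
  have "j < n" if "j \<in> insert i X" for j using that insert.prems by auto
  then have "(\<lambda>i. (y_vars m n ! i) [^]\<^bsub>bipoly_ring m n\<^esub> e i) \<in> insert i X \<rightarrow> carrier (bipoly_ring m n :: 'k mpoly ring)"
    by (intro funcsetI) (simp add: y_vars_nth bipoly_nat_pow carrier_bipoly polys_in_power pvar_in)
  then show ?case
    using insert by (simp add: Pi_iff y_vars_nth bipoly_nat_pow pvar_power mult_single)
qed

lemma cech_denominators_eq:
  assumes "X \<subseteq> {..<n}"
  shows "cech_denominators (bipoly_ring m n) (y_vars m n) X =
    ((\<lambda>t. single t 1) ` y_exponents m X :: 'k::field mpoly set)"
proof -
  have fin: "finite X" using assms finite_subset by blast
  have mem: "(\<Sum>i\<in>X. single (m + i) (e i)) \<in> y_exponents m X" for e :: "nat \<Rightarrow> nat"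
    using keys_sum[of "\<lambda>i. single (m + i) (e i)" X] by (fastforce simp: y_exponents_def split: if_splits)
  have repr: "t = (\<Sum>i\<in>X. single (m + i) (lookup t (m + i)))" if "t \<in> y_exponents m X" for t
  proof (rule poly_mapping_eqI)
    fix k
    have "lookup (\<Sum>i\<in>X. single (m + i) (lookup t (m + i))) k = (\<Sum>i\<in>X. if m + i = k then lookup t k else 0)"
      unfolding lookup_sum by (rule sum.cong) (auto simp: lookup_single when_def)
    also have "\<dots> = lookup t k"
    proof (cases "k \<in> (+) m ` X")
      case True
      then obtain i where i: "i \<in> X" "k = m + i" by blast
      then show ?thesis using fin by (simp add: sum.delta')
    next
      case False
      then have "lookup t k = 0" using that by (auto simp only: y_exponents_def mem_Collect_eq in_keys_iff subset_iff)
      then have "\<forall>i\<in>X. (if m + i = k then lookup t k else 0) = 0" by simp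
      from sum.neutral[OF this] show ?thesis using \<open>lookup t k = 0\<close> by (rule trans[OF _ sym])
    qed
    finally show "lookup t k = lookup (\<Sum>i\<in>X. single (m + i) (lookup t (m + i))) k" by simp
  qed
  show ?thesis
    unfolding cech_denominators_def y_vars_finprod[OF fin assms]
  proof (intro equalityI subsetI)
    fix x :: "'k mpoly" assume "x \<in> {single (\<Sum>i\<in>X. single (m + i) (e i)) 1 | e. True}"
    then show "x \<in> (\<lambda>t. single t 1) ` y_exponents m X" using mem by auto
  next
    fix x :: "'k mpoly" assume "x \<in> (\<lambda>t. single t 1) ` y_exponents m X"
    then obtain t where t: "x = single t 1" "t \<in> y_exponents m X" by blast
    show "x \<in> {single (\<Sum>i\<in>X. single (m + i) (e i)) 1 | e. True}"
      unfolding t(1) by (subst repr[OF t(2)]) (rule CollectI, rule exI, rule conjI[OF refl TrueI])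
  qed
qed

text \<open>Since localization is exact, the localization of S/I is that of S modulo that of I. Both
  are kept as subsets of one Laurent polynomial ring, with A = S and A = I.\<close>

definition laurent_local :: "nat \<Rightarrow> nat set \<Rightarrow> 'k::field mpoly set \<Rightarrow> 'k laurent set"
  where "laurent_local m X A = {laurent_frac v t | v t. v \<in> A \<and> t \<in> y_exponents m X}"

lemma laurent_localI: "v \<in> A \<Longrightarrow> t \<in> y_exponents m X \<Longrightarrow> laurent_frac v t \<in> laurent_local m X A"
  by (auto simp: laurent_local_def)

lemma laurent_local_mono: "X \<subseteq> Y \<Longrightarrow> A \<subseteq> B \<Longrightarrow> laurent_local m X A \<subseteq> laurent_local m Y B"
  unfolding laurent_local_def using y_exponents_mono[of X Y m] by blast

context
  fixes m n X and A :: "'k::field mpoly set"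
  assumes X: "X \<subseteq> {..<n}" and A: "ideal A (bipoly_ring m n)"
begin

interpretation A: bipoly_ideal m n A by (rule bipoly_ideal.intro) (rule A)

lemma laurent_local_0: "0 \<in> laurent_local m X A"
  using laurent_localI[OF A.I_0 y_exponents_0, of m X] by simp

lemma laurent_local_add:
  assumes "l \<in> laurent_local m X A" "l' \<in> laurent_local m X A"
  shows "l + l' \<in> laurent_local m X A"
proof -
  obtain v t v' t' where "l = laurent_frac v t" "l' = laurent_frac v' t'" "v \<in> A" "v' \<in> A"
    "t \<in> y_exponents m X" "t' \<in> y_exponents m X"
    using assms by (auto simp: laurent_local_def)
  then show ?thesis
    using y_monomial_in[OF _ X] by (auto simp: laurent_frac_add' intro!: laurent_localI A.I_add A.I_mult y_exponents_add)
qed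

lemma laurent_local_mult:
  assumes "l \<in> laurent_local m X (polys_in {..<m + n})" "l' \<in> laurent_local m X A"
  shows "l * l' \<in> laurent_local m X A"
proof -
  obtain v t v' t' where "l = laurent_frac v t" "l' = laurent_frac v' t'" "v \<in> polys_in {..<m + n}" "v' \<in> A"
    "t \<in> y_exponents m X" "t' \<in> y_exponents m X"
    using assms by (auto simp: laurent_local_def)
  then show ?thesis
    by (auto simp: laurent_frac_mult intro!: laurent_localI A.I_mult y_exponents_add)
qed

lemma laurent_local_uminus: "l \<in> laurent_local m X A \<Longrightarrow> - l \<in> laurent_local m X A"
proof -
  assume "l \<in> laurent_local m X A"
  then obtain v t where "l = laurent_frac v t" "v \<in> A" "t \<in> y_exponents m X"
    by (auto simp: laurent_local_def)
  moreover from this(1) have "- l = laurent_frac (- v) t" by (simp add: laurent_frac_def to_laurent_uminus)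
  ultimately show ?thesis using A.I_uminus laurent_localI by metis
qed

lemma laurent_local_diff:
  "l \<in> laurent_local m X A \<Longrightarrow> l' \<in> laurent_local m X A \<Longrightarrow> l - l' \<in> laurent_local m X A"
  using laurent_local_add[of l "- l'"] laurent_local_uminus by simp

lemma laurent_local_sum:
  "(\<And>i. i \<in> Z \<Longrightarrow> g i \<in> laurent_local m X A) \<Longrightarrow> (\<Sum>i\<in>Z. g i) \<in> laurent_local m X A"
  by (induction Z rule: infinite_finite_induct) (auto intro: laurent_local_0 laurent_local_add)

text \<open>A fraction can have a numerator outside A and still equal one with numerator in A, after
  expansion by a monomial s.\<close>

lemma laurent_frac_in_local_iff:
  assumes "v \<in> polys_in {..<m + n}" "t \<in> y_exponents m X"
  shows "laurent_frac v t \<in> laurent_local m X A \<longleftrightarrow> (\<exists>s\<in>y_exponents m X. single s 1 * v \<in> A)"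
proof
  assume "laurent_frac v t \<in> laurent_local m X A"
  then obtain i s where eq: "laurent_frac v t = laurent_frac i s" "i \<in> A" "s \<in> y_exponents m X"
    by (auto simp: laurent_local_def)
  then have "single s 1 * v = single t 1 * i" by (simp add: laurent_frac_eq_iff)
  then show "\<exists>s\<in>y_exponents m X. single s 1 * v \<in> A"
    using eq A.I_mult[OF y_monomial_in[OF assms(2) X]] by metis
next
  assume "\<exists>s\<in>y_exponents m X. single s 1 * v \<in> A"
  then obtain s where "s \<in> y_exponents m X" "single s 1 * v \<in> A" by blast
  then show "laurent_frac v t \<in> laurent_local m X A"
    using laurent_localI[of "single s 1 * v" A "s + t"] assms y_exponents_add laurent_frac_expand by metis
qed

end

lemma ideal_polys_in: "ideal (polys_in {..<m + n}) (bipoly_ring m n)"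
  unfolding bipoly_ideal_iff by (auto intro: polys_in_add polys_in_mult)

lemmas laurent_ring_closed =
  laurent_local_0[OF _ ideal_polys_in] laurent_local_add[OF _ ideal_polys_in]
  laurent_local_diff[OF _ ideal_polys_in] laurent_local_uminus[OF _ ideal_polys_in]
  laurent_local_sum[OF _ ideal_polys_in]

text \<open>The image of a Laurent polynomial \<open>l\<close> in the localization of \<open>S/I\<close>.\<close>

definition laurent_class ::
    "nat \<Rightarrow> nat \<Rightarrow> 'k::field mpoly set \<Rightarrow> nat set \<Rightarrow> 'k laurent \<Rightarrow> ('k mpoly set \<times> 'k mpoly) set"
  where "laurent_class m n I X l =
    {(I +>\<^bsub>bipoly_ring m n\<^esub> v, single t 1) | v t.
      v \<in> polys_in {..<m + n} \<and> t \<in> y_exponents m X \<and> l - laurent_frac v t \<in> laurent_local m X I}"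

section \<open>The localizations of S/I at monomials\<close>

locale bipoly_localization = bipoly_ideal +
  fixes X :: "nat set"
  assumes X: "X \<subseteq> {..<n}"
begin

abbreviation (input) LS where "LS \<equiv> laurent_local m X S"
abbreviation (input) LI where "LI \<equiv> laurent_local m X I"
abbreviation (input) E where "E \<equiv> y_exponents m X"
abbreviation (input) cl where "cl \<equiv> laurent_class m n I X"
abbreviation (input) N where "N \<equiv> cech_local R (y_vars m n) M X"
abbreviation (input) fr where "fr v t \<equiv> frac_class R ((\<lambda>t. single t 1) ` E) M (cs v) (single t 1)"

lemmas LI_closed = laurent_local_0[OF X is_ideal] laurent_local_add[OF X is_ideal]
  laurent_local_diff[OF X is_ideal] laurent_local_uminus[OF X is_ideal]
  laurent_local_sum[OF X is_ideal]

lemmas LS_closed = laurent_ring_closed[where m = m, OF X]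

lemma E_S: "t \<in> E \<Longrightarrow> single t 1 \<in> S"
  by (rule y_monomial_in[OF _ X])

text \<open>The difference of two fractions has numerator
  \<open>single t' 1 * v - single t 1 * v'\<close>, and the extra factor u in
  \<open>frac_class\<close> is the monomial s of \<open>laurent_frac_in_local_iff\<close>. So
  fractions over S/I agree exactly when their lifts differ by an element of the localized
  ideal.\<close>

lemma frac_class_eq:
  assumes v: "v \<in> S" and t: "t \<in> E"
  shows "fr v t = cl (laurent_frac v t)"
proof -
  have *: "(\<exists>u\<in>(\<lambda>t. single t 1) ` E. (u \<otimes>\<^bsub>R\<^esub> single t' 1) \<odot>\<^bsub>M\<^esub> cs v = (u \<otimes>\<^bsub>R\<^esub> single t 1) \<odot>\<^bsub>M\<^esub> cs v') \<longleftrightarrow>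
      laurent_frac v t - laurent_frac v' t' \<in> LI" if v': "v' \<in> S" and t': "t' \<in> E" for v' t'
  proof -
    have "(single s 1 * single t' 1) \<odot>\<^bsub>M\<^esub> cs v = (single s 1 * single t 1) \<odot>\<^bsub>M\<^esub> cs v' \<longleftrightarrow>
        single s 1 * (single t' 1 * v - single t 1 * v') \<in> I" if s: "s \<in> E" for s
    proof -
      have "single s 1 * single t' 1 \<in> S" "single s 1 * single t 1 \<in> S"
        using E_S s t t' polys_in_mult by blast+
      then show ?thesis
        using v v' by (simp add: M_smult cs_eq_iff polys_in_mult algebra_simps)
    qed
    moreover have "single t' 1 * v - single t 1 * v' \<in> S"
      using v v' t t' E_S by (intro polys_in_diff polys_in_mult)
    ultimately show ?thesis
      using laurent_frac_in_local_iff[OF X is_ideal, of "single t' 1 * v - single t 1 * v'" "t + t'"]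
        y_exponents_add[OF t t'] by (auto simp: laurent_frac_diff')
  qed
  show ?thesis
    unfolding frac_class_def laurent_class_def M_carrier using * by blast
qed

lemma mem_class_iff:
  assumes v: "v \<in> S" and t: "t \<in> E"
  shows "(cs v, single t 1) \<in> cl l \<longleftrightarrow> l - laurent_frac v t \<in> LI"
proof
  assume "(cs v, single t 1) \<in> cl l"
  then obtain v' t' where *: "cs v = cs v'" "single t 1 = (single t' 1 :: 'a mpoly)" "v' \<in> S" "t' \<in> E"
    "l - laurent_frac v' t' \<in> LI"
    by (auto simp: laurent_class_def)
  have "keys (single t (1::'a)) = keys (single t' (1::'a))" using *(2) by simp
  then have "t = t'" by simp
  moreover have "v - v' \<in> I" using cs_eq_iff[OF v *(3)] *(1) by blast
  ultimately have "laurent_frac v' t' - laurent_frac v t \<in> LI"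
    using laurent_localI[of "v' - v" I t m X] t I_uminus[of "v - v'"] by (simp add: laurent_frac_diff)
  then show "l - laurent_frac v t \<in> LI" using LI_closed(2)[OF *(5)] by fastforce
qed (use v t in \<open>auto simp: laurent_class_def\<close>)

lemma class_eqI: "l - l' \<in> LI \<Longrightarrow> cl l = cl l'"
proof -
  assume l: "l - l' \<in> LI"
  have "l - x \<in> LI \<longleftrightarrow> l' - x \<in> LI" for x
    using LI_closed(2)[OF l, of "l' - x"] LI_closed(3)[OF _ l, of "l - x"] by auto
  then show ?thesis unfolding laurent_class_def by simp
qed

lemma class_eq_iff:
  assumes "l \<in> LS" "l' \<in> LS"
  shows "cl l = cl l' \<longleftrightarrow> l - l' \<in> LI"
proof
  assume *: "cl l = cl l'"
  obtain v t where vt: "v \<in> S" "t \<in> E" "l = laurent_frac v t" using assms by (auto simp: laurent_local_def)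
  then have "l - laurent_frac v t \<in> LI" using LI_closed(1) by simp
  then have "(cs v, single t 1) \<in> cl l'" using mem_class_iff[OF vt(1,2)] * by blast
  then have "l' - l \<in> LI" using mem_class_iff[OF vt(1,2)] vt(3) by blast
  then show "l - l' \<in> LI" using LI_closed(4) by fastforce
qed (rule class_eqI)

lemma N_eq: "N = localization R ((\<lambda>t. single t 1) ` E) M"
  by (simp add: cech_local_def cech_denominators_eq[OF X])

lemma N_carrier: "carrier N = cl ` LS"
proof -
  have "carrier N = {fr v t | v t. v \<in> S \<and> t \<in> E}"
    unfolding N_eq localization_def by (auto simp: M_carrier)
  also have "\<dots> = {cl (laurent_frac v t) | v t. v \<in> S \<and> t \<in> E}"
    using frac_class_eq by blast
  also have "\<dots> = cl ` LS" unfolding laurent_local_def by blast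
  finally show ?thesis .
qed

lemma N_zero: "\<zero>\<^bsub>N\<^esub> = cl 0"
  using frac_class_eq[of 0 0] by (simp add: N_eq localization_def M_zero)

text \<open>The operations of \<open>localization\<close> are unions over all representatives. Such
  a union collapses once all its members coincide and there is at least one representative.\<close>

lemma class_constant_union:
  assumes "l \<in> LS" "\<And>v t. v \<in> S \<Longrightarrow> t \<in> E \<Longrightarrow> l - laurent_frac v t \<in> LI \<Longrightarrow> F (cs v) (single t 1) = C"
  shows "(\<Union>(v, w)\<in>cl l. F v w) = C"
proof -
  have "F v w = C" if "(v, w) \<in> cl l" for v w
    using that assms(2) by (auto simp: laurent_class_def)
  moreover obtain v t where "v \<in> S" "t \<in> E" "l = laurent_frac v t"
    using assms(1) by (auto simp: laurent_local_def)
  then have "(cs v, single t 1) \<in> cl l" using mem_class_iff LI_closed(1) by simp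
  ultimately show ?thesis by fastforce
qed

lemma N_add:
  assumes "l \<in> LS" "l' \<in> LS"
  shows "cl l \<oplus>\<^bsub>N\<^esub> cl l' = cl (l + l')"
proof -
  have "cl l \<oplus>\<^bsub>N\<^esub> cl l' = (\<Union>(v, w)\<in>cl l. \<Union>(v', w')\<in>cl l'.
      frac_class R ((\<lambda>t. single t 1) ` E) M (w' \<odot>\<^bsub>M\<^esub> v \<oplus>\<^bsub>M\<^esub> w \<odot>\<^bsub>M\<^esub> v') (w \<otimes>\<^bsub>R\<^esub> w'))"
    by (simp add: N_eq localization_def)
  also have "\<dots> = cl (l + l')"
  proof (intro class_constant_union assms)
    fix v t v' t'
    assume vt: "v \<in> S" "t \<in> E" "l - laurent_frac v t \<in> LI"
      and vt': "v' \<in> S" "t' \<in> E" "l' - laurent_frac v' t' \<in> LI"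
    have "frac_class R ((\<lambda>t. single t 1) ` E) M
        (single t' 1 \<odot>\<^bsub>M\<^esub> cs v \<oplus>\<^bsub>M\<^esub> single t 1 \<odot>\<^bsub>M\<^esub> cs v') (single t 1 \<otimes>\<^bsub>R\<^esub> single t' 1) =
        fr (single t' 1 * v + single t 1 * v') (t + t')"
      using vt vt' E_S by (simp add: M_smult M_add polys_in_mult mult_single)
    also have "\<dots> = cl (laurent_frac v t + laurent_frac v' t')"
      unfolding laurent_frac_add' using vt vt' E_S
      by (intro frac_class_eq polys_in_add polys_in_mult y_exponents_add)
    also have "\<dots> = cl (l + l')"
    proof (rule class_eqI[symmetric])
      show "l + l' - (laurent_frac v t + laurent_frac v' t') \<in> LI"
        using LI_closed(2)[OF vt(3) vt'(3)] by (simp add: algebra_simps)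
    qed
    finally show "frac_class R ((\<lambda>t. single t 1) ` E) M
        (single t' 1 \<odot>\<^bsub>M\<^esub> cs v \<oplus>\<^bsub>M\<^esub> single t 1 \<odot>\<^bsub>M\<^esub> cs v') (single t 1 \<otimes>\<^bsub>R\<^esub> single t' 1) =
      cl (l + l')" .
  qed
  finally show ?thesis .
qed

lemma N_abelian_group: "abelian_group N"
proof (rule abelian_groupI)
  fix x assume "x \<in> carrier N"
  then obtain l where "l \<in> LS" "x = cl l" by (auto simp: N_carrier)
  then show "\<exists>y\<in>carrier N. y \<oplus>\<^bsub>N\<^esub> x = \<zero>\<^bsub>N\<^esub>"
    using LS_closed(4)[of l] by (intro bexI[of _ "cl (- l)"]) (simp_all add: N_carrier N_zero N_add)
next
  fix x y assume "x \<in> carrier N" "y \<in> carrier N"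
  then show "x \<oplus>\<^bsub>N\<^esub> y \<in> carrier N" "x \<oplus>\<^bsub>N\<^esub> y = y \<oplus>\<^bsub>N\<^esub> x"
    using LS_closed(2) by (auto simp: N_carrier N_add add.commute intro!: imageI)
next
  fix x y z assume "x \<in> carrier N" "y \<in> carrier N" "z \<in> carrier N"
  then show "x \<oplus>\<^bsub>N\<^esub> y \<oplus>\<^bsub>N\<^esub> z = x \<oplus>\<^bsub>N\<^esub> (y \<oplus>\<^bsub>N\<^esub> z)"
    by (auto simp: N_carrier N_add LS_closed(2) add.assoc)
next
  show "\<zero>\<^bsub>N\<^esub> \<in> carrier N" by (auto simp: N_carrier N_zero LS_closed(1))
next
  fix x assume "x \<in> carrier N"
  then show "\<zero>\<^bsub>N\<^esub> \<oplus>\<^bsub>N\<^esub> x = x" by (auto simp: N_carrier N_zero N_add LS_closed(1))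
qed

sublocale N: abelian_group N by (rule N_abelian_group)

lemma N_finsum:
  assumes "\<And>i. i \<in> A \<Longrightarrow> g i \<in> LS"
  shows "(\<Oplus>\<^bsub>N\<^esub>i\<in>A. cl (g i)) = cl (\<Sum>i\<in>A. g i)"
  using assms
proof (induction A rule: infinite_finite_induct)
  case (insert a A)
  then have "(\<Oplus>\<^bsub>N\<^esub>i\<in>insert a A. cl (g i)) = cl (g a) \<oplus>\<^bsub>N\<^esub> (\<Oplus>\<^bsub>N\<^esub>i\<in>A. cl (g i))"
    by (intro N.finsum_insert) (auto simp: N_carrier)
  then show ?case using insert LS_closed(5)[of A g] by (simp add: N_add)
qed (auto simp: N_zero)

lemma N_sign:
  assumes "l \<in> LS"
  shows "[((- 1 :: int) ^ k)] \<cdot>\<^bsub>N\<^esub> cl l = cl ((- 1) ^ k * l)"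
proof -
  have c: "cl l \<in> carrier N" using assms by (simp add: N_carrier)
  have "\<ominus>\<^bsub>N\<^esub> cl l = cl (- l)"
    using assms LS_closed(4)[OF assms] by (intro N.minus_equality) (simp_all add: N_carrier N_add N_zero)
  then have "[(- 1 :: int)] \<cdot>\<^bsub>N\<^esub> cl l = cl (- l)"
    using N.add.int_pow_neg[OF c, of 1] N.add.int_pow_1[OF c] by simp
  moreover have "[(1 :: int)] \<cdot>\<^bsub>N\<^esub> cl l = cl l"
    using N.add.int_pow_1[OF c] by simp
  ultimately show ?thesis by (cases "even k") simp_all
qed

text \<open>Inverting more variables does not change the Laurent polynomial that represents a class,
  so the maps of the complex become inclusions.\<close>

lemma localization_map_class:
  assumes Y: "X \<subseteq> Y" "Y \<subseteq> {..<n}" and l: "l \<in> LS"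
  shows "localization_map R (cech_denominators R (y_vars m n) Y) M (cl l) = laurent_class m n I Y l"
proof -
  interpret Y: bipoly_localization m n I Y by unfold_locales (rule Y(2))
  show ?thesis
    unfolding localization_map_def cech_denominators_eq[OF Y(2)]
  proof (rule class_constant_union[OF l])
    fix v t assume vt: "v \<in> S" "t \<in> E" "l - laurent_frac v t \<in> LI"
    have "Y.fr v t = Y.cl (laurent_frac v t)"
      using vt y_exponents_mono[OF Y(1)] by (intro Y.frac_class_eq) auto
    also have "\<dots> = Y.cl l"
      using vt(3) laurent_local_mono[OF Y(1) subset_refl] by (intro Y.class_eqI[symmetric]) blast
    finally show "Y.fr v t = Y.cl l" .
  qed
qed

end

section \<open>The Cech complex in terms of Laurent polynomials\<close>

definition cech_sign :: "nat set \<Rightarrow> nat \<Rightarrow> 'k::field laurent"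
  where "cech_sign Y j = (- 1) ^ card {k \<in> Y. k < j}"

definition index_sets :: "nat \<Rightarrow> nat \<Rightarrow> nat set set"
  where "index_sets n k = {X. X \<subseteq> {..<n} \<and> card X = k}"

lemma cech_sign_square [simp]:
  fixes l :: "'k::field laurent"
  shows "cech_sign Y j * cech_sign Y j = (1 :: 'k laurent)" "cech_sign Y j * (cech_sign Y j * l) = l"
proof -
  show *: "cech_sign Y j * cech_sign Y j = (1 :: 'k laurent)"
    by (cases "even (card {k \<in> Y. k < j})") (simp_all add: cech_sign_def)
  show "cech_sign Y j * (cech_sign Y j * l) = l"
    by (simp only: mult.assoc[symmetric] *) simp
qed

lemma cech_sign_mult_mem:
  assumes "X \<subseteq> {..<n}" "ideal A (bipoly_ring m n)" "l \<in> laurent_local m X A"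
  shows "cech_sign Y j * l \<in> laurent_local m X A"
  using laurent_local_uminus[OF assms] assms(3)
  by (cases "even (card {k \<in> Y. k < j})") (simp_all add: cech_sign_def)

text \<open>Removing the smaller index i lowers the position of j by one, while removing j leaves
  the position of i unchanged.\<close>

lemma cech_sign_swap:
  assumes "finite J" "i \<in> J" "j \<in> J" "i < j"
  shows "cech_sign J i * cech_sign (J - {i}) j = - (cech_sign J j * cech_sign (J - {j}) i :: 'k::field laurent)"
proof -
  have "{k \<in> J - {j}. k < i} = {k \<in> J. k < i}" using assms by auto
  moreover have "card {k \<in> J. k < j} = Suc (card {k \<in> J - {i}. k < j})"
  proof -
    have "{k \<in> J. k < j} = insert i {k \<in> J - {i}. k < j}" using assms by auto
    then show ?thesis using assms(1) by simp
  qed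
  ultimately show ?thesis by (simp add: cech_sign_def)
qed

text \<open>The identity behind d d = 0: the terms for (i, j) and (j, i) remove the same two indices
  and carry opposite signs.\<close>

lemma cech_sign_sum_zero:
  fixes f :: "nat \<Rightarrow> nat \<Rightarrow> 'k::field laurent"
  assumes J: "finite J" and f: "\<And>i j. f i j = f j i"
  shows "(\<Sum>j\<in>J. \<Sum>i\<in>J - {j}. cech_sign J j * (cech_sign (J - {j}) i * f j i)) = 0"
proof -
  define g where "g j i = cech_sign J j * cech_sign (J - {j}) i * f j i" for j i
  have g: "g i j = - g j i" if "i \<in> J" "j \<in> J" "i < j" for i j
    unfolding g_def using cech_sign_swap[OF J that, where 'k = 'k] f by simp
  have "(\<Sum>j\<in>J. \<Sum>i\<in>J - {j}. g j i) = (\<Sum>j\<in>J. (\<Sum>i\<in>{i \<in> J. i < j}. g j i) + (\<Sum>i\<in>{i \<in> J. j < i}. g j i))"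
  proof (rule sum.cong)
    fix j assume "j \<in> J"
    have eq: "J - {j} = {i \<in> J. i < j} \<union> {i \<in> J. j < i}" by auto
    then show "(\<Sum>i\<in>J - {j}. g j i) = (\<Sum>i\<in>{i \<in> J. i < j}. g j i) + (\<Sum>i\<in>{i \<in> J. j < i}. g j i)"
      unfolding eq using J by (intro sum.union_disjoint) auto
  qed simp
  also have "\<dots> = (\<Sum>j\<in>J. \<Sum>i\<in>{i \<in> J. i < j}. g j i) + (\<Sum>j\<in>J. \<Sum>i\<in>{i \<in> J. j < i}. g j i)"
    by (rule sum.distrib)
  also have "(\<Sum>j\<in>J. \<Sum>i\<in>{i \<in> J. j < i}. g j i) = (\<Sum>i\<in>J. \<Sum>j\<in>{j \<in> J. j < i}. g j i)"
    by (rule sum.swap_restrict[OF J J])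
  also have "\<dots> = (\<Sum>i\<in>J. \<Sum>j\<in>{j \<in> J. j < i}. - g i j)"
    by (intro sum.cong refl g) auto
  finally show ?thesis by (simp add: g_def mult.assoc sum_negf)
qed

lemma cech_indices_y_vars: "cech_indices (y_vars m n) k = index_sets n k"
  by (simp add: cech_indices_def index_sets_def)

lemma index_sets_remove: "Y \<in> index_sets n (Suc k) \<Longrightarrow> j \<in> Y \<Longrightarrow> Y - {j} \<in> index_sets n k"
  by (auto simp: index_sets_def card_Diff_singleton_if)

lemma index_sets_top: "index_sets n n = {{..<n}}"
  using card_subset_eq[of "{..<n}"] by (auto simp: index_sets_def)

lemma index_sets_empty: "k > n \<Longrightarrow> index_sets n k = {}"
proof -
  assume "k > n"
  moreover have "card X \<le> n" if "X \<subseteq> {..<n}" for X using card_mono[OF _ that] by simp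
  ultimately show ?thesis by (auto simp: index_sets_def not_le[symmetric])
qed

lemma index_sets_pred:
  assumes "n > 0" shows "index_sets n (n - 1) = (\<lambda>j. {..<n} - {j}) ` {..<n}"
proof (intro equalityI subsetI)
  fix X assume X: "X \<in> index_sets n (n - 1)"
  then have "card ({..<n} - X) = 1"
    using assms by (subst card_Diff_subset) (auto simp: index_sets_def intro: finite_subset)
  then obtain j where "{..<n} - X = {j}" by (auto simp: card_1_singleton_iff)
  moreover have "X = {..<n} - ({..<n} - X)" using X by (auto simp: index_sets_def)
  ultimately show "X \<in> (\<lambda>j. {..<n} - {j}) ` {..<n}" by (intro image_eqI[of _ _ j]) auto
qed (use assms in \<open>auto simp: index_sets_def\<close>)

section \<open>Cochains, coboundaries and cohomology through Laurent lifts\<close>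

context bipoly_ideal
begin

abbreviation (input) C where "C k \<equiv> cech_module R (y_vars m n) M k"
abbreviation (input) L where "L X \<equiv> laurent_local m X S"
abbreviation (input) LL where "LL X \<equiv> laurent_local m X I"
abbreviation (input) H where "H k \<equiv> local_cohomology R (y_vars m n) M k"

text \<open>Cochains over S/I are handled through lifts, families of Laurent polynomials over S;
  equality of cochains becomes congruence modulo the localizations of I.\<close>

definition cochain :: "nat \<Rightarrow> (nat set \<Rightarrow> 'k laurent) \<Rightarrow> nat set \<Rightarrow> ('k mpoly set \<times> 'k mpoly) set"
  where "cochain k l = (\<lambda>X\<in>index_sets n k. laurent_class m n I X (l X))"

definition laurent_diff :: "(nat set \<Rightarrow> 'k laurent) \<Rightarrow> nat set \<Rightarrow> 'k laurent"
  where "laurent_diff l Y = (\<Sum>j\<in>Y. cech_sign Y j * l (Y - {j}))"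

definition valid_cochain :: "nat \<Rightarrow> (nat set \<Rightarrow> 'k laurent) \<Rightarrow> bool"
  where "valid_cochain k l \<longleftrightarrow> (\<forall>X\<in>index_sets n k. l X \<in> L X)"

lemma localization: "X \<in> index_sets n k \<Longrightarrow> bipoly_localization m n I X"
  by (simp add: bipoly_localization_def bipoly_localization_axioms_def bipoly_ideal_axioms index_sets_def)

lemma index_sub: "X \<in> index_sets n k \<Longrightarrow> X \<subseteq> {..<n}"
  by (auto simp: index_sets_def)

lemma cech_carrier: "carrier (C k) = cochain k ` Collect (valid_cochain k)"
proof (intro equalityI subsetI)
  fix c assume "c \<in> carrier (C k)"
  then have c: "c \<in> (\<Pi>\<^sub>E X\<in>index_sets n k. carrier (cech_local R (y_vars m n) M X))"
    by (simp add: cech_module_def cech_indices_y_vars)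
  have "\<forall>X\<in>index_sets n k. \<exists>l. l \<in> L X \<and> c X = laurent_class m n I X l"
    using c bipoly_localization.N_carrier[OF localization] by (fastforce simp: PiE_iff)
  from bchoice[OF this] obtain l where l: "\<forall>X\<in>index_sets n k. l X \<in> L X \<and> c X = laurent_class m n I X (l X)" ..
  have "c = cochain k l"
    using c l by (auto simp: cochain_def PiE_iff extensional_def fun_eq_iff)
  then show "c \<in> cochain k ` Collect (valid_cochain k)" using l by (auto simp: valid_cochain_def)
next
  fix c assume "c \<in> cochain k ` Collect (valid_cochain k)"
  then show "c \<in> carrier (C k)"
    using bipoly_localization.N_carrier[OF localization]
    by (auto simp: cech_module_def cech_indices_y_vars cochain_def valid_cochain_def)
qed

lemma cech_zero: "\<zero>\<^bsub>C k\<^esub> = cochain k (\<lambda>_. 0)"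
  using bipoly_localization.N_zero[OF localization]
  by (auto simp: cech_module_def cech_indices_y_vars cochain_def intro!: restrict_ext)

lemma cech_add:
  assumes "valid_cochain k l" "valid_cochain k l'"
  shows "cochain k l \<oplus>\<^bsub>C k\<^esub> cochain k l' = cochain k (\<lambda>X. l X + l' X)"
  using bipoly_localization.N_add[OF localization] assms
  by (auto simp: cech_module_def cech_indices_y_vars cochain_def valid_cochain_def intro!: restrict_ext)

lemma cochain_eq_iff:
  assumes "valid_cochain k l" "valid_cochain k l'"
  shows "cochain k l = cochain k l' \<longleftrightarrow> (\<forall>X\<in>index_sets n k. l X - l' X \<in> LL X)"
proof -
  have "cochain k l = cochain k l' \<longleftrightarrow>
      (\<forall>X\<in>index_sets n k. laurent_class m n I X (l X) = laurent_class m n I X (l' X))"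
    by (auto simp: cochain_def fun_eq_iff restrict_def)
  then show ?thesis
    using bipoly_localization.class_eq_iff[OF localization] assms by (auto simp: valid_cochain_def)
qed

lemma laurent_diff_mem:
  assumes l: "valid_cochain k l" and Y: "Y \<in> index_sets n (Suc k)"
  shows "laurent_diff l Y \<in> L Y"
  unfolding laurent_diff_def
proof (intro laurent_ring_closed(5)[OF index_sub[OF Y]] cech_sign_mult_mem[OF index_sub[OF Y] ideal_polys_in])
  fix j assume "j \<in> Y"
  then have "l (Y - {j}) \<in> L (Y - {j})"
    using l index_sets_remove[OF Y] by (auto simp: valid_cochain_def)
  then show "l (Y - {j}) \<in> L Y" using laurent_local_mono[of "Y - {j}" Y S S] by blast
qed

lemma cech_diff_eq:
  assumes l: "valid_cochain k l"
  shows "cech_diff R (y_vars m n) M k (cochain k l) = cochain (Suc k) (laurent_diff l)"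
  unfolding cech_diff_def cech_indices_y_vars cochain_def[of "Suc k"]
proof (rule restrict_ext)
  fix Y assume Y: "Y \<in> index_sets n (Suc k)"
  interpret Y: bipoly_localization m n I Y by (rule localization[OF Y])
  have mem: "l (Y - {j}) \<in> L (Y - {j})" "l (Y - {j}) \<in> L Y" if "j \<in> Y" for j
  proof -
    show "l (Y - {j}) \<in> L (Y - {j})"
      using l index_sets_remove[OF Y that] by (auto simp: valid_cochain_def)
    then show "l (Y - {j}) \<in> L Y" using laurent_local_mono[of "Y - {j}" Y S S] by blast
  qed
  have smem: "cech_sign Y j * l (Y - {j}) \<in> L Y" if "j \<in> Y" for j
    by (rule cech_sign_mult_mem[OF Y.X ideal_polys_in mem(2)[OF that]])
  have "(\<Oplus>\<^bsub>Y.N\<^esub>j\<in>Y. [((- 1 :: int) ^ card {k \<in> Y. k < j})] \<cdot>\<^bsub>Y.N\<^esub>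
        localization_map R (cech_denominators R (y_vars m n) Y) M (cochain k l (Y - {j}))) =
      (\<Oplus>\<^bsub>Y.N\<^esub>j\<in>Y. Y.cl (cech_sign Y j * l (Y - {j})))"
  proof (rule Y.N.finsum_cong')
    fix j assume j: "j \<in> Y"
    have Yj: "Y - {j} \<in> index_sets n k" by (rule index_sets_remove[OF Y j])
    have "localization_map R (cech_denominators R (y_vars m n) Y) M (cochain k l (Y - {j})) = Y.cl (l (Y - {j}))"
      using bipoly_localization.localization_map_class[OF localization[OF Yj] _ Y.X mem(1)[OF j]] Yj
      by (auto simp: cochain_def)
    then show "[((- 1 :: int) ^ card {k \<in> Y. k < j})] \<cdot>\<^bsub>Y.N\<^esub>
        localization_map R (cech_denominators R (y_vars m n) Y) M (cochain k l (Y - {j})) =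
      Y.cl (cech_sign Y j * l (Y - {j}))"
      using Y.N_sign[OF mem(2)[OF j]] by (simp add: cech_sign_def)
  qed (use smem in \<open>auto simp: Y.N_carrier\<close>)
  also have "\<dots> = Y.cl (laurent_diff l Y)"
    unfolding laurent_diff_def by (rule Y.N_finsum[OF smem])
  finally show "(\<Oplus>\<^bsub>Y.N\<^esub>j\<in>Y. [((- 1 :: int) ^ card {k \<in> Y. k < j})] \<cdot>\<^bsub>Y.N\<^esub>
        localization_map R (cech_denominators R (y_vars m n) Y) M (cochain k l (Y - {j}))) =
      Y.cl (laurent_diff l Y)" .
qed

lemma valid_cochain_0: "valid_cochain k (\<lambda>_. 0)"
  using laurent_ring_closed(1)[OF index_sub] by (auto simp: valid_cochain_def)

lemma valid_cochain_add: "valid_cochain k l \<Longrightarrow> valid_cochain k l' \<Longrightarrow> valid_cochain k (\<lambda>X. l X + l' X)"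
  by (auto simp: valid_cochain_def intro!: laurent_ring_closed(2)[OF index_sub])

lemma valid_cochain_diff: "valid_cochain k l \<Longrightarrow> valid_cochain k l' \<Longrightarrow> valid_cochain k (\<lambda>X. l X - l' X)"
  by (auto simp: valid_cochain_def intro!: laurent_ring_closed(3)[OF index_sub])

lemma cech_coboundaries_zero: "\<zero>\<^bsub>C k\<^esub> \<in> cech_coboundaries R (y_vars m n) M k"
proof (cases k)
  case (Suc k')
  have "cech_diff R (y_vars m n) M k' (cochain k' (\<lambda>_. 0)) = cochain k (laurent_diff (\<lambda>_. 0))"
    unfolding Suc by (rule cech_diff_eq[OF valid_cochain_0])
  also have "laurent_diff (\<lambda>_. 0) = (\<lambda>_. 0)" by (simp add: laurent_diff_def fun_eq_iff)
  finally have "\<zero>\<^bsub>C k\<^esub> = cech_diff R (y_vars m n) M k' (cochain k' (\<lambda>_. 0))"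
    by (simp add: cech_zero)
  then show ?thesis unfolding Suc using valid_cochain_0 by (auto simp: cech_carrier)
qed simp

text \<open>In degree 0 the only coboundary is zero, and the condition on e is void since the only
  index set is empty; so one description serves all degrees.\<close>

lemma cech_coboundaries_cochain:
  assumes "u \<in> cech_coboundaries R (y_vars m n) M k"
  shows "\<exists>e. (\<forall>X\<in>index_sets n k. \<forall>i\<in>X. e (X - {i}) \<in> L (X - {i})) \<and> u = cochain k (laurent_diff e)"
proof (cases k)
  case 0
  have "laurent_diff (\<lambda>_. 0) = (\<lambda>_. 0)" by (simp add: laurent_diff_def fun_eq_iff)
  then have "u = cochain k (laurent_diff (\<lambda>_. 0))"
    using assms 0 cech_zero[of 0] by simp
  moreover have "X = {}" if "X \<in> index_sets n k" for X
    using that 0 finite_subset[of X "{..<n}"] by (auto simp: index_sets_def)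
  ultimately show ?thesis by (intro exI[of _ "\<lambda>_. 0"]) auto
next
  case (Suc k')
  then obtain e where e: "valid_cochain k' e" "u = cochain k (laurent_diff e)"
    using assms cech_diff_eq by (auto simp: cech_carrier)
  then show ?thesis
    using index_sets_remove Suc by (intro exI[of _ e]) (auto simp: valid_cochain_def)
qed

text \<open>The coset of the cocycle differs from the set of coboundaries because it contains the
  cocycle itself, zero being a coboundary.\<close>

lemma local_cohomology_nonzeroI:
  assumes l: "valid_cochain k l"
    and cocycle: "\<And>Y. Y \<in> index_sets n (Suc k) \<Longrightarrow> laurent_diff l Y \<in> LL Y"
    and not_coboundary: "\<And>e. (\<And>X i. X \<in> index_sets n k \<Longrightarrow> i \<in> X \<Longrightarrow> e (X - {i}) \<in> L (X - {i})) \<Longrightarrow>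
      \<exists>X\<in>index_sets n k. l X - laurent_diff e X \<notin> LL X"
  shows "nonzero_module (H k)"
proof -
  let ?U = "cech_coboundaries R (y_vars m n) M k"
  let ?N = "C k\<lparr>carrier := cech_cocycles R (y_vars m n) M k\<rparr>"
  define c where "c = cochain k l"
  have "cech_diff R (y_vars m n) M k c = \<zero>\<^bsub>C (Suc k)\<^esub>"
    unfolding c_def cech_diff_eq[OF l] cech_zero
    using cocycle laurent_diff_mem[OF l] valid_cochain_0
    by (subst cochain_eq_iff) (auto simp: valid_cochain_def)
  then have c: "c \<in> cech_cocycles R (y_vars m n) M k"
    using l by (auto simp: cech_cocycles_def c_def cech_carrier)
  have "c \<notin> ?U"
  proof
    assume "c \<in> ?U"
    then obtain e where e: "\<And>X i. X \<in> index_sets n k \<Longrightarrow> i \<in> X \<Longrightarrow> e (X - {i}) \<in> L (X - {i})"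
      "c = cochain k (laurent_diff e)"
      using cech_coboundaries_cochain by blast
    have "laurent_diff e X \<in> L X" if X: "X \<in> index_sets n k" for X
      unfolding laurent_diff_def
    proof (intro laurent_ring_closed(5)[OF index_sub[OF X]] cech_sign_mult_mem[OF index_sub[OF X] ideal_polys_in])
      fix i assume "i \<in> X"
      then show "e (X - {i}) \<in> L X"
        using e(1)[OF X] laurent_local_mono[of "X - {i}" X S S] by blast
    qed
    then have "valid_cochain k (laurent_diff e)" by (simp add: valid_cochain_def)
    then show False using not_coboundary[OF e(1)] cochain_eq_iff[OF l] e(2) by (auto simp: c_def)
  qed
  moreover have "c \<in> ?U +>\<^bsub>?N\<^esub> c"
  proof -
    have "\<zero>\<^bsub>C k\<^esub> \<oplus>\<^bsub>C k\<^esub> c = c"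
      using cech_add[OF valid_cochain_0 l] by (simp add: c_def cech_zero)
    then have "\<exists>h\<in>?U. c = h \<oplus>\<^bsub>?N\<^esub> c"
      using cech_coboundaries_zero by (intro bexI[of _ "\<zero>\<^bsub>C k\<^esub>"]) auto
    then show ?thesis by (simp add: a_r_coset_def')
  qed
  ultimately have "?U +>\<^bsub>?N\<^esub> c \<noteq> ?U" by blast
  moreover have "?U +>\<^bsub>?N\<^esub> c \<in> carrier (H k)"
    using c by (auto simp: local_cohomology_def quot_module_def A_RCOSETS_def')
  moreover have "\<zero>\<^bsub>H k\<^esub> = ?U" by (simp add: local_cohomology_def quot_module_def)
  ultimately show ?thesis unfolding nonzero_module_def by blast
qed

text \<open>All cochains are assumed to be coboundaries, without a cocycle condition: this fits the
  top degree, where every cochain is a cocycle, and the degrees above it.\<close>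

lemma local_cohomology_zeroI:
  assumes "\<And>l. valid_cochain (Suc k) l \<Longrightarrow>
    \<exists>e. valid_cochain k e \<and> (\<forall>X\<in>index_sets n (Suc k). l X - laurent_diff e X \<in> LL X)"
  shows "\<not> nonzero_module (H (Suc k))"
proof -
  let ?U = "cech_coboundaries R (y_vars m n) M (Suc k)"
  let ?N = "C (Suc k)\<lparr>carrier := cech_cocycles R (y_vars m n) M (Suc k)\<rparr>"
  have U: "?U = carrier (C (Suc k))"
  proof (intro equalityI subsetI)
    fix c assume "c \<in> carrier (C (Suc k))"
    then obtain l where l: "valid_cochain (Suc k) l" "c = cochain (Suc k) l" by (auto simp: cech_carrier)
    then obtain e where e: "valid_cochain k e" "\<forall>X\<in>index_sets n (Suc k). l X - laurent_diff e X \<in> LL X"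
      using assms by blast
    then have "c = cochain (Suc k) (laurent_diff e)"
      using l cochain_eq_iff[OF l(1)] laurent_diff_mem[OF e(1)] by (simp add: valid_cochain_def)
    then show "c \<in> ?U" using cech_diff_eq[OF e(1)] e(1) by (force simp: cech_carrier)
  qed (use cech_diff_eq laurent_diff_mem in \<open>auto simp: cech_carrier valid_cochain_def\<close>)
  have coset: "?U +>\<^bsub>?N\<^esub> c = ?U" if "c \<in> cech_cocycles R (y_vars m n) M (Suc k)" for c
  proof -
    obtain l where l: "valid_cochain (Suc k) l" "c = cochain (Suc k) l"
      using \<open>c \<in> _\<close> by (auto simp: cech_cocycles_def cech_carrier)
    have "\<exists>u\<in>carrier (C (Suc k)). x = u \<oplus>\<^bsub>C (Suc k)\<^esub> c" if "x \<in> carrier (C (Suc k))" for x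
    proof -
      obtain l' where l': "valid_cochain (Suc k) l'" "x = cochain (Suc k) l'"
        using \<open>x \<in> _\<close> by (auto simp: cech_carrier)
      have "x = cochain (Suc k) (\<lambda>X. l' X - l X) \<oplus>\<^bsub>C (Suc k)\<^esub> c"
        using l l' by (simp add: cech_add valid_cochain_diff)
      moreover have "cochain (Suc k) (\<lambda>X. l' X - l X) \<in> carrier (C (Suc k))"
        using l l' by (simp add: cech_carrier valid_cochain_diff)
      ultimately show ?thesis by blast
    qed
    moreover have "u \<oplus>\<^bsub>C (Suc k)\<^esub> c \<in> carrier (C (Suc k))" if "u \<in> carrier (C (Suc k))" for u
    proof -
      obtain l' where "valid_cochain (Suc k) l'" "u = cochain (Suc k) l'"
        using \<open>u \<in> _\<close> by (auto simp: cech_carrier)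
      then show ?thesis using l by (auto simp: cech_carrier cech_add valid_cochain_add)
    qed
    ultimately show ?thesis unfolding U by (auto simp: a_r_coset_def')
  qed
  have "cochain (Suc k) (\<lambda>_. 0) \<in> cech_cocycles R (y_vars m n) M (Suc k)"
    using cech_diff_eq[OF valid_cochain_0, of "Suc k"] valid_cochain_0
    by (auto simp: cech_cocycles_def cech_carrier cech_zero laurent_diff_def cochain_def)
  then have "carrier (H (Suc k)) = {?U}"
    using coset by (auto simp: local_cohomology_def quot_module_def A_RCOSETS_def')
  moreover have "\<zero>\<^bsub>H (Suc k)\<^esub> = ?U" by (simp add: local_cohomology_def quot_module_def)
  ultimately show ?thesis by (simp add: nonzero_module_def)
qed

lemma local_cohomology_above: "k > n \<Longrightarrow> \<not> nonzero_module (H k)"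
proof -
  assume "k > n"
  then obtain k' where k: "k = Suc k'" "index_sets n (Suc k') = {}"
    using index_sets_empty by (cases k) auto
  then show ?thesis
    unfolding k(1) using valid_cochain_0 by (intro local_cohomology_zeroI exI[of _ "\<lambda>_. 0"]) auto
qed

lemma cd_le:
  assumes "\<And>k. r < k \<Longrightarrow> k \<le> n \<Longrightarrow> \<not> nonzero_module (H k)"
  shows "cd R (y_vars m n) M \<le> enat r"
  unfolding cd_def
proof (rule SUP_least)
  fix i assume i: "i \<in> {i. nonzero_module (H i)}"
  then have "i \<le> n" using local_cohomology_above by (meson leI mem_Collect_eq)
  then have "i \<le> r" using i assms[of i] by (meson leI mem_Collect_eq)
  then show "enat i \<le> enat r" by simp
qed

lemma cd_ge: "nonzero_module (H k) \<Longrightarrow> enat k \<le> cd R (y_vars m n) M"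
  unfolding cd_def by (rule SUP_upper) simp

end

section \<open>Top local cohomology\<close>

lemma keys_laurent_local:
  assumes "l \<in> laurent_local m X A" "s \<in> keys l"
  shows "\<exists>v\<in>A. \<exists>u\<in>keys v. \<exists>t\<in>y_exponents m X. s = int_exp u - int_exp t"
proof -
  obtain v t where vt: "v \<in> A" "t \<in> y_exponents m X" "l = laurent_frac v t"
    using assms(1) by (auto simp: laurent_local_def)
  obtain a b where ab: "s = a + b" "a \<in> keys (to_laurent v)" "b \<in> keys (single (- int_exp t) (1 :: 'a))"
    using assms(2) keys_mult[of "to_laurent v" "single (- int_exp t) 1"]
    unfolding vt(3) laurent_frac_def by blast
  then obtain u where "a = int_exp u" "u \<in> keys v" using keys_to_laurent by blast
  moreover have "b = - int_exp t" using ab(3) by simp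
  ultimately show ?thesis using ab(1) vt by auto
qed

lemma y_exponents_lookup_0: "t \<in> y_exponents m X \<Longrightarrow> i \<notin> (+) m ` X \<Longrightarrow> lookup t i = 0"
  by (metis (mono_tags, lifting) in_keys_iff mem_Collect_eq subsetD y_exponents_def)

text \<open>The exponent of 1/(y_1 ... y_n), whose coefficient plays the role of a residue.\<close>

definition residue_exp :: "nat \<Rightarrow> nat \<Rightarrow> (nat \<Rightarrow>\<^sub>0 int)"
  where "residue_exp m n = (\<Sum>j<n. single (m + j) (- 1))"

lemma lookup_residue_exp: "lookup (residue_exp m n) i = (if m \<le> i \<and> i < m + n then - 1 else 0)"
proof -
  have "lookup (residue_exp m n) i = (\<Sum>j<n. if j = i - m then (if m \<le> i then - 1 else 0) else 0)"
    unfolding residue_exp_def lookup_sum by (rule sum.cong) (auto simp: lookup_single when_def)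
  then show ?thesis by auto
qed

text \<open>In a localization that leaves out y_j all exponents of y_j are nonnegative, while this
  exponent is -1 there. So taking the coefficient is a functional that vanishes on all top
  coboundaries.\<close>

lemma residue_laurent_local_remove:
  assumes "l \<in> laurent_local m ({..<n} - {j}) A" "j < n"
  shows "lookup l (residue_exp m n) = 0"
proof (rule ccontr)
  assume "\<not> ?thesis"
  then obtain u t where t: "t \<in> y_exponents m ({..<n} - {j})" "residue_exp m n = int_exp u - int_exp t"
    using keys_laurent_local[OF assms(1), of "residue_exp m n"] by (auto simp: in_keys_iff)
  have "m + j \<notin> (+) m ` ({..<n} - {j})" by auto
  then have "lookup t (m + j) = 0" by (rule y_exponents_lookup_0[OF t(1)])
  then have "lookup (residue_exp m n) (m + j) = int (lookup u (m + j))" by (simp add: t(2) lookup_minus)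
  then show False using assms(2) by (simp add: lookup_residue_exp)
qed

lemma lookup_cech_sign_mult: "lookup l s = 0 \<Longrightarrow> lookup (cech_sign Y j * l) s = 0"
  by (cases "even (card {k \<in> Y. k < j})") (simp_all add: cech_sign_def)

lemma residue_laurent_diff:
  assumes "\<And>j. j < n \<Longrightarrow> e ({..<n} - {j}) \<in> laurent_local m ({..<n} - {j}) A"
  shows "lookup (\<Sum>j<n. cech_sign {..<n} j * e ({..<n} - {j})) (residue_exp m n) = 0"
  unfolding lookup_sum
  by (intro sum.neutral ballI lookup_cech_sign_mult residue_laurent_local_remove[OF assms]) auto

lemma single_in_laurent_local:
  assumes "\<And>i. i \<ge> m + n \<Longrightarrow> lookup s i = 0" "\<And>i. i \<notin> (+) m ` X \<Longrightarrow> lookup s i \<ge> 0"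
  shows "single s c \<in> laurent_local m X (polys_in {..<m + n})"
proof -
  \<comment> \<open>As \<open>nat\<close> sends negative numbers to 0, u and t are the positive and
    the negative part of s.\<close>
  define u where "u = Poly_Mapping.map nat s"
  define t where "t = Poly_Mapping.map (\<lambda>z. nat (- z)) s"
  have u: "lookup u i = nat (lookup s i)" and t: "lookup t i = nat (- lookup s i)" for i
    by (simp_all add: u_def t_def Poly_Mapping.map.rep_eq when_def)
  have "s = int_exp u - int_exp t"
    by (rule poly_mapping_eqI) (simp add: lookup_minus u t)
  then have "single s c = laurent_frac (single u c) t"
    by (simp add: laurent_frac_def to_laurent_single mult_single)
  moreover have "keys u \<subseteq> {..<m + n}"
  proof
    fix i assume "i \<in> keys u"
    then have "lookup s i \<noteq> 0" by (auto simp: in_keys_iff u)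
    then show "i \<in> {..<m + n}" using assms(1)[of i] by force
  qed
  moreover have "t \<in> y_exponents m X"
    unfolding y_exponents_def
  proof (intro CollectI subsetI)
    fix i assume "i \<in> keys t"
    then have "lookup s i < 0" by (simp add: in_keys_iff t)
    then show "i \<in> (+) m ` X" using assms(2)[of i] by fastforce
  qed
  ultimately show ?thesis by (auto intro!: laurent_localI polys_in_single)
qed

lemma residue_monomial_mem: "single (residue_exp m n) c \<in> laurent_local m {..<n} (polys_in {..<m + n})"
proof (rule single_in_laurent_local)
  fix i assume "i \<notin> (+) m ` {..<n}"
  then have "\<not> (m \<le> i \<and> i < m + n)" by (auto simp: image_iff) (metis le_add_diff_inverse lessThan_iff nat_add_left_cancel_less)
  then show "lookup (residue_exp m n) i \<ge> 0" by (simp add: lookup_residue_exp)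
qed (simp add: lookup_residue_exp)

section \<open>Nonvanishing and vanishing in degree n\<close>

context bipoly_ideal
begin

text \<open>Every monomial of an element of I involves some x_i, which no denominator in the y_j
  removes. So the residue coefficient vanishes on the localized ideal as well as on coboundaries,
  but not on the residue monomial.\<close>

lemma top_cohomology_nonzero:
  assumes x: "\<And>v s. v \<in> I \<Longrightarrow> s \<in> keys v \<Longrightarrow> \<exists>i<m. lookup s i \<noteq> 0"
  shows "nonzero_module (H n)"
proof (rule local_cohomology_nonzeroI)
  let ?l = "\<lambda>_. single (residue_exp m n) 1 :: 'k laurent"
  show "valid_cochain n ?l" by (simp add: valid_cochain_def index_sets_top residue_monomial_mem)
  fix e assume e: "\<And>X i. X \<in> index_sets n n \<Longrightarrow> i \<in> X \<Longrightarrow> e (X - {i}) \<in> L (X - {i})"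
  have "lookup (laurent_diff e {..<n}) (residue_exp m n) = 0"
    unfolding laurent_diff_def using e by (intro residue_laurent_diff) (auto simp: index_sets_top)
  then have "residue_exp m n \<in> keys (?l {..<n} - laurent_diff e {..<n})"
    by (simp add: in_keys_iff lookup_minus)
  moreover have "residue_exp m n \<notin> keys l" if l: "l \<in> LL {..<n}" for l
  proof
    assume "residue_exp m n \<in> keys l"
    then obtain v u t where *: "v \<in> I" "u \<in> keys v" "t \<in> y_exponents m {..<n}"
      "residue_exp m n = int_exp u - int_exp t"
      using keys_laurent_local[OF l] by blast
    obtain i where i: "i < m" "lookup u i \<noteq> 0" using x[OF *(1,2)] by blast
    have "lookup t i = 0" using y_exponents_lookup_0[OF *(3), of i] i(1) by auto
    moreover have "lookup (residue_exp m n) i = 0" using i(1) by (simp add: lookup_residue_exp)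
    ultimately show False using i(2) by (simp add: *(4) lookup_minus)
  qed
  ultimately show "\<exists>X\<in>index_sets n n. ?l X - laurent_diff e X \<notin> LL X"
    unfolding index_sets_top by blast
qed (simp add: index_sets_empty)

text \<open>The index sets of size n - 1 are complements of single elements. Recovering this element
  from the set allows such a cochain to be specified by a function of j.\<close>

lemma Min_complement: "j < n \<Longrightarrow> Min ({..<n} - ({..<n} - {j})) = j"
proof -
  assume "j < n"
  then have "{..<n} - ({..<n} - {j}) = {j}" by auto
  then show ?thesis by simp
qed

text \<open>The elements that become zero in the top cohomology of S/I. The signs of the
  differential are absorbed into e.\<close>

definition negligible :: "'k laurent \<Rightarrow> bool"
  where "negligible l \<longleftrightarrow> (\<exists>e. (\<forall>j<n. e j \<in> L ({..<n} - {j})) \<and> l - (\<Sum>j<n. e j) \<in> LL {..<n})"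

lemma negligible_add: "negligible l \<Longrightarrow> negligible l' \<Longrightarrow> negligible (l + l')"
proof -
  assume "negligible l" "negligible l'"
  then obtain e e' where e: "\<forall>j<n. e j \<in> L ({..<n} - {j})" "l - (\<Sum>j<n. e j) \<in> LL {..<n}"
    and e': "\<forall>j<n. e' j \<in> L ({..<n} - {j})" "l' - (\<Sum>j<n. e' j) \<in> LL {..<n}"
    by (auto simp: negligible_def)
  have "(l - (\<Sum>j<n. e j)) + (l' - (\<Sum>j<n. e' j)) \<in> LL {..<n}"
    by (rule laurent_local_add[OF subset_refl is_ideal e(2) e'(2)])
  then have "l + l' - (\<Sum>j<n. e j + e' j) \<in> LL {..<n}" by (simp add: sum.distrib algebra_simps)
  moreover have "\<forall>j<n. e j + e' j \<in> L ({..<n} - {j})"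
    using e(1) e'(1) by (intro allI impI laurent_ring_closed(2)[of _ n]) auto
  ultimately show ?thesis unfolding negligible_def by (intro exI[of _ "\<lambda>j. e j + e' j"]) blast
qed

lemma negligible_ideal: "l \<in> LL {..<n} \<Longrightarrow> negligible l"
  unfolding negligible_def using laurent_ring_closed(1)[of "{..<n} - {_}" n]
  by (intro exI[of _ "\<lambda>_. 0"]) auto

lemma negligible_remove:
  assumes "l \<in> L ({..<n} - {j})" "j < n"
  shows "negligible l"
proof -
  have "(\<Sum>i<n. if i = j then l else 0) = l" using assms(2) by simp
  then show ?thesis
    unfolding negligible_def
    using assms laurent_ring_closed(1)[of "{..<n} - {_}" n] laurent_local_0[OF subset_refl is_ideal]
    by (intro exI[of _ "\<lambda>i. if i = j then l else 0"]) auto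
qed

lemma negligible_sum: "(\<And>i. i \<in> A \<Longrightarrow> negligible (g i)) \<Longrightarrow> negligible (\<Sum>i\<in>A. g i)"
proof (induction A rule: infinite_finite_induct)
  case (insert x A)
  then show ?case by (simp add: negligible_add)
qed (use negligible_ideal laurent_local_0[OF subset_refl is_ideal] in simp_all)

lemma finite_exponents:
  assumes "finite B"
  shows "finite {r :: nat \<Rightarrow>\<^sub>0 int. (\<forall>i<N. lookup r i \<in> B) \<and> (\<forall>i\<ge>N. lookup r i = 0)}" (is "finite ?F")
proof -
  let ?f = "\<lambda>r :: nat \<Rightarrow>\<^sub>0 int. map (lookup r) [0..<N]"
  have "inj_on ?f ?F"
  proof (rule inj_onI, rule poly_mapping_eqI)
    fix r r' i assume r: "r \<in> ?F" "r' \<in> ?F" "?f r = ?f r'"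
    show "lookup r i = lookup r' i"
    proof (cases "i < N")
      case True
      then show ?thesis using arg_cong[OF r(3), of "\<lambda>xs. xs ! i"] by simp
    qed (use r in simp)
  qed
  moreover have "?f ` ?F \<subseteq> {xs. set xs \<subseteq> B \<and> length xs = N}" by auto
  ultimately show ?thesis using inj_on_finite[OF _ _ finite_lists_length_eq[OF assms]] by blast
qed

lemma int_exp_less: "s < t \<Longrightarrow> int_exp s < int_exp t"
  unfolding less_poly_mapping.rep_eq less_fun_def by simp

text \<open>Modulo \<open>p\<close>, a Laurent monomial with negative exponents in all \<open>y\<^sub>j\<close> is a combination of
  smaller monomials of the same degree; only finitely many of these again have negative exponents
  in all \<open>y\<^sub>j\<close>.\<close>

lemma monomial_negligible:
  assumes p: "p \<in> I" "bihomogeneous m n (0, b) p" "p \<noteq> 0"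
    and s: "\<And>i. i \<ge> m + n \<Longrightarrow> lookup s i = 0" "\<And>i. i < m \<Longrightarrow> lookup s i \<ge> 0"
  shows "negligible (single s c)"
proof -
  define F where "F s = {r :: nat \<Rightarrow>\<^sub>0 int. (\<forall>i<m. lookup r i = lookup s i) \<and> (\<forall>j<n. lookup r (m + j) < 0) \<and>
    (\<Sum>j<n. lookup r (m + j)) = (\<Sum>j<n. lookup s (m + j)) \<and> (\<forall>i\<ge>m+n. lookup r i = 0)}" for s
  have F_fin: "finite (F s)" for s
  proof -
    let ?tot = "\<Sum>j<n. lookup s (m + j)"
    \<comment> \<open>The x-exponents of r are prescribed; its y-exponents are all negative, so each
      of them is at least their total.\<close>
    let ?B = "lookup s ` {..<m} \<union> {?tot..0}"
    have "lookup r i \<in> ?B" if r: "r \<in> F s" and i: "i < m + n" for r i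
    proof (cases "i < m")
      case True
      then show ?thesis using r by (auto simp: F_def)
    next
      case False
      define j where "j = i - m"
      have j: "j < n" "i = m + j" using False i by (auto simp: j_def)
      have neg: "lookup r (m + k) < 0" if "k < n" for k using r that by (simp add: F_def)
      have "?tot = (\<Sum>j<n. lookup r (m + j))" using r by (simp add: F_def)
      also have "\<dots> = lookup r (m + j) + (\<Sum>j\<in>{..<n} - {j}. lookup r (m + j))"
        using j by (subst sum.remove[of _ j]) auto
      also have "(\<Sum>j\<in>{..<n} - {j}. lookup r (m + j)) \<le> 0"
        by (rule sum_nonpos) (use neg in \<open>auto intro: less_imp_le\<close>)
      finally show ?thesis using neg[OF j(1)] j(2) by simp
    qed
    then have "F s \<subseteq> {r. (\<forall>i<m+n. lookup r i \<in> ?B) \<and> (\<forall>i\<ge>m+n. lookup r i = 0)}" by (auto simp: F_def)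
    then show ?thesis by (rule finite_subset) (rule finite_exponents, simp)
  qed
  \<comment> \<open>The leading monomial of p for the linear order on exponents, which is compatible
    with addition also for integer exponents.\<close>
  define T where "T = Max (keys p)"
  have T: "T \<in> keys p" "\<And>t. t \<in> keys p \<Longrightarrow> t \<noteq> T \<Longrightarrow> t < T"
    using p(3) Max_in[of "keys p"] Max_ge[of "keys p"] by (auto simp: T_def order_less_le)
  have p_deg: "lookup t i = 0" if "t \<in> keys p" "i < m \<or> i \<ge> m + n" for t i
  proof (cases "i < m")
    case True
    then show ?thesis using p(2) that by (auto simp: bihomogeneous_def)
  next
    case False
    then have "i \<notin> {..<m + n}" using that by auto
    moreover have "keys t \<subseteq> {..<m + n}"
      using p(2) that by (auto simp: bihomogeneous_def carrier_bipoly polys_in_def)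
    ultimately show ?thesis by (meson in_keys_iff subsetD)
  qed
  have p_tot: "(\<Sum>j<n. lookup t (m + j)) = b" if "t \<in> keys p" for t
    using p(2) that by (auto simp: bihomogeneous_def)
  \<comment> \<open>No y_j occurs in the denominator, so the monomial comes from the localization
    that leaves out y_j.\<close>
  have base: "negligible (single s c)"
    if s: "\<And>i. i \<ge> m + n \<Longrightarrow> lookup s i = 0" "\<And>i. i < m \<Longrightarrow> lookup s i \<ge> 0" and j: "j < n" "lookup s (m + j) \<ge> 0" for s c j
  proof (rule negligible_remove[OF _ j(1)])
    show "single s c \<in> L ({..<n} - {j})"
    proof (rule single_in_laurent_local[OF s(1)])
      fix i assume i: "i \<notin> (+) m ` ({..<n} - {j})"
      consider "i < m" | "i \<ge> m + n" | "i = m + j" | "m \<le> i" "i < m + n" "i \<noteq> m + j" by linarith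
      then show "lookup s i \<ge> 0"
      proof cases
        case 4
        then have "i = m + (i - m)" "i - m \<in> {..<n} - {j}" by auto
        then show ?thesis using i by blast
      qed (use s j in auto)
    qed
  qed
  \<comment> \<open>The order on integer exponents is not well founded, so the measure counts only
    the smaller members of the finite set \<open>F s\<close>.\<close>
  show ?thesis
    using s
  proof (induction "card {r \<in> F s. r < s}" arbitrary: s c rule: less_induct)
    case less
    show ?case
    proof (cases "\<exists>j<n. lookup s (m + j) \<ge> 0")
      case True
      then obtain j where j: "j < n" "lookup s (m + j) \<ge> 0" by blast
      then show ?thesis using base less.prems by blast
    next
      case False
      then have neg: "\<And>j. j < n \<Longrightarrow> lookup s (m + j) < 0" by force
      have sF: "s \<in> F s" using neg less.prems by (auto simp: F_def)
      \<comment> \<open>Chosen so that p times the monomial with exponent s - T and coefficient d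
        has leading coefficient c, at the exponent s.\<close>
      define d where "d = c / lookup p T"
      have d: "d * lookup p T = c" using T(1) by (simp add: d_def in_keys_iff)
      let ?q = "s - int_exp T"
      have "single ?q d \<in> L {..<n}"
      proof (rule single_in_laurent_local)
        fix i
        show "lookup ?q i = 0" if "i \<ge> m + n" using that less.prems p_deg[OF T(1)] by (simp add: lookup_minus)
        show "lookup ?q i \<ge> 0" if "i \<notin> (+) m ` {..<n}"
        proof -
          have "i < m \<or> i \<ge> m + n"
            using that by (auto simp: image_iff) (metis le_add_diff_inverse lessThan_iff nat_add_left_cancel_less not_less)
          then show ?thesis using less.prems p_deg[OF T(1)] by (auto simp: lookup_minus)
        qed
      qed
      moreover have "to_laurent p \<in> LL {..<n}"
        using laurent_localI[OF p(1) y_exponents_0, of m "{..<n}"] by (simp add: laurent_frac_def)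
      ultimately have in_LL: "single ?q d * to_laurent p \<in> LL {..<n}"
        by (intro laurent_local_mult[OF subset_refl is_ideal])
      have "single ?q d * to_laurent p = (\<Sum>t\<in>keys p. single (?q + int_exp t) (d * lookup p t))"
        by (subst pm_eq_sum_single[of p])
          (simp add: to_laurent_sum to_laurent_single sum_distrib_left mult_single)
      also have "\<dots> = single s c + (\<Sum>t\<in>keys p - {T}. single (?q + int_exp t) (d * lookup p t))"
        using T(1) by (subst sum.remove[of _ T]) (auto simp: d)
      finally have eq: "single s c = single ?q d * to_laurent p +
          (\<Sum>t\<in>keys p - {T}. single (?q + int_exp t) (- (d * lookup p t)))"
        by (simp add: single_uminus sum_negf)
      show ?thesis
        unfolding eq
      proof (rule negligible_add[OF negligible_ideal[OF in_LL] negligible_sum])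
        fix t assume t: "t \<in> keys p - {T}"
        let ?s = "?q + int_exp t"
        have x: "lookup ?s i = lookup s i" if "i < m \<or> i \<ge> m + n" for i
          using p_deg[OF T(1) that] p_deg[of t i] t that by (simp add: lookup_add lookup_minus)
        have "(\<Sum>j<n. lookup ?s (m + j)) = (\<Sum>j<n. lookup s (m + j)) - int (\<Sum>j<n. lookup T (m + j)) + int (\<Sum>j<n. lookup t (m + j))"
          by (simp add: lookup_add lookup_minus sum.distrib sum_subtractf)
        also have "\<dots> = (\<Sum>j<n. lookup s (m + j))" using p_tot[OF T(1)] p_tot[of t] t by simp
        \<comment> \<open>T and t have the same bidegree, so the set F is the same for the new
          exponent and the two measures count within one set.\<close>
        finally have FF: "F ?s = F s" unfolding F_def using x by simp
        have "int_exp t < int_exp T" using T(2) t by (intro int_exp_less) auto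
        then have lt: "?s < s" by (simp add: algebra_simps)
        show "negligible (single ?s (- (d * lookup p t)))"
        proof (cases "\<exists>j<n. lookup ?s (m + j) \<ge> 0")
          case True
          then show ?thesis using base[of ?s] x less.prems by auto
        next
          case False
          then have "?s \<in> F ?s" using x less.prems by (auto simp: F_def not_le)
          then have "?s \<in> {r \<in> F s. r < s}" "?s \<notin> {r \<in> F ?s. r < ?s}" using lt FF by auto
          moreover have "{r \<in> F ?s. r < ?s} \<subseteq> {r \<in> F s. r < s}" unfolding FF using less_trans[OF _ lt] by blast
          ultimately have "{r \<in> F ?s. r < ?s} \<subset> {r \<in> F s. r < s}" by blast
          then have "card {r \<in> F ?s. r < ?s} < card {r \<in> F s. r < s}"
            using F_fin by (intro psubset_card_mono) auto
          then show ?thesis using less.prems x by (intro less.hyps) auto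
        qed
      qed
    qed
  qed
qed

text \<open>A top cochain is a single Laurent polynomial, and negligibility is additive, so it is
  enough to treat its monomials.\<close>

lemma top_cohomology_zero:
  assumes p: "p \<in> I" "bihomogeneous m n (0, b) p" "p \<noteq> 0" "b > 0"
  shows "\<not> nonzero_module (H n)"
proof -
  obtain s where s: "s \<in> keys p" using p(3) by fastforce
  have "n \<noteq> 0"
  proof
    assume "n = 0"
    then show False using p(2,4) s by (auto simp: bihomogeneous_def)
  qed
  then obtain k where k: "n = Suc k" by (cases n) auto
  have *: "\<exists>e. valid_cochain k e \<and> (\<forall>X\<in>index_sets n (Suc k). l X - laurent_diff e X \<in> LL X)"
    if l: "valid_cochain (Suc k) l" for l
  proof -
    have lL: "l {..<n} \<in> L {..<n}" using l by (simp add: valid_cochain_def index_sets_top flip: k)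
    have "negligible (\<Sum>s\<in>keys (l {..<n}). single s (lookup (l {..<n}) s))"
    proof (rule negligible_sum, rule monomial_negligible[OF p(1-3)])
      fix s i assume "s \<in> keys (l {..<n})"
      then obtain v u t where *: "v \<in> S" "u \<in> keys v" "t \<in> y_exponents m {..<n}" "s = int_exp u - int_exp t"
        using keys_laurent_local[OF lL] by blast
      have u: "lookup u i = 0" if "i \<ge> m + n"
      proof -
        have "keys u \<subseteq> {..<m + n}" using *(1,2) by (simp add: polys_in_def)
        then have "i \<notin> keys u" using that by auto
        then show ?thesis by (simp add: in_keys_iff)
      qed
      have t: "lookup t i = 0" if "i < m \<or> i \<ge> m + n"
        using that by (intro y_exponents_lookup_0[OF *(3)]) auto
      show "lookup s i = 0" if "i \<ge> m + n" using u t that by (simp add: *(4) lookup_minus)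
      show "lookup s i \<ge> 0" if "i < m" using t that by (simp add: *(4) lookup_minus)
    qed
    then have "negligible (l {..<n})" by (simp flip: pm_eq_sum_single)
    then obtain e where e: "\<forall>j<n. e j \<in> L ({..<n} - {j})" "l {..<n} - (\<Sum>j<n. e j) \<in> LL {..<n}"
      by (auto simp: negligible_def)
    \<comment> \<open>The signs put in here are cancelled by those of \<open>laurent_diff\<close>,
      each sign having square 1.\<close>
    define e' where "e' X = cech_sign {..<n} (Min ({..<n} - X)) * e (Min ({..<n} - X))" for X
    have e': "e' ({..<n} - {j}) = cech_sign {..<n} j * e j" if "j < n" for j
      unfolding e'_def Min_complement[OF that] ..
    have "valid_cochain k e'"
      unfolding valid_cochain_def
    proof
      fix X assume "X \<in> index_sets n k"
      then obtain j where j: "j < n" "X = {..<n} - {j}" using index_sets_pred[of n] k by auto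
      have "cech_sign {..<n} j * e j \<in> L X"
        using e(1) j by (intro cech_sign_mult_mem[OF _ ideal_polys_in]) auto
      then show "e' X \<in> L X" using e'[OF j(1)] j(2) by simp
    qed
    moreover have "laurent_diff e' {..<n} = (\<Sum>j<n. e j)"
      unfolding laurent_diff_def by (rule sum.cong) (simp_all add: e')
    ultimately show ?thesis
      using e(2) by (intro exI[of _ e']) (simp add: index_sets_top flip: k)
  qed
  have "\<not> nonzero_module (H (Suc k))" by (rule local_cohomology_zeroI) (rule *)
  then show ?thesis unfolding k[symmetric] .
qed

end

section \<open>Nonvanishing in degree n - 1\<close>

lemma y_ideal_combination:
  assumes "v \<in> y_ideal m n"
  shows "\<exists>a. (\<forall>j<n. a j \<in> polys_in {..<m + n}) \<and> v = (\<Sum>j<n. a j * pvar (m + j))"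
proof -
  let ?P = "\<lambda>v. \<exists>a. (\<forall>j<n. a j \<in> polys_in {..<m + n}) \<and> v = (\<Sum>j<n. a j * pvar (m + j))"
  have P_add: "?P (v + w)" if vw: "?P v" "?P w" for v w
  proof -
    obtain a a' where "\<forall>j<n. a j \<in> polys_in {..<m + n}" "v = (\<Sum>j<n. a j * pvar (m + j))"
      "\<forall>j<n. a' j \<in> polys_in {..<m + n}" "w = (\<Sum>j<n. a' j * pvar (m + j))"
      using vw by blast
    then show ?thesis
      by (intro exI[of _ "\<lambda>j. a j + a' j"]) (simp add: polys_in_add distrib_right sum.distrib)
  qed
  have P_single: "?P (single s c)" if s: "keys s \<subseteq> {..<m + n}" "\<not> keys s \<subseteq> {..<m}" for s c
  proof -
    obtain i where i: "i \<in> keys s" "i \<notin> {..<m}" using s(2) by blast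
    define j where "j = i - m"
    have j: "j < n" "i = m + j" using i s(1) by (auto simp: j_def)
    \<comment> \<open>Some y_j divides the monomial; u is the exponent left after splitting off one
      such factor.\<close>
    define u where "u = s - single i 1"
    have u: "u + single i 1 = s"
      by (rule poly_mapping_eqI) (use i(1) in \<open>auto simp: u_def lookup_add lookup_minus lookup_single when_def in_keys_iff\<close>)
    have "keys u \<subseteq> {..<m + n}" using s(1) keys_add_nat[of u "single i 1"] u by auto
    moreover have "single s c = (\<Sum>k<n. (if k = j then single u c else 0) * pvar (m + k))"
    proof -
      have "(\<Sum>k<n. (if k = j then single u c else 0) * pvar (m + k)) = (\<Sum>k<n. if k = j then single u c * pvar (m + j) else 0)"
        by (rule sum.cong) auto
      also have "\<dots> = single s c" using j u by (simp add: pvar_def mult_single)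
      finally show ?thesis by simp
    qed
    ultimately show ?thesis
      by (intro exI[of _ "\<lambda>k. if k = j then single u c else 0"]) (auto intro: polys_in_single)
  qed
  have P_0: "?P 0" by (intro exI[of _ "\<lambda>_. 0"]) simp
  have "?P (\<Sum>s\<in>A. single s (lookup v s))" if "finite A" "A \<subseteq> keys v" for A
    using that
  proof (induction A rule: finite_induct)
    case empty
    then show ?case using P_0 by simp
  next
    case (insert s A)
    have "s \<in> keys v" using insert by simp
    then have "keys s \<subseteq> {..<m + n}" "\<not> keys s \<subseteq> {..<m}"
      using assms by (auto simp: y_ideal_def polys_in_def restrict_vars_eq_0_iff)
    then have "?P (single s (lookup v s))" by (rule P_single)
    moreover have "?P (\<Sum>s\<in>A. single s (lookup v s))" using insert by simp
    ultimately show ?case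
      unfolding sum.insert[OF insert(1,2)] by (rule P_add)
  qed
  from this[of "keys v"] show ?thesis by (simp only: finite_keys subset_refl flip: pm_eq_sum_single)
qed

text \<open>The connecting homomorphism for multiplication by \<open>p\<close>: writing \<open>p\<close> as a combination of the
  \<open>y\<^sub>j\<close> makes \<open>p / (y\<^sub>1 \<dots> y\<^sub>n)\<close> a coboundary over \<open>S\<close>, hence gives a cocycle over \<open>S/p\<close>.\<close>

lemma penultimate_cohomology_nonzero:
  fixes p :: "'k::field mpoly"
  assumes p: "p \<in> y_ideal m n" "p \<noteq> 0" and n: "n > 0"
  shows "nonzero_module (local_cohomology (bipoly_ring m n) (y_vars m n)
    (hypersurface m n p) (n - 1))"
proof -
  have pS: "p \<in> polys_in {..<m + n}" using p(1) y_ideal_subset by blast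
  interpret bipoly_ideal m n "PIdl\<^bsub>bipoly_ring m n\<^esub> p" by (rule PIdl_bipoly_ideal[OF pS])
  let ?J = "{..<n}"
  obtain a where a: "\<And>j. j < n \<Longrightarrow> a j \<in> S" "p = (\<Sum>j<n. a j * pvar (m + j))"
    using y_ideal_combination[OF p(1)] by blast
  define w :: "'k laurent" where "w = single (residue_exp m n) 1"
  \<comment> \<open>The j-th part of p / (y_1 ... y_n). Its factor y_j cancels against the
    denominator, so it lies in the localization that leaves out y_j.\<close>
  define q where "q j = to_laurent (a j * pvar (m + j)) * w" for j
  have q_mem: "q j \<in> L (?J - {j})" if j: "j < n" for j
  proof -
    have "q j = to_laurent (a j) * single (int_exp (single (m + j) 1) + residue_exp m n) 1"
      by (simp add: q_def w_def to_laurent_mult pvar_def to_laurent_single mult_single mult.assoc)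
    moreover have "single (int_exp (single (m + j) 1) + residue_exp m n) 1 \<in> L (?J - {j})"
    proof (rule single_in_laurent_local)
      fix i
      have e: "lookup (int_exp (single (m + j) 1) + residue_exp m n) i =
          (if i = m + j then 1 else 0) + (if m \<le> i \<and> i < m + n then - 1 else 0)"
        by (simp add: lookup_add lookup_single lookup_residue_exp when_def)
      show "lookup (int_exp (single (m + j) 1) + residue_exp m n) i = 0" if "i \<ge> m + n"
        using that j e by simp
      show "0 \<le> lookup (int_exp (single (m + j) 1) + residue_exp m n) i" if i: "i \<notin> (+) m ` (?J - {j})"
      proof -
        have "i = m + j \<or> \<not> (m \<le> i \<and> i < m + n)"
        proof (rule ccontr)
          assume "\<not> ?thesis"
          then have "i = m + (i - m)" "i - m \<in> ?J - {j}" by auto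
          then show False using i by blast
        qed
        then show ?thesis using e j by auto
      qed
    qed
    moreover have "to_laurent (a j) \<in> L (?J - {j})"
      using laurent_localI[OF a(1)[OF j] y_exponents_0, of m "?J - {j}"] by (simp add: laurent_frac_def)
    ultimately show ?thesis
      using laurent_local_mult[OF Diff_subset ideal_polys_in] by simp
  qed
  have q_sum: "(\<Sum>j<n. q j) = to_laurent p * w"
    by (subst a(2)) (simp add: q_def to_laurent_sum sum_distrib_right)
  \<comment> \<open>With these signs the differential of l is the plain sum of the
    \<open>q j\<close>, that is p / (y_1 ... y_n), which vanishes modulo p.\<close>
  define l where "l X = cech_sign ?J (Min (?J - X)) * q (Min (?J - X))" for X
  have l: "l (?J - {j}) = cech_sign ?J j * q j" if "j < n" for j
    unfolding l_def Min_complement[OF that] ..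
  have pred: "X \<in> index_sets n (n - 1) \<longleftrightarrow> (\<exists>j<n. X = ?J - {j})" for X
    using index_sets_pred[OF n] by auto
  have LL_p: "\<exists>s\<in>L X. x = to_laurent p * s" if x: "x \<in> LL X" for X x
  proof -
    obtain v t where vt: "v \<in> PIdl\<^bsub>bipoly_ring m n\<^esub> p" "t \<in> y_exponents m X" "x = laurent_frac v t"
      using x by (auto simp: laurent_local_def)
    then obtain u where "v = u * p" "u \<in> S" by (auto simp: cgenideal_def carrier_bipoly)
    then have "x = to_laurent p * laurent_frac u t" "laurent_frac u t \<in> L X"
      using vt laurent_localI[of u S t m X] by (simp_all add: laurent_frac_def to_laurent_mult mult.commute mult.left_commute)
    then show ?thesis by blast
  qed
  show ?thesis
  proof (rule local_cohomology_nonzeroI)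
    show "valid_cochain (n - 1) l"
      unfolding valid_cochain_def
    proof
      fix X assume "X \<in> index_sets n (n - 1)"
      then obtain j where j: "j < n" "X = ?J - {j}" using pred by blast
      show "l X \<in> L X"
        unfolding j(2) l[OF j(1)] by (rule cech_sign_mult_mem[OF Diff_subset ideal_polys_in q_mem[OF j(1)]])
    qed
  next
    fix Y assume "Y \<in> index_sets n (Suc (n - 1))"
    then have Y: "Y = ?J" using n by (simp add: index_sets_top)
    have "laurent_diff l ?J = (\<Sum>j<n. q j)"
      unfolding laurent_diff_def by (rule sum.cong) (simp_all add: l)
    also have "\<dots> = w * to_laurent p" by (simp add: q_sum mult.commute)
    also have "\<dots> \<in> LL ?J"
    proof (rule laurent_local_mult[OF subset_refl is_ideal])
      show "w \<in> L ?J" unfolding w_def by (rule residue_monomial_mem)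
      have "p \<in> PIdl\<^bsub>bipoly_ring m n\<^esub> p" by (simp add: bipoly_PIdl[OF pS] pS)
      from laurent_localI[OF this y_exponents_0, of m ?J] show "to_laurent p \<in> LL ?J"
        by (simp add: laurent_frac_def)
    qed
    finally show "laurent_diff l Y \<in> LL Y" unfolding Y .
  next
    fix e assume "\<And>X i. X \<in> index_sets n (n - 1) \<Longrightarrow> i \<in> X \<Longrightarrow> e (X - {i}) \<in> L (X - {i})"
    show "\<exists>X\<in>index_sets n (n - 1). l X - laurent_diff e X \<notin> LL X"
    proof (rule ccontr)
      assume "\<not> ?thesis"
      then have "\<forall>j\<in>?J. \<exists>s. s \<in> L (?J - {j}) \<and> l (?J - {j}) - laurent_diff e (?J - {j}) = to_laurent p * s"
        using LL_p pred by blast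
      from bchoice[OF this] obtain s where s: "\<And>j. j < n \<Longrightarrow> s j \<in> L (?J - {j})"
        "\<And>j. j < n \<Longrightarrow> l (?J - {j}) - laurent_diff e (?J - {j}) = to_laurent p * s j"
        by auto
      \<comment> \<open>Apply the differential to the congruence between l and the coboundary. The
        coboundary disappears by d d = 0 and l gives p w, so after cancelling p, w is a signed sum
        of the \<open>s j\<close>. These have residue coefficient 0, whereas that of w is 1.\<close>
      have "(\<Sum>j<n. cech_sign ?J j * (l (?J - {j}) - laurent_diff e (?J - {j}))) =
          (\<Sum>j<n. cech_sign ?J j * l (?J - {j})) - (\<Sum>j<n. cech_sign ?J j * laurent_diff e (?J - {j}))"
        by (simp add: right_diff_distrib sum_subtractf)
      also have "(\<Sum>j<n. cech_sign ?J j * l (?J - {j})) = to_laurent p * w"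
        unfolding q_sum[symmetric] by (rule sum.cong) (simp_all add: l)
      also have "(\<Sum>j<n. cech_sign ?J j * laurent_diff e (?J - {j})) =
          (\<Sum>j<n. \<Sum>i\<in>?J - {j}. cech_sign ?J j * (cech_sign (?J - {j}) i * e (?J - {j} - {i})))"
        unfolding laurent_diff_def by (simp add: sum_distrib_left)
      also have "\<dots> = 0"
      proof (rule cech_sign_sum_zero)
        show "e (?J - {i} - {j}) = e (?J - {j} - {i})" for i j
          by (rule arg_cong[of _ _ e]) auto
      qed simp
      finally have "to_laurent p * w = (\<Sum>j<n. cech_sign ?J j * (to_laurent p * s j))"
        using s(2) by simp
      also have "\<dots> = to_laurent p * (\<Sum>j<n. cech_sign ?J j * s j)"
        by (simp add: sum_distrib_left mult.left_commute)
      finally have "w = (\<Sum>j<n. cech_sign ?J j * s j)"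
        using p(2) to_laurent_eq_iff[of p 0] by (simp only: mult_cancel_left) auto
      moreover have "lookup (\<Sum>j<n. cech_sign ?J j * s j) (residue_exp m n) = 0"
        unfolding lookup_sum
        by (intro sum.neutral ballI lookup_cech_sign_mult residue_laurent_local_remove[OF s(1)]) auto
      ultimately have "lookup w (residue_exp m n) = 0" by simp
      then show False by (simp add: w_def)
    qed
  qed
qed

section \<open>Maximal depth of a hypersurface ring\<close>

lemma bihomogeneous_quotient:
  assumes "bihomogeneous m n (a, b) (p * q)" "p * q \<noteq> 0" "bihomogeneous m n (c, d) p"
  shows "\<exists>c' d'. bihomogeneous m n (c', d') q \<and> a = c + c' \<and> b = d + d'"
proof -
  have "q * p \<noteq> 0" "bihomogeneous m n (a, b) (q * p)" using assms by (simp_all add: mult.commute)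
  then obtain e where e: "bihomogeneous m n e q" using bihomogeneous_factor by blast
  obtain c' d' where "e = (c', d')" by (cases e)
  then show ?thesis
    using e bihomogeneous_degree_unique[OF assms(1) bihomogeneous_mult[OF assms(3)] assms(2)] by blast
qed

lemma bihomogeneous_0_0_unit:
  assumes "bihomogeneous m n (0, 0) p" "p \<noteq> 0"
  shows "p dvd 1"
proof -
  have px: "p \<in> polys_in {..<m}" using assms(1) by (rule bihomogeneous_y_degree_0)
  have "deg_on {..<m} p = 0"
    unfolding deg_on_def le_zero_eq[symmetric]
  proof (intro degree_le allI impI)
    fix i :: nat assume "0 < i"
    moreover have "(\<Sum>j<m. lookup s j) = 0" if "s \<in> keys p" for s
      using assms(1) that by (auto simp: bihomogeneous_def)
    ultimately show "coeff (grade_hom (\<lambda>s. s) (\<lambda>s. \<Sum>i\<in>{..<m}. lookup s i) p) i = 0"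
      unfolding grading.coeff_H[OF grading_sum] by (intro sum.neutral) fastforce
  qed
  then show ?thesis using deg_on_0_unit[OF px] assms(2) by simp
qed

lemma cd_hypersurface_le:
  "p \<in> polys_in {..<m + n} \<Longrightarrow> cd (bipoly_ring m n) (y_vars m n)
    (hypersurface m n p) \<le> enat n"
  by (rule bipoly_ideal.cd_le[OF PIdl_bipoly_ideal]) auto

lemma cd_hypersurface_x:
  assumes p: "bihomogeneous m n (\<alpha>, \<beta>) p" "\<alpha> > 0"
  shows "cd (bipoly_ring m n) (y_vars m n)
    (hypersurface m n p) = enat n"
proof -
  have pS: "p \<in> polys_in {..<m + n}" using p(1) by (simp add: bihomogeneous_def carrier_bipoly)
  interpret bipoly_ideal m n "PIdl\<^bsub>bipoly_ring m n\<^esub> p" by (rule PIdl_bipoly_ideal[OF pS])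
  have "\<exists>i<m. lookup s i \<noteq> 0" if v: "v \<in> PIdl\<^bsub>bipoly_ring m n\<^esub> p" "s \<in> keys v" for v s
  proof -
    obtain u where "v = p * u" using v(1) by (auto simp: bipoly_PIdl[OF pS] elim: dvdE)
    then obtain t t' where t: "s = t + t'" "t \<in> keys p" using v(2) keys_mult[of p u] by blast
    then have "(\<Sum>i<m. lookup t i) \<noteq> 0" using p by (auto simp: bihomogeneous_def)
    then obtain i where "i < m" "lookup t i \<noteq> 0" by auto
    then show ?thesis using t(1) by (auto simp: lookup_add)
  qed
  then have "enat n \<le> cd R (y_vars m n) M" by (intro cd_ge top_cohomology_nonzero)
  then show ?thesis using cd_hypersurface_le[OF pS] by (rule antisym[rotated])
qed

lemma cd_hypersurface_y:
  assumes p: "bihomogeneous m n (0, \<beta>) p" "\<beta> > 0" "p \<noteq> 0" and n: "n > 0"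
  shows "cd (bipoly_ring m n) (y_vars m n)
    (hypersurface m n p) = enat (n - 1)"
proof -
  have pS: "p \<in> polys_in {..<m + n}" using p(1) by (simp add: bihomogeneous_def carrier_bipoly)
  interpret bipoly_ideal m n "PIdl\<^bsub>bipoly_ring m n\<^esub> p" by (rule PIdl_bipoly_ideal[OF pS])
  have "p \<in> PIdl\<^bsub>bipoly_ring m n\<^esub> p" by (simp add: bipoly_PIdl[OF pS] pS)
  then have "\<not> nonzero_module (H n)" using top_cohomology_zero p by blast
  then have "cd R (y_vars m n) M \<le> enat (n - 1)"
    by (intro cd_le) (metis One_nat_def Suc_leI Suc_pred le_antisym n)
  moreover have "p \<in> y_ideal m n" using bihomogeneous_y_degree_pos p by blast
  then have "enat (n - 1) \<le> cd R (y_vars m n) M"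
    by (intro cd_ge penultimate_cohomology_nonzero p n)
  ultimately show ?thesis by (rule antisym)
qed

text \<open>A divisor h of degree (0, \<beta>) has a cofactor of degree (a, d). If a = 0 or d = 0
  this leads to the form \<open>?C\<close>, otherwise to \<open>?B\<close>. Conversely, for b > 0
  the factor h3 of any of the three forms is such a divisor.\<close>

lemma decomposition_iff_y_divisor:
  fixes f :: "'k::field mpoly"
  assumes f: "bihomogeneous m n (a, b) f" "f \<noteq> 0"
  shows "(\<exists>h1 h2 h3 \<alpha>1 \<alpha>2 \<beta>1 \<beta>2. f = h1 * h2 * h3 \<and>
        bihomogeneous m n (\<alpha>1, 0) h1 \<and> \<alpha>1 > 0 \<and>
        bihomogeneous m n (\<alpha>2, \<beta>1) h2 \<and> \<alpha>2 > 0 \<and> \<beta>1 > 0 \<and>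
        bihomogeneous m n (0, \<beta>2) h3 \<and> \<beta>2 > 0 \<and>
        \<alpha>1 + \<alpha>2 = a \<and> \<beta>1 + \<beta>2 = b) \<or>
    (\<exists>h2 h3 \<alpha>2 \<beta>1 \<beta>2. f = h2 * h3 \<and>
        bihomogeneous m n (\<alpha>2, \<beta>1) h2 \<and> a = \<alpha>2 \<and> \<alpha>2 > 0 \<and> \<beta>1 > 0 \<and>
        bihomogeneous m n (0, \<beta>2) h3 \<and> \<beta>2 > 0 \<and> \<beta>1 + \<beta>2 = b) \<or>
    (\<exists>h1 h3. f = h1 * h3 \<and>
        bihomogeneous m n (a, 0) h1 \<and> a \<ge> 0 \<and> bihomogeneous m n (0, b) h3 \<and> b \<ge> 0) \<longleftrightarrow>
    b = 0 \<or> (\<exists>h \<beta>. bihomogeneous m n (0, \<beta>) h \<and> \<beta> > 0 \<and> h dvd f)" (is "?A \<or> ?B \<or> ?C \<longleftrightarrow> ?D")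
proof
  assume "?A \<or> ?B \<or> ?C"
  then show ?D
    by (elim disjE exE conjE; metis dvd_triv_right neq0_conv)
next
  assume ?D
  then show "?A \<or> ?B \<or> ?C"
  proof (elim disjE exE conjE)
    assume "b = 0"
    then have ?C using f(1) bihomogeneous_1[of m n] by (intro exI[of _ f] exI[of _ 1]) simp
    then show ?thesis by blast
  next
    fix h \<beta> assume h: "bihomogeneous m n (0, \<beta>) h" "\<beta> > 0" "h dvd f"
    obtain g where g: "f = h * g" using h(3) by (elim dvdE)
    obtain c d where cd: "bihomogeneous m n (c, d) g" "a = 0 + c" "b = \<beta> + d"
      using bihomogeneous_quotient[of m n a b h g] f h(1) unfolding g by blast
    have gh: "f = g * h" using g by (simp add: mult.commute)
    consider "a = 0" | "d = 0" | "a > 0" "d > 0" by auto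
    then show ?thesis
    proof cases
      case 1
      \<comment> \<open>For a = 0, f itself has degree (0, b) and is taken as h3.\<close>
      then have ?C using f(1) bihomogeneous_1[of m n] by (intro exI[of _ 1] exI[of _ f]) simp
      then show ?thesis by blast
    next
      case 2
      then have ?C using gh cd h(1) by (intro exI[of _ g] exI[of _ h]) simp
      then show ?thesis by blast
    next
      case 3
      then have ?B
        using gh cd h by (intro exI[of _ g] exI[of _ h] exI[of _ c] exI[of _ d] exI[of _ \<beta>]) simp
      then show ?thesis by blast
    qed
  qed
qed

lemma maximal_depth_iff_y_divisor:
  fixes f :: "'k::field mpoly"
  assumes f: "bihomogeneous m n (a, b) f" "f \<noteq> 0" "\<not> f dvd 1"
  shows "has_maximal_depth (bipoly_ring m n) (y_vars m n)
      (hypersurface m n f) \<longleftrightarrow>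
    b = 0 \<or> (\<exists>h \<beta>. bihomogeneous m n (0, \<beta>) h \<and> \<beta> > 0 \<and> h dvd f)"
proof -
  let ?R = "bipoly_ring m n :: 'k mpoly ring"
  let ?M = "quot_ring_module ?R (PIdl\<^bsub>?R\<^esub> f)"
  let ?cd = "\<lambda>P. cd ?R (y_vars m n) (quot_ring_module ?R P)"
  have fS: "f \<in> polys_in {..<m + n}" using f(1) by (simp add: bihomogeneous_def carrier_bipoly)
  have prime_degree: "\<exists>\<alpha> \<beta>. bihomogeneous m n (\<alpha>, \<beta>) p \<and> (\<alpha> > 0 \<or> \<beta> > 0)"
    if p: "prime_elem p" "p dvd f" for p
  proof -
    obtain \<alpha> \<beta> where ab: "bihomogeneous m n (\<alpha>, \<beta>) p"
      using bihomogeneous_dvd[OF f(1,2) p(2)] by auto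
    have "\<not> (\<alpha> = 0 \<and> \<beta> = 0)"
    proof
      assume "\<alpha> = 0 \<and> \<beta> = 0"
      then have "bihomogeneous m n (0, 0) p" using ab by simp
      moreover have "p \<noteq> 0" using p(1) by auto
      ultimately have "p dvd 1" by (rule bihomogeneous_0_0_unit)
      then show False using prime_elem_not_unit[OF p(1)] by blast
    qed
    then have "\<alpha> > 0 \<or> \<beta> > 0" by simp
    then show ?thesis using ab by (intro exI conjI)
  qed
  have Ass: "associated_primes ?R ?M = {PIdl\<^bsub>?R\<^esub> p | p. prime_elem p \<and> p dvd f}"
  proof (intro equalityI subsetI)
    fix P assume "P \<in> associated_primes ?R ?M"
    from associated_prime_hypersurface[OF fS f(2) this]
    show "P \<in> {PIdl\<^bsub>?R\<^esub> p | p. prime_elem p \<and> p dvd f}" by auto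
  next
    fix P assume "P \<in> {PIdl\<^bsub>?R\<^esub> p | p. prime_elem p \<and> p dvd f}"
    then show "P \<in> associated_primes ?R ?M" using prime_factor_associated[OF fS f(2)] by auto
  qed
  \<comment> \<open>As f is not a unit, the infimum below runs over a nonempty set.\<close>
  obtain p0 where p0: "prime_elem p0" "p0 dvd f" using mpoly_prime_factor[OF f(2,3)] by blast
  have mgrade: "mgrade ?R (y_vars m n) ?M = (INF p\<in>{p. prime_elem p \<and> p dvd f}. ?cd (PIdl\<^bsub>?R\<^esub> p))"
    unfolding mgrade_def Ass by (rule arg_cong[of _ _ Inf]) auto
  have mgrade_n: "mgrade ?R (y_vars m n) ?M = enat n"
    if no_y: "\<And>p \<beta>. prime_elem p \<Longrightarrow> p dvd f \<Longrightarrow> bihomogeneous m n (0, \<beta>) p \<Longrightarrow> \<beta> = 0"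
  proof -
    have "?cd (PIdl\<^bsub>?R\<^esub> p) = enat n" if p: "prime_elem p" "p dvd f" for p
    proof -
      obtain \<alpha> \<beta> where ab: "bihomogeneous m n (\<alpha>, \<beta>) p" "\<alpha> > 0 \<or> \<beta> > 0"
        using prime_degree[OF p] by blast
      then have "\<alpha> > 0" using no_y[OF p] by (cases "\<alpha> = 0") auto
      then show ?thesis using cd_hypersurface_x ab(1) by blast
    qed
    then have "(INF p\<in>{p. prime_elem p \<and> p dvd f}. ?cd (PIdl\<^bsub>?R\<^esub> p)) =
        (INF p\<in>{p. prime_elem p \<and> p dvd f}. enat n)"
      by (intro INF_cong) auto
    also have "\<dots> = enat n" using p0 by (subst INF_const) auto
    finally show ?thesis unfolding mgrade .
  qed
  show ?thesis
  proof (cases "b = 0")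
    case True
    have "f \<in> polys_in {..<m}" using bihomogeneous_y_degree_0 f(1) True by blast
    \<comment> \<open>The y-degrees of a factor and its cofactor add up to b = 0.\<close>
    have "\<beta> = 0" if p: "prime_elem p" "p dvd f" "bihomogeneous m n (0, \<beta>) p" for p \<beta>
    proof -
      obtain q where "f = p * q" using p(2) by (elim dvdE)
      then show ?thesis using bihomogeneous_quotient[of m n a b p q 0 \<beta>] f p(3) True by auto
    qed
    then have "mgrade ?R (y_vars m n) ?M = enat n" by (rule mgrade_n)
    then show ?thesis
      using grade_hypersurface_0[OF f True] True by (simp add: has_maximal_depth_def)
  next
    case False
    then have b: "b > 0" by simp
    have n: "n > 0" and grade: "grade ?R (Idl\<^bsub>?R\<^esub> (set (y_vars m n))) ?M = enat (n - 1)"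
      using grade_hypersurface_pos[OF f b] by auto
    show ?thesis
    proof (cases "\<exists>h \<beta>. bihomogeneous m n (0, \<beta>) h \<and> \<beta> > 0 \<and> h dvd f")
      case True
      then obtain h \<beta> where h: "bihomogeneous m n (0, \<beta>) h" "\<beta> > 0" "h dvd f" by blast
      have h0: "h \<noteq> 0" using h(3) f(2) by auto
      have "\<not> h dvd 1"
      proof
        assume "h dvd 1"
        then obtain c where "h = single 0 c" using unit_const by blast
        then have "0 \<in> keys h" using h0 by auto
        then show False using h(1,2) by (auto simp: bihomogeneous_def)
      qed
      then obtain p q where p: "prime_elem p" "h = p * q"
        using mpoly_prime_factor[OF h0] by (auto elim: dvdE)
      have pf: "p dvd f" using p(2) h(3) by (auto elim: dvd_mult_left)
      obtain \<alpha>' \<beta>' where ab: "bihomogeneous m n (\<alpha>', \<beta>') p" "\<alpha>' > 0 \<or> \<beta>' > 0"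
        using prime_degree[OF p(1) pf] by blast
      \<comment> \<open>The x-degree of h is 0, hence so is that of its factor p. This replaces the
        given divisor by a prime one of degree (0, \<open>\<beta>'\<close>) with
        \<open>\<beta>'\<close> positive.\<close>
      have "\<alpha>' = 0"
        using bihomogeneous_quotient[of m n 0 \<beta> p q \<alpha>' \<beta>'] h(1) h0 ab(1) p(2) by auto
      then have cd_p: "?cd (PIdl\<^bsub>?R\<^esub> p) = enat (n - 1)"
        using ab p(1) n by (intro cd_hypersurface_y[of m n \<beta>']) auto
      have "enat (n - 1) \<le> ?cd (PIdl\<^bsub>?R\<^esub> p')" if p': "prime_elem p'" "p' dvd f" for p'
      proof -
        obtain \<alpha> \<beta> where ab': "bihomogeneous m n (\<alpha>, \<beta>) p'" "\<alpha> > 0 \<or> \<beta> > 0"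
          using prime_degree[OF p'] by blast
        show ?thesis
        proof (cases "\<alpha> > 0")
          case True
          then show ?thesis using cd_hypersurface_x[OF ab'(1)] by simp
        next
          case False
          then have "?cd (PIdl\<^bsub>?R\<^esub> p') = enat (n - 1)"
            using ab' p'(1) n by (intro cd_hypersurface_y[of m n \<beta>]) auto
          then show ?thesis by simp
        qed
      qed
      then have "mgrade ?R (y_vars m n) ?M = enat (n - 1)"
        unfolding mgrade using p(1) pf cd_p by (intro antisym INF_greatest INF_lower2[of p]) auto
      then show ?thesis using grade True by (simp add: has_maximal_depth_def)
    next
      case no: False
      \<comment> \<open>No prime factor is a polynomial in the y_j alone, so the minimum is n, while
        the grade is n - 1 because b > 0.\<close>
      then have "mgrade ?R (y_vars m n) ?M = enat n"
        by (intro mgrade_n) (meson gr0I)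
      then have "\<not> has_maximal_depth ?R (y_vars m n) ?M"
        using grade n by (simp add: has_maximal_depth_def)
      then show ?thesis using no False by (simp only: simp_thms)
    qed
  qed
qed

theorem theorem4p1:
  fixes m n a b :: nat and f :: "'k::field mpoly"
  assumes "bihomogeneous m n (a, b) f"
    and "f \<noteq> \<zero>\<^bsub>bipoly_ring m n\<^esub>"
    and "f \<notin> Units (bipoly_ring m n)"
  shows "has_maximal_depth (bipoly_ring m n) (y_vars m n)
      (quot_ring_module (bipoly_ring m n) (PIdl\<^bsub>bipoly_ring m n\<^esub> f)) \<longleftrightarrow>
    (\<exists>h1 h2 h3 \<alpha>1 \<alpha>2 \<beta>1 \<beta>2.
        f = h1 \<otimes>\<^bsub>bipoly_ring m n\<^esub> h2 \<otimes>\<^bsub>bipoly_ring m n\<^esub> h3 \<and>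
        bihomogeneous m n (\<alpha>1, 0) h1 \<and> \<alpha>1 > 0 \<and>
        bihomogeneous m n (\<alpha>2, \<beta>1) h2 \<and> \<alpha>2 > 0 \<and> \<beta>1 > 0 \<and>
        bihomogeneous m n (0, \<beta>2) h3 \<and> \<beta>2 > 0 \<and>
        \<alpha>1 + \<alpha>2 = a \<and> \<beta>1 + \<beta>2 = b) \<or>
    (\<exists>h2 h3 \<alpha>2 \<beta>1 \<beta>2.
        f = h2 \<otimes>\<^bsub>bipoly_ring m n\<^esub> h3 \<and>
        bihomogeneous m n (\<alpha>2, \<beta>1) h2 \<and> a = \<alpha>2 \<and> \<alpha>2 > 0 \<and> \<beta>1 > 0 \<and>
        bihomogeneous m n (0, \<beta>2) h3 \<and> \<beta>2 > 0 \<and>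
        \<beta>1 + \<beta>2 = b) \<or>
    (\<exists>h1 h3.
        f = h1 \<otimes>\<^bsub>bipoly_ring m n\<^esub> h3 \<and>
        bihomogeneous m n (a, 0) h1 \<and> a \<ge> 0 \<and>
        bihomogeneous m n (0, b) h3 \<and> b \<ge> 0)"
proof -
  have f: "f \<noteq> 0" "\<not> f dvd 1" using assms(2,3) by (simp_all add: bipoly_Units)
  show ?thesis
    unfolding bipoly_simps
    using maximal_depth_iff_y_divisor[OF assms(1) f] decomposition_iff_y_divisor[OF assms(1) f(1)]
    by (rule trans[OF _ sym])
qed

end
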